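(* Let $\zeta$ be a primitive aperiodic substitution on $\mathcal{A}=\{0,1\}$ of non-constant length, such that the substitution matrix $\mathsf{S}_\zeta$ has two integer eigenvalues, both greater than one in absolute value. Let $\theta_1$ be the Perron–Frobenius eigenvalue of $\mathsf{S}_\zeta$. If $$\chi(\mathscr{M}_\zeta)<\frac{\log\theta_1}{2},$$ then the substitution $\mathbb{Z}$-action $(X_\zeta,T,\mu)$ has pure singular spectrum.
   Context: A substitution is a map $\zeta:\mathcal{A}\to\mathcal{A}^+$ extended to words by concatenation; it has constant length if $|\zeta(a)|$ is the same for all $a$, non-constant length otherwise. $X_\zeta$ is the set of $x\in\mathcal{A}^{\mathbb{Z}}$ all of whose finite subwords occur in some $\zeta^n(a)$; $T$ is the left shift on $X_\zeta$, $\mu$ its unique invariant probability measure. $\mathsf{S}_\zeta(i,j)$ = number of $i$'s in $\zeta(j)$; primitive means some power of $\mathsf{S}_\zeta$ is strictly positive; aperiodic means $X_\zeta$ is infinite. Pure singular spectrum: the maximal spectral type of $f\mapsto f\circ T$ on $L^2(X_\zeta,\mu)$ is singular w.r.t. Lebesgue measure. With $\zeta(b)=u^b_1\cdots u^b_{|\zeta(b)|}$, define for $\xi\in\mathbb{R}^d$ ($d=2$) the matrix $[\mathscr{M}_\zeta(\xi)]_{b,c}=\sum_{j\le|\zeta(b)|,\,u^b_j=c}\exp(-2\pi i\sum_{k=1}^{j-1}\xi_{u^b_k})$, viewed on $\mathbb{T}^d$; $E_\zeta\xi=\mathsf{S}_\zeta^t\xi\pmod{\mathbb{Z}^d}$;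 $\mathscr{M}_\zeta(\xi,n)=\mathscr{M}_\zeta(E_\zeta^{n-1}\xi)\cdots\mathscr{M}_\zeta(\xi)$. Since no eigenvalue is a root of unity, $E_\zeta$ is ergodic for Haar measure and $\chi(\mathscr{M}_\zeta)=\lim_n\frac1n\log\|\mathscr{M}_\zeta(\xi,n)\|$ exists and is constant a.e. *)

theory Defs
  imports "HOL-Probability.Probability"
begin

definition is_substitution :: "('a \<Rightarrow> 'a list) \<Rightarrow> bool" where
  "is_substitution \<zeta> \<longleftrightarrow> (\<forall>a. \<zeta> a \<noteq> [])"

definition subst_word :: "('a \<Rightarrow> 'a list) \<Rightarrow> 'a list \<Rightarrow> 'a list" where
  "subst_word \<zeta> w = concat (map \<zeta> w)"

definition subst_iter :: "('a \<Rightarrow> 'a list) \<Rightarrow> nat \<Rightarrow> 'a \<Rightarrow> 'a list" where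
  "subst_iter \<zeta> n a = (subst_word \<zeta> ^^ n) [a]"

definition constant_length :: "('a \<Rightarrow> 'a list) \<Rightarrow> bool" where
  "constant_length \<zeta> \<longleftrightarrow> (\<forall>a b. length (\<zeta> a) = length (\<zeta> b))"

definition subst_matrix :: "('a::finite \<Rightarrow> 'a list) \<Rightarrow> real^'a^'a" where
  "subst_matrix \<zeta> = (\<chi> i j. real (count_list (\<zeta> j) i))"

fun mat_pow :: "'b::semiring_1^'a::finite^'a \<Rightarrow> nat \<Rightarrow> 'b^'a^'a" where
  "mat_pow A 0 = mat 1"
| "mat_pow A (Suc n) = A ** mat_pow A n"

definition primitive :: "('a::finite \<Rightarrow> 'a list) \<Rightarrow> bool" where
  "primitive \<zeta> \<longleftrightarrow> (\<exists>n>0. \<forall>i j. mat_pow (subst_matrix \<zeta>) n $ i $ j > 0)"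

definition subwords :: "'a list \<Rightarrow> 'a list set" where
  "subwords w = {v. \<exists>p s. w = p @ v @ s}"

definition subst_language :: "('a \<Rightarrow> 'a list) \<Rightarrow> 'a list set" where
  "subst_language \<zeta> = (\<Union>n a. subwords (subst_iter \<zeta> n a))"

definition block :: "(int \<Rightarrow> 'a) \<Rightarrow> int \<Rightarrow> nat \<Rightarrow> 'a list" where
  "block x m k = map (\<lambda>i. x (m + int i)) [0..<k]"

definition subst_shift_space :: "('a \<Rightarrow> 'a list) \<Rightarrow> (int \<Rightarrow> 'a) set" where
  "subst_shift_space \<zeta> = {x. \<forall>m k. block x m k \<in> subst_language \<zeta>}"

definition aperiodic :: "('a \<Rightarrow> 'a list) \<Rightarrow> bool" where
  "aperiodic \<zeta> \<longleftrightarrow> infinite (subst_shift_space \<zeta>)"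

definition shift :: "(int \<Rightarrow> 'a) \<Rightarrow> int \<Rightarrow> 'a" where
  "shift x = (\<lambda>k. x (k + 1))"

definition shift_pow :: "int \<Rightarrow> (int \<Rightarrow> 'a) \<Rightarrow> int \<Rightarrow> 'a" where
  "shift_pow n x = (\<lambda>k. x (k + n))"

definition full_shift_space :: "(int \<Rightarrow> 'a) measure" where
  "full_shift_space = PiM UNIV (\<lambda>_. count_space UNIV)"

definition invariant_prob_on :: "('a \<Rightarrow> 'a list) \<Rightarrow> (int \<Rightarrow> 'a) measure \<Rightarrow> bool" where
  "invariant_prob_on \<zeta> \<mu> \<longleftrightarrow>
     sets \<mu> = sets full_shift_space \<and> prob_space \<mu> \<and>
     emeasure \<mu> (subst_shift_space \<zeta>) = 1 \<and> distr \<mu> \<mu> shift = \<mu>"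

text \<open>sigma is a spectral measure (on the circle, parametrised by [0,1)) of f for the
  Koopman operator U f = f o T on L^2(mu):
  its Fourier coefficients are  sigma^(n) = <U^n f, f>  for all n in Z.\<close>
definition spectral_measure_of ::
  "(int \<Rightarrow> 'a) measure \<Rightarrow> ((int \<Rightarrow> 'a) \<Rightarrow> complex) \<Rightarrow> real measure \<Rightarrow> bool" where
  "spectral_measure_of \<mu> f \<sigma> \<longleftrightarrow>
     sets \<sigma> = sets borel \<and> finite_measure \<sigma> \<and> emeasure \<sigma> (UNIV - {0..<1}) = 0 \<and>
     (\<forall>n::int. (\<integral>t. exp (- 2 * pi * \<i> * of_int n * of_real t) \<partial>\<sigma>) =
                (\<integral>x. f (shift_pow n x) * cnj (f x) \<partial>\<mu>))"

definition singular_lebesgue :: "real measure \<Rightarrow> bool" where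
  "singular_lebesgue \<sigma> \<longleftrightarrow>
     (\<exists>N \<in> sets borel. emeasure lborel N = 0 \<and> emeasure \<sigma> (UNIV - N) = 0)"

text \<open>Pure singular spectrum: the maximal spectral type is singular, i.e. every spectral
  measure sigma_f, f in L^2(mu), is singular w.r.t. Lebesgue measure.\<close>
definition pure_singular_spectrum :: "(int \<Rightarrow> 'a) measure \<Rightarrow> bool" where
  "pure_singular_spectrum \<mu> \<longleftrightarrow>
     (\<forall>f \<sigma>. f \<in> borel_measurable \<mu> \<and> integrable \<mu> (\<lambda>x. (cmod (f x))^2) \<and>
            spectral_measure_of \<mu> f \<sigma> \<longrightarrow> singular_lebesgue \<sigma>)"

definition fourier_matrix :: "('a::finite \<Rightarrow> 'a list) \<Rightarrow> real^'a \<Rightarrow> complex^'a^'a" where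
  "fourier_matrix \<zeta> \<xi> = (\<chi> b c. \<Sum>j \<in> {j. j < length (\<zeta> b) \<and> \<zeta> b ! j = c}.
       exp (- 2 * pi * \<i> * of_real (\<Sum>k<j. \<xi> $ (\<zeta> b ! k))))"

text \<open>E xi = S^t xi; taken in R^d (M is Z^d-periodic, so reduction mod Z^d is immaterial).\<close>
definition torus_endo :: "('a::finite \<Rightarrow> 'a list) \<Rightarrow> real^'a \<Rightarrow> real^'a" where
  "torus_endo \<zeta> \<xi> = transpose (subst_matrix \<zeta>) *v \<xi>"

fun fourier_cocycle :: "('a::finite \<Rightarrow> 'a list) \<Rightarrow> real^'a \<Rightarrow> nat \<Rightarrow> complex^'a^'a" where
  "fourier_cocycle \<zeta> \<xi> 0 = mat 1"
| "fourier_cocycle \<zeta> \<xi> (Suc n) =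
     fourier_matrix \<zeta> ((torus_endo \<zeta> ^^ n) \<xi>) ** fourier_cocycle \<zeta> \<xi> n"

definition is_lyapunov_exponent :: "('a::finite \<Rightarrow> 'a list) \<Rightarrow> real \<Rightarrow> bool" where
  "is_lyapunov_exponent \<zeta> \<chi>' \<longleftrightarrow>
     (AE \<xi> in lborel. (\<lambda>n. ln (norm (fourier_cocycle \<zeta> \<xi> n)) / real n) \<longlonglongrightarrow> \<chi>')"

definition is_eigenvalue :: "real^'a::finite^'a \<Rightarrow> real \<Rightarrow> bool" where
  "is_eigenvalue A l \<longleftrightarrow> (\<exists>v. v \<noteq> 0 \<and> A *v v = l *\<^sub>R v)"

definition pf_eigenvalue :: "real^'a::finite^'a \<Rightarrow> real" where
  "pf_eigenvalue A = (THE l. \<exists>v. (\<forall>i. v $ i > 0) \<and> A *v v = l *\<^sub>R v)"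

end

(*
  For a function g depending on finitely many coordinates, twisted Birkhoff sums over the words
  zeta^n(a) satisfy h_(n+1) = M(E^n(w,w)) h_n + O(1), hence they are controlled by products of blocks
  of the cocycle along the diagonal. Since the diagonal is not an
  eigendirection and both eigenvalues exceed 1 in absolute value, the frequencies <p, E^(jK)(1,1)> are
  eventually strictly increasing in absolute value for every integer vector p other than 0.
  Orthogonality and trigonometric approximation then show that averages of a continuous function on
  the torus along E^(jK)(w,w) converge in measure to its integral. With the hypothesis on the
  exponent, the sums of length N are o(sqrt N) outside a set of w of small measure, and by density
  and the identity (average over w of |S_N f|^2) = N |f|^2 the same holds in L^2 for every square
  integrable f. As |S_N f|^2 is the integral of a squared Dirichlet kernel against the spectral
  measure, the latter gives mass at most epsilon to a set of Lebesgue measure at least 1 - epsilon.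
*)
theory Submission
  imports Defs "HOL-Real_Asymp.Real_Asymp"
begin

section \<open>Twisted sums over substituted words\<close>

text \<open>The hypothesis holds almost everywhere on the torus, whereas the spectral measure only
  sees the diagonal, a null set on which the exponent need not be attained. The exponent is
  therefore used just once, under an integral: a block length K is fixed for which the mean of the
  continuous function log^+ |M(xi,K)| / K over the torus lies below half of log theta_1. Continuity
  is what transfers to the diagonal. Only convergence in measure is available there, so exceptional
  sets of w of small positive measure have to be tolerated. The same tolerance pays for the passage
  to all of L^2: bounds at a fixed w are not stable under L^2 limits, but the average over w is, and
  Markov's inequality turns a small average into one more small exceptional set. The factor 2 in the
  hypothesis comes from squaring: up to polynomial factors, energies of size exp(2 K J gamma) with
  gamma < log theta_1 / 2 compete with the length N, which is at least a constant times
  theta_1^(JK).\<close>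

definition twist :: "real \<Rightarrow> complex" where
  "twist t = exp (- 2 * pi * \<i> * of_real t)"

lemma twist_add: "twist (s + t) = twist s * twist t"
  by (simp add: twist_def exp_add [symmetric] algebra_simps)

lemma norm_twist [simp]: "cmod (twist t) = 1"
proof -
  have "twist t = exp (\<i> * of_real (- 2 * pi * t))"
    by (simp add: twist_def mult_ac)
  then show ?thesis
    by (metis norm_exp_i_times)
qed

lemma twist_0 [simp]: "twist 0 = 1"
  by (simp add: twist_def)

lemma twist_eq_1_iff: "twist t = 1 \<longleftrightarrow> t \<in> \<int>"
proof -
  have "twist t = 1 \<longleftrightarrow> (\<exists>n::int. - (2 * pi * t) = of_int (2 * n) * pi)"
    by (simp add: twist_def exp_eq_1)
  also have "\<dots> \<longleftrightarrow> (\<exists>n::int. t = of_int (- n))"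
  proof -
    have "- (2 * pi * t) = of_int (2 * n) * pi \<longleftrightarrow> t = of_int (- n)" for n :: int
    proof -
      have "- (2 * pi * t) = of_int (2 * n) * pi \<longleftrightarrow> (2 * pi) * t = (2 * pi) * (- of_int n)"
        by (auto simp: algebra_simps)
      also have "\<dots> \<longleftrightarrow> t = of_int (- n)"
        unfolding mult_cancel_left by simp
      finally show ?thesis .
    qed
    then show ?thesis by simp
  qed
  also have "\<dots> \<longleftrightarrow> t \<in> \<int>"
    by (metis Ints_cases Ints_of_int minus_minus)
  finally show ?thesis .
qed

lemma twist_minus: "twist (- t) = cnj (twist t)"
  by (simp add: twist_def exp_cnj)

lemma cmod_add_sq_le: "(cmod (a + b))\<^sup>2 \<le> 2 * (cmod a)\<^sup>2 + 2 * (cmod b)\<^sup>2"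
proof -
  have "(cmod (a + b))\<^sup>2 \<le> (cmod a + cmod b)\<^sup>2" by (intro power_mono norm_triangle_ineq) auto
  also have "\<dots> \<le> 2 * (cmod a)\<^sup>2 + 2 * (cmod b)\<^sup>2"
    using sum_squares_bound[of "cmod a" "cmod b"] by (simp add: power2_sum)
  finally show ?thesis .
qed

text \<open>Windows that run over the end of the word are truncated rather than dropped; this makes
  the sum additive under concatenation up to an error depending only on the window length.\<close>

definition twisted_sum :: "('a list \<Rightarrow> complex) \<Rightarrow> nat \<Rightarrow> real \<Rightarrow> 'a list \<Rightarrow> complex" where
  "twisted_sum \<phi> q \<omega> w = (\<Sum>j<length w. \<phi> (take q (drop j w)) * twist (\<omega> * real j))"

lemma twisted_sum_Nil [simp]: "twisted_sum \<phi> q \<omega> [] = 0"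
  by (simp add: twisted_sum_def)

text \<open>Only the last \<open>q\<close> starting points can see past the end, and each costs at
  most \<open>2 * B\<close>. The phases \<open>c\<close> are arbitrary, so the same bound serves
  words and blocks of a bi-infinite sequence.\<close>

lemma sum_boundary_bound:
  fixes f g :: "nat \<Rightarrow> complex"
  assumes "\<And>j. j + q \<le> n \<Longrightarrow> f j = g j" "\<And>j. cmod (f j) \<le> B" "\<And>j. cmod (g j) \<le> B"
  shows "cmod ((\<Sum>j<n. f j * twist (c j)) - (\<Sum>j<n. g j * twist (c j))) \<le> 2 * B * real q"
proof -
  have B: "0 \<le> B" using assms(2)[of 0] norm_ge_zero order_trans by blast
  have "(\<Sum>j<n. f j * twist (c j)) - (\<Sum>j<n. g j * twist (c j))
      = (\<Sum>j<n. (f j - g j) * twist (c j))"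
    by (simp add: sum_subtractf algebra_simps)
  also have "\<dots> = (\<Sum>j\<in>{n - q..<n}. (f j - g j) * twist (c j))"
    by (rule sum.mono_neutral_right) (use assms(1) in auto)
  also have "cmod \<dots> \<le> (\<Sum>j\<in>{n - q..<n}. 2 * B)"
  proof (rule sum_norm_le)
    fix j show "cmod ((f j - g j) * twist (c j)) \<le> 2 * B"
      using norm_triangle_ineq4[of "f j" "g j"] assms(2)[of j] assms(3)[of j]
      by (simp add: norm_mult)
  qed
  also have "\<dots> = 2 * B * real (n - (n - q))" by simp
  also have "\<dots> \<le> 2 * B * real q"
    by (rule mult_left_mono) (use B in auto)
  finally show ?thesis .
qed

lemma sum_lessThan_add:
  fixes f :: "nat \<Rightarrow> 'b::comm_monoid_add"
  shows "(\<Sum>j<m + n. f j) = (\<Sum>j<m. f j) + (\<Sum>j<n. f (m + j))"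
  by (induction n) (simp_all add: add.assoc)

text \<open>Only windows that start in \<open>u\<close> less than \<open>q\<close> letters before
  its end read into \<open>v\<close>; the windows of \<open>v\<close> are shifted by
  \<open>length u\<close>, which is the phase in front of its sum.\<close>

lemma twisted_sum_append:
  assumes "\<And>w. cmod (\<phi> w) \<le> B"
  shows "cmod (twisted_sum \<phi> q \<omega> (u @ v) -
    (twisted_sum \<phi> q \<omega> u + twist (\<omega> * real (length u)) * twisted_sum \<phi> q \<omega> v)) \<le> 2 * B * real q"
proof -
  let ?f = "\<lambda>j. \<phi> (take q (drop j (u @ v)))"
  have "twisted_sum \<phi> q \<omega> (u @ v) = (\<Sum>j<length u. ?f j * twist (\<omega> * real j))
      + (\<Sum>j<length v. ?f (length u + j) * twist (\<omega> * real (length u + j)))"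
    by (simp add: twisted_sum_def sum_lessThan_add)
  also have "(\<Sum>j<length v. ?f (length u + j) * twist (\<omega> * real (length u + j))) =
      twist (\<omega> * real (length u)) * twisted_sum \<phi> q \<omega> v"
    by (simp add: twisted_sum_def sum_distrib_left twist_add distrib_left mult_ac)
  finally have "twisted_sum \<phi> q \<omega> (u @ v) -
      (twisted_sum \<phi> q \<omega> u + twist (\<omega> * real (length u)) * twisted_sum \<phi> q \<omega> v) =
      (\<Sum>j<length u. ?f j * twist (\<omega> * real j)) -
      (\<Sum>j<length u. \<phi> (take q (drop j u)) * twist (\<omega> * real j))"
    by (simp add: twisted_sum_def)
  also have "cmod \<dots> \<le> 2 * B * real q"
    by (rule sum_boundary_bound) (use assms in auto)
  finally show ?thesis .
qed

text \<open>The second inequality allows a subword to be treated as the difference of two prefixes,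
  so that only prefixes have to be estimated later.\<close>

lemma norm_twisted_sum_append_le:
  assumes "\<And>w. cmod (\<phi> w) \<le> B"
  shows "cmod (twisted_sum \<phi> q \<omega> (u @ v)) \<le>
    cmod (twisted_sum \<phi> q \<omega> u) + cmod (twisted_sum \<phi> q \<omega> v) + 2 * B * real q"
    and "cmod (twisted_sum \<phi> q \<omega> v) \<le>
    cmod (twisted_sum \<phi> q \<omega> u) + cmod (twisted_sum \<phi> q \<omega> (u @ v)) + 2 * B * real q"
proof -
  define a where "a = twisted_sum \<phi> q \<omega> (u @ v)"
  define b where "b = twisted_sum \<phi> q \<omega> u"
  define c where "c = twist (\<omega> * real (length u)) * twisted_sum \<phi> q \<omega> v"
  have c: "cmod c = cmod (twisted_sum \<phi> q \<omega> v)" by (simp add: c_def norm_mult)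
  have *: "cmod (a - (b + c)) \<le> 2 * B * real q"
    unfolding a_def b_def c_def by (rule twisted_sum_append) (rule assms)
  have "cmod a \<le> cmod (a - (b + c)) + cmod b + cmod c"
    using norm_triangle_ineq[of "a - (b + c)" "b + c"] norm_triangle_ineq[of b c] by simp
  with * show "cmod (twisted_sum \<phi> q \<omega> (u @ v)) \<le>
    cmod (twisted_sum \<phi> q \<omega> u) + cmod (twisted_sum \<phi> q \<omega> v) + 2 * B * real q"
    unfolding a_def b_def c by simp
  have "cmod c \<le> cmod (a - (b + c)) + cmod b + cmod a"
    using norm_triangle_ineq4[of "a - b" "a - (b + c)"] norm_triangle_ineq4[of a b] by simp
  with * show "cmod (twisted_sum \<phi> q \<omega> v) \<le>
    cmod (twisted_sum \<phi> q \<omega> u) + cmod (twisted_sum \<phi> q \<omega> (u @ v)) + 2 * B * real q"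
    unfolding a_def b_def c by simp
qed

lemma twisted_sum_concat:
  assumes "\<And>w. cmod (\<phi> w) \<le> B"
  shows "cmod (twisted_sum \<phi> q \<omega> (concat ws) -
    (\<Sum>i<length ws. twist (\<omega> * real (length (concat (take i ws)))) * twisted_sum \<phi> q \<omega> (ws ! i)))
    \<le> 2 * B * real q * real (length ws)"
proof (induction ws)
  case (Cons w ws)
  let ?S = "\<Sum>i<length ws. twist (\<omega> * real (length (concat (take i ws)))) * twisted_sum \<phi> q \<omega> (ws ! i)"
  let ?t = "twist (\<omega> * real (length w))"
  have S: "(\<Sum>i<length (w # ws). twist (\<omega> * real (length (concat (take i (w # ws))))) * twisted_sum \<phi> q \<omega> ((w # ws) ! i))
    = twisted_sum \<phi> q \<omega> w + ?t * ?S"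
    by (simp add: sum.lessThan_Suc_shift sum_distrib_left twist_add distrib_left mult_ac
        del: sum.lessThan_Suc)
  have eq: "twisted_sum \<phi> q \<omega> (concat (w # ws)) - (twisted_sum \<phi> q \<omega> w + ?t * ?S) =
      (twisted_sum \<phi> q \<omega> (w @ concat ws) - (twisted_sum \<phi> q \<omega> w + ?t * twisted_sum \<phi> q \<omega> (concat ws)))
      + ?t * (twisted_sum \<phi> q \<omega> (concat ws) - ?S)"
    by (simp add: algebra_simps)
  have "cmod (twisted_sum \<phi> q \<omega> (concat (w # ws)) - (twisted_sum \<phi> q \<omega> w + ?t * ?S))
      \<le> 2 * B * real q + 2 * B * real q * real (length ws)"
    unfolding eq
    by (rule norm_triangle_mono)
      (use Cons.IH twisted_sum_append[of \<phi> B q \<omega> w "concat ws", OF assms] in \<open>simp_all add: norm_mult\<close>)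
  then show ?case
    unfolding S by (simp add: algebra_simps)
qed simp

text \<open>The windows of \<open>x\<close> run past the end of the block while
  \<open>twisted_sum\<close> truncates them; the two agree as soon as the whole window fits.\<close>

lemma twisted_sum_block:
  assumes "\<And>w. cmod (\<phi> w) \<le> B"
  shows "cmod ((\<Sum>j<N. \<phi> (block x (a + int j) q) * twist (\<omega> * real j)) -
    twisted_sum \<phi> q \<omega> (block x a N)) \<le> 2 * B * real q"
proof -
  have "twisted_sum \<phi> q \<omega> (block x a N) =
      (\<Sum>j<N. \<phi> (take q (drop j (block x a N))) * twist (\<omega> * real j))"
    by (simp add: twisted_sum_def block_def)
  moreover have "\<phi> (block x (a + int j) q) = \<phi> (take q (drop j (block x a N)))" if "j + q \<le> N" for j
  proof -
    have "take q (drop j (block x a N)) = block x (a + int j) q"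
      by (rule nth_equalityI) (use that in \<open>auto simp: block_def algebra_simps\<close>)
    then show ?thesis by simp
  qed
  ultimately show ?thesis
    using assms by (auto intro!: sum_boundary_bound)
qed

section \<open>Powers of the substitution and the phases on the diagonal\<close>

lemma funpow_subst_word_append:
  "(subst_word \<zeta> ^^ n) (u @ v) = (subst_word \<zeta> ^^ n) u @ (subst_word \<zeta> ^^ n) v"
  by (induction n) (simp_all add: subst_word_def)

lemma funpow_subst_word: "(subst_word \<zeta> ^^ n) w = concat (map (subst_iter \<zeta> n) w)"
proof (induction w)
  case Nil
  show ?case by (induction n) (simp_all add: subst_word_def)
next
  case (Cons a w)
  then show ?case
    using funpow_subst_word_append[of n \<zeta> "[a]" w] by (simp add: subst_iter_def)
qed

lemma subst_iter_0 [simp]: "subst_iter \<zeta> 0 a = [a]"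
  by (simp add: subst_iter_def)

lemma subst_iter_add: "subst_iter \<zeta> (m + n) a = concat (map (subst_iter \<zeta> m) (subst_iter \<zeta> n a))"
  by (simp add: subst_iter_def funpow_add flip: funpow_subst_word)

lemma subst_iter_1: "subst_iter \<zeta> (Suc 0) a = \<zeta> a"
  by (simp add: subst_iter_def subst_word_def)

text \<open>The single step acts on the letter and the power \<open>n\<close> on the result: this
  order makes the newest factor of \<open>fourier_cocycle\<close> stand on the left, evaluated at
  the \<open>n\<close>-th point of the orbit.\<close>

lemma subst_iter_Suc: "subst_iter \<zeta> (Suc n) a = concat (map (subst_iter \<zeta> n) (\<zeta> a))"
  using subst_iter_add[of \<zeta> n "Suc 0" a] by (simp add: subst_iter_1)

lemma sum_list_map_count_list:
  fixes f :: "'a::finite \<Rightarrow> real"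
  shows "sum_list (map f w) = (\<Sum>i\<in>UNIV. real (count_list w i) * f i)"
proof (induction w)
  case (Cons a w)
  have "(\<Sum>i\<in>UNIV. real (count_list (a # w) i) * f i) =
      (\<Sum>i\<in>UNIV. (if i = a then f i else 0) + real (count_list w i) * f i)"
    by (rule sum.cong) (auto simp: algebra_simps)
  also have "\<dots> = f a + (\<Sum>i\<in>UNIV. real (count_list w i) * f i)"
    by (simp add: sum.distrib)
  finally show ?case using Cons by simp
qed simp

lemma torus_endo_nth: "torus_endo \<zeta> \<xi> $ b = sum_list (map (\<lambda>a. \<xi> $ a) (\<zeta> b))"
  by (simp add: torus_endo_def matrix_vector_mult_def transpose_def subst_matrix_def
      sum_list_map_count_list)

lemma length_concat_map: "real (length (concat (map f w))) = sum_list (map (\<lambda>a. real (length (f a))) w)"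
  by (induction w) auto

text \<open>The transposed substitution matrix sends the vector of lengths at level \<open>n\<close>
  to that at level \<open>n + 1\<close>. Hence the phases of twisted sums are coordinates of the
  orbit of a diagonal point.\<close>

lemma funpow_torus_endo_diagonal:
  "((torus_endo \<zeta> ^^ n) (\<chi> i. \<omega>)) $ b = \<omega> * real (length (subst_iter \<zeta> n b))"
proof (induction n arbitrary: b)
  case (Suc n)
  have "((torus_endo \<zeta> ^^ Suc n) (\<chi> i. \<omega>)) $ b =
     sum_list (map (\<lambda>a. \<omega> * real (length (subst_iter \<zeta> n a))) (\<zeta> b))"
    by (simp add: torus_endo_nth Suc del: map_eq_conv)
  then show ?case
    by (simp add: subst_iter_Suc length_concat_map sum_list_const_mult)
qed simp

lemma fourier_matrix_mult_vec:
  "(fourier_matrix \<zeta> \<xi> *v h) $ b =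
    (\<Sum>j<length (\<zeta> b). twist (\<Sum>k<j. \<xi> $ (\<zeta> b ! k)) * h $ (\<zeta> b ! j))"
proof -
  let ?t = "\<lambda>j. twist (\<Sum>k<j. \<xi> $ (\<zeta> b ! k))"
  have "(\<Sum>j<length (\<zeta> b). ?t j * h $ (\<zeta> b ! j)) =
      (\<Sum>c\<in>UNIV. \<Sum>j\<in>{j\<in>{..<length (\<zeta> b)}. \<zeta> b ! j = c}. ?t j * h $ (\<zeta> b ! j))"
    by (rule sum.group[symmetric]) auto
  also have "\<dots> = (\<Sum>c\<in>UNIV. \<Sum>j\<in>{j. j < length (\<zeta> b) \<and> \<zeta> b ! j = c}. ?t j * h $ c)"
    by (intro sum.cong) auto
  finally show ?thesis
    by (simp add: fourier_matrix_def matrix_vector_mult_def twist_def sum_distrib_right)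
qed

definition level_sums ::
  "('a::finite \<Rightarrow> 'a list) \<Rightarrow> ('a list \<Rightarrow> complex) \<Rightarrow> nat \<Rightarrow> real \<Rightarrow> nat \<Rightarrow> complex^'a" where
  "level_sums \<zeta> \<phi> q \<omega> n = (\<chi> b. twisted_sum \<phi> q \<omega> (subst_iter \<zeta> n b))"

text \<open>The word of level \<open>n + 1\<close> is cut into words of level \<open>n\<close>, one
  for each letter of the image of \<open>b\<close>, and the phase at each cut is exactly the
  exponent in the Fourier matrix. What is left is one boundary error per cut, uniform in
  \<open>n\<close> and in the frequency.\<close>

lemma level_sums_Suc:
  fixes \<zeta> :: "'a::finite \<Rightarrow> 'a list"
  assumes "\<And>w. cmod (\<phi> w) \<le> B"
  shows "norm (level_sums \<zeta> \<phi> q \<omega> (Suc n) -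
      fourier_matrix \<zeta> ((torus_endo \<zeta> ^^ n) (\<chi> i. \<omega>)) *v level_sums \<zeta> \<phi> q \<omega> n)
    \<le> (\<Sum>b\<in>UNIV. 2 * B * real q * real (length (\<zeta> b)))"
proof -
  let ?\<xi> = "(torus_endo \<zeta> ^^ n) (\<chi> i. \<omega>)"
  let ?d = "level_sums \<zeta> \<phi> q \<omega> (Suc n) - fourier_matrix \<zeta> ?\<xi> *v level_sums \<zeta> \<phi> q \<omega> n"
  have "norm (?d $ b) \<le> 2 * B * real q * real (length (\<zeta> b))" for b
  proof -
    let ?ws = "map (subst_iter \<zeta> n) (\<zeta> b)"
    have phase: "\<omega> * real (length (concat (take j ?ws))) = (\<Sum>k<j. ?\<xi> $ (\<zeta> b ! k))"
      if "j < length (\<zeta> b)" for j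
    proof -
      have "real (length (concat (take j ?ws))) =
          sum_list (map (\<lambda>a. real (length (subst_iter \<zeta> n a))) (take j (\<zeta> b)))"
        by (simp add: take_map length_concat_map)
      also have "\<dots> = (\<Sum>k<j. real (length (subst_iter \<zeta> n (\<zeta> b ! k))))"
        using that by (simp add: sum_list_sum_nth atLeast0LessThan)
      finally show ?thesis
        by (simp add: funpow_torus_endo_diagonal sum_distrib_left)
    qed
    have "(fourier_matrix \<zeta> ?\<xi> *v level_sums \<zeta> \<phi> q \<omega> n) $ b =
      (\<Sum>i<length ?ws. twist (\<omega> * real (length (concat (take i ?ws)))) * twisted_sum \<phi> q \<omega> (?ws ! i))"
      unfolding fourier_matrix_mult_vec
      by (auto intro!: sum.cong simp: phase level_sums_def)
    moreover have "level_sums \<zeta> \<phi> q \<omega> (Suc n) $ b = twisted_sum \<phi> q \<omega> (concat ?ws)"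
      by (simp add: level_sums_def subst_iter_Suc)
    ultimately show ?thesis
      using twisted_sum_concat[of \<phi> B q \<omega> ?ws, OF assms] by simp
  qed
  then have "(\<Sum>b\<in>UNIV. norm (?d $ b)) \<le> (\<Sum>b\<in>UNIV. 2 * B * real q * real (length (\<zeta> b)))"
    by (intro sum_mono)
  moreover have "norm ?d \<le> (\<Sum>b\<in>UNIV. norm (?d $ b))"
    by (simp add: norm_vec_def L2_set_le_sum)
  ultimately show ?thesis by linarith
qed

section \<open>The spectral cocycle\<close>

text \<open>The norm on nested vectors is the Frobenius norm, so Cauchy-Schwarz in each row
  suffices.\<close>

lemma norm_matrix_vector_mult_le:
  fixes A :: "complex^'n^'m" and x :: "complex^'n"
  shows "norm (A *v x) \<le> norm A * norm x"
proof -
  have "norm ((A *v x) $ i) \<le> norm (A $ i) * norm x" for i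
  proof -
    have "norm ((A *v x) $ i) \<le> (\<Sum>j\<in>UNIV. norm (A $ i $ j * x $ j))"
      unfolding matrix_vector_mult_def by (simp add: norm_sum)
    also have "\<dots> = (\<Sum>j\<in>UNIV. \<bar>norm (A $ i $ j)\<bar> * \<bar>norm (x $ j)\<bar>)"
      by (simp add: norm_mult)
    also have "\<dots> \<le> norm (A $ i) * norm x"
      unfolding norm_vec_def[of "A $ i"] norm_vec_def[of x] by (rule L2_set_mult_ineq)
    finally show ?thesis .
  qed
  then have "norm (A *v x) \<le> L2_set (\<lambda>i. norm (A $ i) * norm x) UNIV"
    unfolding norm_vec_def[of "A *v x"] by (intro L2_set_mono) auto
  also have "\<dots> = norm A * norm x"
    unfolding norm_vec_def[of A] by (simp add: L2_set_left_distrib)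
  finally show ?thesis .
qed

text \<open>Each row of the product is a combination of the rows of \<open>B\<close>; Cauchy-Schwarz
  applies to its coefficients and the norms of those rows.\<close>

lemma norm_matrix_mult_le:
  fixes A :: "complex^'n^'m" and B :: "complex^'k^'n"
  shows "norm (A ** B) \<le> norm A * norm B"
proof -
  have "norm ((A ** B) $ i) \<le> norm (A $ i) * norm B" for i
  proof -
    have "norm ((A ** B) $ i) = norm (\<Sum>k\<in>UNIV. (\<chi> j. A $ i $ k * B $ k $ j))"
      by (rule arg_cong[where f = norm]) (simp add: matrix_matrix_mult_def vec_eq_iff)
    also have "\<dots> \<le> (\<Sum>k\<in>UNIV. norm (\<chi> j. A $ i $ k * B $ k $ j))"
      by (rule norm_sum)
    also have "\<dots> = (\<Sum>k\<in>UNIV. \<bar>norm (A $ i $ k)\<bar> * \<bar>norm (B $ k)\<bar>)"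
      by (simp add: norm_vec_def norm_mult L2_set_right_distrib)
    also have "\<dots> \<le> norm (A $ i) * norm B"
      unfolding norm_vec_def[of "A $ i"] norm_vec_def[of B] by (rule L2_set_mult_ineq)
    finally show ?thesis .
  qed
  then have "norm (A ** B) \<le> L2_set (\<lambda>i. norm (A $ i) * norm B) UNIV"
    unfolding norm_vec_def[of "A ** B"] by (intro L2_set_mono) auto
  also have "\<dots> = norm A * norm B"
    unfolding norm_vec_def[of A] by (simp add: L2_set_left_distrib)
  finally show ?thesis .
qed

lemma fourier_matrix_bounded:
  fixes \<zeta> :: "'a::finite \<Rightarrow> 'a list"
  obtains C where "C \<ge> 1" "\<And>\<xi>. norm (fourier_matrix \<zeta> \<xi>) \<le> C"
proof
  \<comment> \<open>The summand 1 gives \<open>C \<ge> 1\<close>, so that \<open>C ^ n\<close> is at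
    least 1 and \<open>ln C\<close> nonnegative when logarithms are dominated.\<close>
  let ?C = "1 + (\<Sum>b\<in>(UNIV::'a set). \<Sum>c\<in>(UNIV::'a set). real (length (\<zeta> b)))"
  show "?C \<ge> 1" by (simp add: sum_nonneg)
  fix \<xi>
  have "norm (fourier_matrix \<zeta> \<xi>) \<le> (\<Sum>b\<in>UNIV. \<Sum>c\<in>UNIV. norm (fourier_matrix \<zeta> \<xi> $ b $ c))"
  proof -
    have "norm (fourier_matrix \<zeta> \<xi>) \<le> (\<Sum>b\<in>UNIV. norm (fourier_matrix \<zeta> \<xi> $ b))"
      by (simp add: norm_vec_def L2_set_le_sum)
    also have "\<dots> \<le> (\<Sum>b\<in>UNIV. \<Sum>c\<in>UNIV. norm (fourier_matrix \<zeta> \<xi> $ b $ c))"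
      by (intro sum_mono) (simp add: norm_vec_def L2_set_le_sum)
    finally show ?thesis .
  qed
  also have "\<dots> \<le> (\<Sum>b\<in>(UNIV::'a set). \<Sum>c\<in>(UNIV::'a set). real (length (\<zeta> b)))"
  proof (intro sum_mono)
    fix b c :: 'a
    have "norm (fourier_matrix \<zeta> \<xi> $ b $ c) \<le>
        (\<Sum>j\<in>{j. j < length (\<zeta> b) \<and> \<zeta> b ! j = c}. norm (twist (\<Sum>k<j. \<xi> $ (\<zeta> b ! k))))"
      unfolding fourier_matrix_def twist_def by (simp add: norm_sum del: norm_exp_eq_Re)
    also have "\<dots> = real (card {j. j < length (\<zeta> b) \<and> \<zeta> b ! j = c})" by simp
    also have "\<dots> \<le> real (card {j. j < length (\<zeta> b)})"
      by (intro of_nat_mono card_mono) auto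
    finally show "norm (fourier_matrix \<zeta> \<xi> $ b $ c) \<le> real (length (\<zeta> b))" by simp
  qed
  finally show "norm (fourier_matrix \<zeta> \<xi>) \<le> ?C" by simp
qed

text \<open>The last factor is the Frobenius norm of the identity, which is not 1 in general; its
  logarithm stays bounded after division by \<open>n\<close>.\<close>

lemma norm_fourier_cocycle_le:
  fixes \<zeta> :: "'a::finite \<Rightarrow> 'a list"
  assumes "\<And>\<xi>. norm (fourier_matrix \<zeta> \<xi>) \<le> C"
  shows "norm (fourier_cocycle \<zeta> \<xi> n) \<le> C ^ n * norm (mat 1 :: complex^'a^'a)"
proof (induction n)
  case (Suc n)
  have "0 \<le> C" using assms norm_ge_zero order_trans by blast
  then show ?case
    using norm_matrix_mult_le[of "fourier_matrix \<zeta> ((torus_endo \<zeta> ^^ n) \<xi>)" "fourier_cocycle \<zeta> \<xi> n"]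
      mult_mono[OF assms[of "(torus_endo \<zeta> ^^ n) \<xi>"] Suc]
    by (simp add: mult_ac)
qed simp

section \<open>Continuity and integer periodicity of the cocycle\<close>

lemma continuous_on_torus_endo [continuous_intros]:
  "continuous_on S f \<Longrightarrow> continuous_on S (\<lambda>x. torus_endo \<zeta> (f x))"
  unfolding torus_endo_def matrix_vector_mult_def
  by (auto intro!: continuous_intros)

lemma continuous_on_funpow_torus_endo [continuous_intros]:
  "continuous_on S f \<Longrightarrow> continuous_on S (\<lambda>x. (torus_endo \<zeta> ^^ n) (f x))"
  by (induction n) (auto intro!: continuous_intros)

lemma continuous_on_fourier_matrix [continuous_intros]:
  "continuous_on S f \<Longrightarrow> continuous_on S (\<lambda>x. fourier_matrix \<zeta> (f x))"
  unfolding fourier_matrix_def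
  by (auto intro!: continuous_intros)

lemma continuous_on_matrix_mult [continuous_intros]:
  fixes f :: "'x::topological_space \<Rightarrow> complex^'n^'m" and g :: "'x \<Rightarrow> complex^'k^'n"
  shows "continuous_on S f \<Longrightarrow> continuous_on S g \<Longrightarrow> continuous_on S (\<lambda>x. f x ** g x)"
  unfolding matrix_matrix_mult_def
  by (auto intro!: continuous_intros)

lemma continuous_on_fourier_cocycle [continuous_intros]:
  "continuous_on S (\<lambda>\<xi>. fourier_cocycle \<zeta> \<xi> n)"
  by (induction n) (auto intro!: continuous_intros)

text \<open>Functions on the torus are handled as periodic functions on the covering space; no
  quotient is formed.\<close>

definition int_periodic :: "(real^'n \<Rightarrow> 'b) \<Rightarrow> bool" where
  "int_periodic F \<longleftrightarrow> (\<forall>\<xi> \<xi>'. (\<forall>i. \<xi> $ i - \<xi>' $ i \<in> \<int>) \<longrightarrow> F \<xi> = F \<xi>')"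

lemma twist_cong: "s - t \<in> \<int> \<Longrightarrow> twist s = twist t"
  using twist_add[of "s - t" t] twist_eq_1_iff[of "s - t"] by simp

lemma Ints_sum_list: "(\<And>x. x \<in> set w \<Longrightarrow> f x \<in> \<int>) \<Longrightarrow> sum_list (map f w) \<in> \<int>"
  by (induction w) auto

lemma torus_endo_diff_Ints:
  assumes "\<forall>i. \<xi> $ i - \<xi>' $ i \<in> \<int>"
  shows "\<forall>i. torus_endo \<zeta> \<xi> $ i - torus_endo \<zeta> \<xi>' $ i \<in> \<int>"
  using assms by (simp add: torus_endo_nth Ints_sum_list flip: sum_list_subtractf)

lemma funpow_torus_endo_diff_Ints:
  assumes "\<forall>i. \<xi> $ i - \<xi>' $ i \<in> \<int>"
  shows "\<forall>i. (torus_endo \<zeta> ^^ n) \<xi> $ i - (torus_endo \<zeta> ^^ n) \<xi>' $ i \<in> \<int>"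
proof (induction n)
  case (Suc n)
  then show ?case using torus_endo_diff_Ints[OF Suc] by simp
qed (use assms in simp)

lemma int_periodic_fourier_matrix: "int_periodic (fourier_matrix \<zeta>)"
  unfolding int_periodic_def
proof (intro allI impI)
  fix \<xi> \<xi>' :: "real^'a" assume *: "\<forall>i. \<xi> $ i - \<xi>' $ i \<in> \<int>"
  have "twist (\<Sum>k<j. \<xi> $ (\<zeta> b ! k)) = twist (\<Sum>k<j. \<xi>' $ (\<zeta> b ! k))" for j b
    by (rule twist_cong) (use * in \<open>auto simp flip: sum_subtractf\<close>)
  then show "fourier_matrix \<zeta> \<xi> = fourier_matrix \<zeta> \<xi>'"
    unfolding fourier_matrix_def twist_def by simp
qed

lemma int_periodic_fourier_cocycle: "int_periodic (\<lambda>\<xi>. fourier_cocycle \<zeta> \<xi> n)"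
proof (induction n)
  case (Suc n)
  then show ?case
    using int_periodic_fourier_matrix[of \<zeta>] funpow_torus_endo_diff_Ints[of _ _ n \<zeta>]
    unfolding int_periodic_def by (metis fourier_cocycle.simps(2))
qed (simp add: int_periodic_def)

text \<open>The errors of single steps are multiplied by at most \<open>C0\<close> in each further
  step, so \<open>C\<close> depends on \<open>k\<close>. This is harmless because \<open>k\<close>
  will be the fixed block length, and \<open>C\<close> is uniform in \<open>n\<close> and the
  frequency.\<close>

lemma level_sums_add:
  fixes \<zeta> :: "'a::finite \<Rightarrow> 'a list"
  assumes "\<And>w. cmod (\<phi> w) \<le> B"
  obtains C where "C \<ge> 0" "\<And>n \<omega>. norm (level_sums \<zeta> \<phi> q \<omega> (n + k) -
      fourier_cocycle \<zeta> ((torus_endo \<zeta> ^^ n) (\<chi> i. \<omega>)) k *v level_sums \<zeta> \<phi> q \<omega> n) \<le> C"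
proof -
  have B: "0 \<le> B" using assms norm_ge_zero order_trans by blast
  have "\<exists>C\<ge>0. \<forall>n \<omega>. norm (level_sums \<zeta> \<phi> q \<omega> (n + k) -
      fourier_cocycle \<zeta> ((torus_endo \<zeta> ^^ n) (\<chi> i. \<omega>)) k *v level_sums \<zeta> \<phi> q \<omega> n) \<le> C"
  proof (induction k)
    case 0
    then show ?case by (auto simp: matrix_vector_mul_lid)
  next
    case (Suc k)
    then obtain C where C: "C \<ge> 0" "\<And>n \<omega>. norm (level_sums \<zeta> \<phi> q \<omega> (n + k) -
      fourier_cocycle \<zeta> ((torus_endo \<zeta> ^^ n) (\<chi> i. \<omega>)) k *v level_sums \<zeta> \<phi> q \<omega> n) \<le> C"
      by blast
    obtain C0 where C0: "C0 \<ge> 1" "\<And>\<xi>. norm (fourier_matrix \<zeta> \<xi>) \<le> C0"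
      using fourier_matrix_bounded[of \<zeta>] by blast
    let ?R = "\<Sum>b\<in>UNIV. 2 * B * real q * real (length (\<zeta> b))"
    have "norm (level_sums \<zeta> \<phi> q \<omega> (n + Suc k) -
      fourier_cocycle \<zeta> ((torus_endo \<zeta> ^^ n) (\<chi> i. \<omega>)) (Suc k) *v level_sums \<zeta> \<phi> q \<omega> n)
      \<le> ?R + C0 * C" for n \<omega>
    proof -
      let ?h = "level_sums \<zeta> \<phi> q \<omega>" and ?\<xi> = "(torus_endo \<zeta> ^^ n) (\<chi> i. \<omega>)"
      let ?M = "fourier_matrix \<zeta> ((torus_endo \<zeta> ^^ (n + k)) (\<chi> i. \<omega>))"
      have M: "fourier_cocycle \<zeta> ?\<xi> (Suc k) = ?M ** fourier_cocycle \<zeta> ?\<xi> k"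
        by (simp add: add.commute[of n k] funpow_add)
      have eq: "?h (n + Suc k) - fourier_cocycle \<zeta> ?\<xi> (Suc k) *v ?h n =
          (?h (Suc (n + k)) - ?M *v ?h (n + k)) + ?M *v (?h (n + k) - fourier_cocycle \<zeta> ?\<xi> k *v ?h n)"
        unfolding M by (simp add: matrix_vector_mult_diff_distrib matrix_vector_mul_assoc)
      show ?thesis
        unfolding eq
      proof (rule norm_triangle_mono)
        show "norm (?h (Suc (n + k)) - ?M *v ?h (n + k)) \<le> ?R"
          by (rule level_sums_Suc) (rule assms)
        have "norm (?M *v (?h (n + k) - fourier_cocycle \<zeta> ?\<xi> k *v ?h n)) \<le>
            norm ?M * norm (?h (n + k) - fourier_cocycle \<zeta> ?\<xi> k *v ?h n)"
          by (rule norm_matrix_vector_mult_le)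
        also have "\<dots> \<le> C0 * C"
          using C0(1) C(2)[of \<omega> n] by (intro mult_mono C0) auto
        finally show "norm (?M *v (?h (n + k) - fourier_cocycle \<zeta> ?\<xi> k *v ?h n)) \<le> C0 * C" .
      qed
    qed
    moreover have "?R + C0 * C \<ge> 0" using B C(1) C0(1) by (intro add_nonneg_nonneg sum_nonneg) auto
    ultimately show ?case by blast
  qed
  then show ?thesis using that by blast
qed

section \<open>Growth of twisted sums\<close>

text \<open>Clipping the factors at 1 makes the product increasing in the number of blocks, so one bound
  serves all lower levels in the prefix decomposition.\<close>

definition cocycle_growth :: "('a::finite \<Rightarrow> 'a list) \<Rightarrow> nat \<Rightarrow> real^'a \<Rightarrow> nat \<Rightarrow> real" where
  "cocycle_growth \<zeta> K \<xi> J =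
    (\<Prod>j<J. max 1 (norm (fourier_cocycle \<zeta> ((torus_endo \<zeta> ^^ (j * K)) \<xi>) K)))"

lemma cocycle_growth_ge_1: "1 \<le> cocycle_growth \<zeta> K \<xi> J"
  unfolding cocycle_growth_def by (rule prod_ge_1) simp

lemma cocycle_growth_Suc: "cocycle_growth \<zeta> K \<xi> (Suc J) =
    cocycle_growth \<zeta> K \<xi> J * max 1 (norm (fourier_cocycle \<zeta> ((torus_endo \<zeta> ^^ (J * K)) \<xi>) K))"
  by (simp add: cocycle_growth_def)

lemma cocycle_growth_le_Suc: "cocycle_growth \<zeta> K \<xi> J \<le> cocycle_growth \<zeta> K \<xi> (Suc J)"
  using mult_left_mono[of 1 "max 1 (norm (fourier_cocycle \<zeta> ((torus_endo \<zeta> ^^ (J * K)) \<xi>) K))" "cocycle_growth \<zeta> K \<xi> J"]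
    cocycle_growth_ge_1[of \<zeta> K \<xi> J] by (simp add: cocycle_growth_Suc)

lemma norm_twisted_sum_le:
  assumes "\<And>w. cmod (\<phi> w) \<le> B"
  shows "cmod (twisted_sum \<phi> q \<omega> w) \<le> B * real (length w)"
proof -
  have "cmod (twisted_sum \<phi> q \<omega> w) \<le> (\<Sum>j<length w. B)"
    unfolding twisted_sum_def by (rule sum_norm_le) (use assms in \<open>simp add: norm_mult\<close>)
  then show ?thesis by (simp add: mult.commute)
qed

text \<open>Each block multiplies the old sums by the norm of its cocycle and adds a constant. Since
  every factor of \<open>cocycle_growth\<close> is at least 1, each added constant is absorbed by
  the current product, and \<open>J\<close> of them give the linear factor.\<close>

lemma norm_level_sums_le:
  fixes \<zeta> :: "'a::finite \<Rightarrow> 'a list"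
  assumes "\<And>w. cmod (\<phi> w) \<le> B"
  obtains C where "C \<ge> 0" "\<And>\<omega> J. norm (level_sums \<zeta> \<phi> q \<omega> (J * K)) \<le>
    C * (real J + 1) * cocycle_growth \<zeta> K (\<chi> i. \<omega>) J"
proof -
  have B: "0 \<le> B" using assms norm_ge_zero order_trans by blast
  obtain C where C: "C \<ge> 0" "\<And>n \<omega>. norm (level_sums \<zeta> \<phi> q \<omega> (n + K) -
      fourier_cocycle \<zeta> ((torus_endo \<zeta> ^^ n) (\<chi> i. \<omega>)) K *v level_sums \<zeta> \<phi> q \<omega> n) \<le> C"
    using level_sums_add[where \<phi> = \<phi> and B = B and q = q and k = K] assms by blast
  \<comment> \<open>\<open>C\<close> is for the error of one block, \<open>B * CARD('a)\<close> for
    level 0, where each word is a single letter.\<close>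
  define D where "D = C + B * real CARD('a)"
  have D: "C \<le> D" "B * real CARD('a) \<le> D" "0 \<le> D" using B C(1) by (simp_all add: D_def)
  have "norm (level_sums \<zeta> \<phi> q \<omega> (J * K)) \<le> D * (real J + 1) * cocycle_growth \<zeta> K (\<chi> i. \<omega>) J" for \<omega> J
  proof (induction J)
    case 0
    have "norm (level_sums \<zeta> \<phi> q \<omega> 0) \<le> (\<Sum>b\<in>UNIV. norm (level_sums \<zeta> \<phi> q \<omega> 0 $ b))"
      by (simp add: norm_vec_def L2_set_le_sum)
    also have "\<dots> \<le> (\<Sum>b\<in>(UNIV::'a set). B)"
      by (intro sum_mono) (use norm_twisted_sum_le[of \<phi> B q \<omega> "[_]", OF assms] in \<open>simp add: level_sums_def\<close>)
    also have "\<dots> \<le> D" using D(2) by (simp add: mult.commute)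
    finally show ?case by (simp add: cocycle_growth_def)
  next
    case (Suc J)
    let ?h = "level_sums \<zeta> \<phi> q \<omega>" and ?\<xi> = "\<chi> i. \<omega>"
    let ?M = "fourier_cocycle \<zeta> ((torus_endo \<zeta> ^^ (J * K)) ?\<xi>) K"
    let ?G = "cocycle_growth \<zeta> K ?\<xi>"
    have "norm (?h (J * K + K)) \<le> norm (?h (J * K + K) - ?M *v ?h (J * K)) + norm (?M *v ?h (J * K))"
      by (metis add.commute norm_triangle_sub)
    also have "\<dots> \<le> C + norm ?M * norm (?h (J * K))"
      by (intro add_mono C norm_matrix_vector_mult_le)
    also have "norm ?M * norm (?h (J * K)) \<le> max 1 (norm ?M) * (D * (real J + 1) * ?G J)"
      by (intro mult_mono Suc) auto
    also have "\<dots> = D * (real J + 1) * ?G (Suc J)"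
      by (simp add: cocycle_growth_Suc)
    also have "C \<le> D * ?G (Suc J)"
      using mult_mono[OF D(1) cocycle_growth_ge_1[of \<zeta> K ?\<xi> "Suc J"] D(3)] by simp
    finally show ?case by (simp add: add.commute algebra_simps)
  qed
  with D(3) that show ?thesis by blast
qed

text \<open>One step of the prefix decomposition of Dumont and Thomas: \<open>p\<close> is cut along
  the boundaries between \<open>Z\<close>-words. The remainder is again a prefix of a single such
  word, so the step can be repeated at a lower level.\<close>

lemma prefix_concat_map:
  assumes "concat (map Z D) = p @ s"
  shows "\<exists>u p' c s'. length u \<le> length D \<and> p = concat (map Z u) @ p' \<and> Z c = p' @ s'"
  using assms
proof (induction D arbitrary: p)
  case Nil
  then show ?case by (metis append_Nil2 append_is_Nil_conv concat.simps(1) list.size(3) list.simps(8) order_refl self_append_conv2)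
next
  case (Cons d D)
  show ?case
  proof (cases "length p \<le> length (Z d)")
    case True
    with Cons.prems have "\<exists>s'. Z d = p @ s'"
      by (metis append_eq_append_conv_if append_take_drop_id concat.simps(2) list.simps(9))
    then show ?thesis
      by (metis append_Nil concat.simps(1) le0 list.map_disc_iff list.size(3))
  next
    case False
    with Cons.prems obtain r where r: "p = Z d @ r" "concat (map Z D) = r @ s"
      by (auto simp: append_eq_append_conv2)
    from Cons.IH[OF r(2)] obtain u p' c s' where
      "length u \<le> length D" "r = concat (map Z u) @ p'" "Z c = p' @ s'" by blast
    with r(1) have "length (d # u) \<le> length (d # D) \<and> p = concat (map Z (d # u)) @ p' \<and> Z c = p' @ s'"
      by simp
    then show ?thesis by blast
  qed
qed

text \<open>Between two consecutive cuts lies a whole \<open>Z\<close>-word, which is at least as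
  long as \<open>w\<close>; so \<open>w\<close> crosses at most one cut. The letters
  \<open>c\<close> and \<open>d\<close> need not follow each other in \<open>W\<close>.\<close>

lemma subword_concat_map:
  assumes "concat (map Z W) = p @ w @ s" "\<And>c. length w \<le> length (Z c)"
  shows "\<exists>c d p s. Z c @ Z d = p @ w @ s"
  using assms(1)
proof (induction W arbitrary: p)
  case Nil
  \<comment> \<open>Here \<open>w\<close> is empty and any letter will do.\<close>
  then have "Z undefined @ Z undefined = [] @ w @ (Z undefined @ Z undefined)" by simp
  then show ?case by blast
next
  case (Cons c W)
  show ?case
  proof (cases "length (Z c) \<le> length p")
    case True
    with Cons.prems obtain r where "p = Z c @ r" "concat (map Z W) = r @ w @ s"
      by (auto simp: append_eq_append_conv2)
    then show ?thesis using Cons.IH by blast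
  next
    case False
    with Cons.prems obtain r where r: "Z c = p @ r" "r @ concat (map Z W) = w @ s"
      by (auto simp: append_eq_append_conv2)
    show ?thesis
    proof (cases "length w \<le> length r")
      case True
      with r(2) obtain s' where "r = w @ s'" by (auto simp: append_eq_append_conv2)
      \<comment> \<open>\<open>w\<close> lies inside one factor; the second copy is padding.\<close>
      with r(1) have "Z c @ Z c = p @ w @ (s' @ Z c)" by simp
      then show ?thesis by blast
    next
      case False
      with r(2) obtain w' where w': "w = r @ w'" "concat (map Z W) = w' @ s"
        by (auto simp: append_eq_append_conv2)
      with False obtain d W' where W: "W = d # W'" by (cases W) auto
      have "length w' \<le> length (Z d)" using assms(2)[of d] w'(1) by simp
      with w'(2) W obtain s' where "Z d = w' @ s'" by (auto simp: append_eq_append_conv2)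
      with r(1) w'(1) have "Z c @ Z d = p @ w @ s'" by simp
      then show ?thesis by blast
    qed
  qed
qed

lemma norm_twisted_sum_concat_map_le:
  assumes "\<And>w. cmod (\<phi> w) \<le> B" "\<And>c. cmod (twisted_sum \<phi> q \<omega> (Z c)) \<le> H"
  shows "cmod (twisted_sum \<phi> q \<omega> (concat (map Z u))) \<le> real (length u) * (H + 2 * B * real q)"
proof (induction u)
  case (Cons c u)
  then show ?case
    using norm_twisted_sum_append_le(1)[of \<phi> B q \<omega> "Z c" "concat (map Z u)", OF assms(1)] assms(2)[of c]
    by (simp add: algebra_simps)
qed simp

text \<open>A prefix at one level consists of boundedly many whole words of the level below,
  controlled by \<open>level_sums\<close>, and a prefix of one more such word. Summing the linear
  factors over the levels gives the quadratic one.\<close>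

lemma norm_twisted_sum_prefix_le:
  fixes \<zeta> :: "'a::finite \<Rightarrow> 'a list"
  assumes \<phi>: "\<And>w. cmod (\<phi> w) \<le> B"
  obtains C where "C \<ge> 0" "\<And>\<omega> J a p s. subst_iter \<zeta> (J * K) a = p @ s \<Longrightarrow>
    cmod (twisted_sum \<phi> q \<omega> p) \<le> C * (real J + 1)^2 * cocycle_growth \<zeta> K (\<chi> i. \<omega>) J"
proof -
  have B: "0 \<le> B" using assms norm_ge_zero order_trans by blast
  obtain C where C: "C \<ge> 0" "\<And>\<omega> J. norm (level_sums \<zeta> \<phi> q \<omega> (J * K)) \<le>
    C * (real J + 1) * cocycle_growth \<zeta> K (\<chi> i. \<omega>) J"
    using norm_level_sums_le[where \<phi> = \<phi> and B = B and q = q and K = K] \<phi> by blast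
  define L where "L = Max (range (\<lambda>b. length (subst_iter \<zeta> K b)))"
  have L: "length (subst_iter \<zeta> K b) \<le> L" for b
    unfolding L_def by (rule Max_ge) auto
  define D where "D = real L * (C + 2 * B * real q) + 2 * B * real q + B"
  have D: "D \<ge> 0" "B \<le> D" "real L * (C + 2 * B * real q) + 2 * B * real q \<le> D"
    using B C(1) by (simp_all add: D_def)
  have "cmod (twisted_sum \<phi> q \<omega> p) \<le> D * (real J + 1)^2 * cocycle_growth \<zeta> K (\<chi> i. \<omega>) J"
    if "subst_iter \<zeta> (J * K) a = p @ s" for \<omega> J a p s
    using that
  proof (induction J arbitrary: a p s)
    case 0
    then have "length p \<le> 1" by (cases p) auto
    then have "B * real (length p) \<le> B * 1" by (intro mult_left_mono B) auto
    then show ?case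
      using norm_twisted_sum_le[of \<phi> B q \<omega> p, OF \<phi>] D(2) by (simp add: cocycle_growth_def)
  next
    case (Suc J)
    let ?\<xi> = "\<chi> i. \<omega>"
    let ?G = "cocycle_growth \<zeta> K ?\<xi> J"
    let ?Z = "subst_iter \<zeta> (J * K)"
    have G: "1 \<le> ?G" by (rule cocycle_growth_ge_1)
    have "subst_iter \<zeta> (J * K + K) a = p @ s" using Suc.prems by (simp add: add.commute)
    then obtain u p' c s' where u: "length u \<le> length (subst_iter \<zeta> K a)"
        "p = concat (map ?Z u) @ p'" "?Z c = p' @ s'"
      using prefix_concat_map[of ?Z "subst_iter \<zeta> K a" p s] unfolding subst_iter_add by blast
    define H where "H = C * (real J + 1) * ?G"
    have H: "H \<ge> 0" using C(1) G by (simp add: H_def)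
    have "cmod (twisted_sum \<phi> q \<omega> (?Z c)) \<le> H" for c
      using C(2)[of \<omega> J]
        Finite_Cartesian_Product.norm_nth_le[of "level_sums \<zeta> \<phi> q \<omega> (J * K)" c]
      unfolding H_def by (simp add: level_sums_def)
    then have "cmod (twisted_sum \<phi> q \<omega> (concat (map ?Z u))) \<le> real (length u) * (H + 2 * B * real q)"
      by (rule norm_twisted_sum_concat_map_le[OF \<phi>])
    also have "\<dots> \<le> real L * (H + 2 * B * real q)"
      using u(1) L[of a] H B by (intro mult_right_mono) auto
    finally have 1: "cmod (twisted_sum \<phi> q \<omega> (concat (map ?Z u))) \<le> real L * (H + 2 * B * real q)" .
    have "cmod (twisted_sum \<phi> q \<omega> p) \<le> (real L * (H + 2 * B * real q) + 2 * B * real q) + D * (real J + 1)^2 * ?G"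
      using norm_twisted_sum_append_le(1)[of \<phi> B q \<omega> "concat (map ?Z u)" p', OF \<phi>] 1 Suc.IH[OF u(3)]
      unfolding u(2) by linarith
    also have "real L * (H + 2 * B * real q) + 2 * B * real q \<le> D * ((real J + 1) * ?G)"
    proof -
      have 1: "1 \<le> (real J + 1) * ?G" using mult_mono[of 1 "real J + 1" 1 ?G] G by simp
      have "real L * (2 * B * real q) + 2 * B * real q \<le> (real L * (2 * B * real q) + 2 * B * real q) * ((real J + 1) * ?G)"
        using mult_left_mono[OF 1, of "real L * (2 * B * real q) + 2 * B * real q"] B by simp
      then have "real L * (H + 2 * B * real q) + 2 * B * real q \<le>
          (real L * (C + 2 * B * real q) + 2 * B * real q) * ((real J + 1) * ?G)"
        by (simp add: H_def algebra_simps)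
      also have "\<dots> \<le> D * ((real J + 1) * ?G)"
        using D(3) G by (intro mult_right_mono) auto
      finally show ?thesis .
    qed
    \<comment> \<open>The induction closes because
      \<open>(J + 1)^2 + (J + 1) \<le> (J + 2)^2\<close>.\<close>
    finally have "cmod (twisted_sum \<phi> q \<omega> p) \<le> D * ((real J + 1)\<^sup>2 + (real J + 1)) * ?G"
      by (simp add: algebra_simps)
    also have "\<dots> \<le> D * (real (Suc J) + 1)\<^sup>2 * cocycle_growth \<zeta> K ?\<xi> (Suc J)"
      using D(1) G by (intro mult_mono mult_left_mono cocycle_growth_le_Suc)
        (auto simp: power2_eq_square algebra_simps)
    finally show ?case .
  qed
  with D(1) that show ?thesis by blast
qed

text \<open>Otherwise row \<open>a\<close> of the substitution matrix vanishes, and with it row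
  \<open>a\<close> of all its positive powers.\<close>

lemma letter_occurs:
  fixes \<zeta> :: "'a::finite \<Rightarrow> 'a list"
  assumes "primitive \<zeta>"
  shows "\<exists>c. a \<in> set (\<zeta> c)"
proof (rule ccontr)
  assume "\<nexists>c. a \<in> set (\<zeta> c)"
  then have "subst_matrix \<zeta> $ a $ c = 0" for c
    by (auto simp: subst_matrix_def count_list_0_iff)
  then have "mat_pow (subst_matrix \<zeta>) (Suc n) $ a $ c = 0" for n c
    by (simp add: matrix_matrix_mult_def)
  with assms show False
    unfolding primitive_def by (metis gr0_conv_Suc less_irrefl)
qed

lemma letter_occurs_iter:
  fixes \<zeta> :: "'a::finite \<Rightarrow> 'a list"
  assumes "primitive \<zeta>"
  shows "\<exists>c. a \<in> set (subst_iter \<zeta> n c)"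
proof (induction n arbitrary: a)
  case (Suc n)
  from Suc obtain b where b: "a \<in> set (subst_iter \<zeta> n b)" by blast
  obtain c where "b \<in> set (\<zeta> c)" using letter_occurs[OF assms] by blast
  with b show ?case by (auto simp: subst_iter_Suc)
qed simp

text \<open>A word of the language comes from some level \<open>m\<close>. If \<open>m\<close> is at
  least \<open>n\<close>, the word of level \<open>m\<close> is regrouped; if it is smaller,
  \<open>letter_occurs_iter\<close> embeds that word into a word of level \<open>n\<close>.\<close>

lemma subst_language_level:
  fixes \<zeta> :: "'a::finite \<Rightarrow> 'a list"
  assumes "primitive \<zeta>" "w \<in> subst_language \<zeta>"
  shows "\<exists>W p s. concat (map (subst_iter \<zeta> n) W) = p @ w @ s"
proof -
  obtain m a p s where *: "subst_iter \<zeta> m a = p @ w @ s"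
    using assms(2) by (auto simp: subst_language_def subwords_def)
  show ?thesis
  proof (cases "n \<le> m")
    case True
    then have "concat (map (subst_iter \<zeta> n) (subst_iter \<zeta> (m - n) a)) = p @ w @ s"
      using * subst_iter_add[of \<zeta> n "m - n" a] by simp
    then show ?thesis by blast
  next
    case False
    obtain c where "a \<in> set (subst_iter \<zeta> (n - m) c)"
      using letter_occurs_iter[OF assms(1)] by blast
    then obtain u v where "subst_iter \<zeta> (n - m) c = u @ a # v"
      by (auto simp: in_set_conv_decomp)
    then have "concat (map (subst_iter \<zeta> n) [c]) =
        (concat (map (subst_iter \<zeta> m) u) @ p) @ w @ (s @ concat (map (subst_iter \<zeta> m) v))"
      using * False subst_iter_add[of \<zeta> m "n - m" c] by simp
    then show ?thesis by blast
  qed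
qed

text \<open>The length condition confines a block to two juxtaposed words of level
  \<open>J * K\<close>. There it is the difference of two prefixes, each contained in the first word
  or made of the first word and a prefix of the second.\<close>

lemma norm_block_sum_le:
  fixes \<zeta> :: "'a::finite \<Rightarrow> 'a list"
  assumes prim: "primitive \<zeta>" and \<phi>: "\<And>w. cmod (\<phi> w) \<le> B"
  obtains C where "C \<ge> 0" "\<And>\<omega> J N x a. \<lbrakk>x \<in> subst_shift_space \<zeta>; \<And>c. N \<le> length (subst_iter \<zeta> (J * K) c)\<rbrakk> \<Longrightarrow>
    cmod (\<Sum>j<N. \<phi> (block x (a + int j) q) * twist (\<omega> * real j))
      \<le> C * (real J + 1)^2 * cocycle_growth \<zeta> K (\<chi> i. \<omega>) J"
proof -
  have B: "0 \<le> B" using assms norm_ge_zero order_trans by blast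
  obtain C where C: "C \<ge> 0" "\<And>\<omega> J a p s. subst_iter \<zeta> (J * K) a = p @ s \<Longrightarrow>
    cmod (twisted_sum \<phi> q \<omega> p) \<le> C * (real J + 1)^2 * cocycle_growth \<zeta> K (\<chi> i. \<omega>) J"
    using norm_twisted_sum_prefix_le[where \<phi> = \<phi> and B = B and q = q and K = K] \<phi> by blast
  \<comment> \<open>With \<open>T\<close> the bound for a prefix of one word, the two prefixes cost
    \<open>2 * T + 2 * B * q\<close> each, the passage to a suffix \<open>2 * B * q\<close>, and the
    truncated windows \<open>2 * B * q\<close> again.\<close>
  let ?D = "4 * C + 8 * B * real q"
  have "cmod (\<Sum>j<N. \<phi> (block x (a + int j) q) * twist (\<omega> * real j))
      \<le> ?D * (real J + 1)^2 * cocycle_growth \<zeta> K (\<chi> i. \<omega>) J"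
    if x: "x \<in> subst_shift_space \<zeta>" and N: "\<And>c. N \<le> length (subst_iter \<zeta> (J * K) c)" for \<omega> J N x a
  proof -
    let ?H = "\<lambda>w. cmod (twisted_sum \<phi> q \<omega> w)"
    let ?Z = "subst_iter \<zeta> (J * K)"
    let ?w = "block x a N"
    define T where "T = C * (real J + 1)^2 * cocycle_growth \<zeta> K (\<chi> i. \<omega>) J"
    have T: "?H p \<le> T" if "?Z c = p @ s" for c p s
      unfolding T_def using C(2) that by blast
    have G: "1 \<le> (real J + 1)^2 * cocycle_growth \<zeta> K (\<chi> i. \<omega>) J"
      using mult_mono[of 1 "(real J + 1)^2" 1 "cocycle_growth \<zeta> K (\<chi> i. \<omega>) J"]
        cocycle_growth_ge_1[of \<zeta> K "\<chi> i. \<omega>" J] by (simp add: one_le_power)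
    have "?w \<in> subst_language \<zeta>" using x by (simp add: subst_shift_space_def)
    then obtain W p s where "concat (map ?Z W) = p @ ?w @ s"
      using subst_language_level[OF prim] by blast
    moreover have "\<And>c. length ?w \<le> length (?Z c)" using N by (simp add: block_def)
    ultimately obtain c d p s where cd: "?Z c @ ?Z d = p @ ?w @ s"
      using subword_concat_map[of ?Z W p ?w s] by blast
    have pre: "?H u \<le> 2 * T + 2 * B * real q" if "?Z c @ ?Z d = u @ v" for u v
    proof (cases "length u \<le> length (?Z c)")
      case True
      with that obtain v' where "?Z c = u @ v'" by (auto simp: append_eq_append_conv2)
      then show ?thesis using T B norm_ge_zero[of "twisted_sum \<phi> q \<omega> u"]
        by (smt (verit, best) mult_nonneg_nonneg of_nat_0_le_iff)
    next
      case False
      with that obtain u' where "u = ?Z c @ u'" "?Z d = u' @ v" by (auto simp: append_eq_append_conv2)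
      then show ?thesis
        using norm_twisted_sum_append_le(1)[of \<phi> B q \<omega> "?Z c" u', OF \<phi>] T[of c "?Z c" "[]"] T[of d u' v]
        by simp
    qed
    have "?H ?w \<le> ?H p + ?H (p @ ?w) + 2 * B * real q"
      by (rule norm_twisted_sum_append_le(2)) (rule \<phi>)
    also have "\<dots> \<le> 4 * T + 6 * B * real q"
      using pre[of p "?w @ s"] pre[of "p @ ?w" s] cd by simp
    finally have "cmod (\<Sum>j<N. \<phi> (block x (a + int j) q) * twist (\<omega> * real j)) \<le> 4 * T + 8 * B * real q"
      using twisted_sum_block[of \<phi> B x a q \<omega> N, OF \<phi>]
        norm_triangle_sub[of "\<Sum>j<N. \<phi> (block x (a + int j) q) * twist (\<omega> * real j)" "twisted_sum \<phi> q \<omega> ?w"]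
      by linarith
    also have "8 * B * real q \<le> 8 * B * real q * ((real J + 1)^2 * cocycle_growth \<zeta> K (\<chi> i. \<omega>) J)"
      using mult_left_mono[OF G, of "8 * B * real q"] B by simp
    finally show ?thesis by (simp add: T_def algebra_simps)
  qed
  moreover have "?D \<ge> 0" using B C(1) by simp
  ultimately show ?thesis using that by blast
qed

section \<open>The substitution matrix\<close>

lemma mat_pow_mult_vec_eigen:
  fixes A :: "real^'n^'n"
  assumes "A *v v = l *\<^sub>R v"
  shows "mat_pow A n *v v = l ^ n *\<^sub>R v"
  by (induction n) (simp_all add: assms mult.commute matrix_vector_mult_scaleR flip: matrix_vector_mul_assoc)

lemma inner_torus_endo: "p \<bullet> torus_endo \<zeta> \<xi> = (subst_matrix \<zeta> *v p) \<bullet> \<xi>"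
  unfolding torus_endo_def
  by (metis dot_lmul_matrix inner_commute transpose_matrix_vector)

lemma mat_pow_Suc_right: "mat_pow A (Suc n) = mat_pow A n ** A"
  by (induction n) (simp_all add: matrix_mul_assoc)

text \<open>The adjoint of the torus endomorphism is the substitution matrix itself, so the orbit of
  the diagonal can be tested through the eigenvector expansion of \<open>p\<close>.\<close>

lemma inner_funpow_torus_endo:
  "p \<bullet> (torus_endo \<zeta> ^^ n) \<xi> = (mat_pow (subst_matrix \<zeta>) n *v p) \<bullet> \<xi>"
  by (induction n arbitrary: p)
    (simp_all add: inner_torus_endo matrix_vector_mul_assoc mat_pow_Suc_right del: mat_pow.simps(2))

text \<open>Subtract from \<open>v\<close> the largest multiple of \<open>w\<close> that leaves a
  nonnegative vector. It vanishes at some coordinate \<open>k\<close>, and the nonnegativity of its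
  image there reads \<open>(l - m) * v $ k \<ge> 0\<close>.\<close>

lemma positive_eigenvalue_le:
  fixes A :: "real^'n^'n"
  assumes A: "\<And>i j. A $ i $ j \<ge> 0"
    and v: "\<And>i. v $ i > 0" "A *v v = l *\<^sub>R v"
    and w: "\<And>i. w $ i > 0" "A *v w = m *\<^sub>R w"
  shows "m \<le> l"
proof -
  define c where "c = Min (range (\<lambda>i. v $ i / w $ i))"
  have "c \<in> range (\<lambda>i. v $ i / w $ i)" unfolding c_def by (rule Min_in) auto
  then obtain k where "c = v $ k / w $ k" by blast
  with w(1)[of k] have k: "v $ k = c * w $ k" by (simp add: field_simps)
  have nonneg: "v $ i - c * w $ i \<ge> 0" for i
  proof -
    have "c \<le> v $ i / w $ i" unfolding c_def by (rule Min_le) auto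
    with w(1)[of i] show ?thesis by (simp add: field_simps)
  qed
  have "0 \<le> (A *v (v - c *\<^sub>R w)) $ k"
    unfolding matrix_vector_mult_def by (auto intro!: sum_nonneg mult_nonneg_nonneg A nonneg)
  also have "\<dots> = (l - m) * v $ k"
    by (simp add: matrix_vector_mult_diff_distrib matrix_vector_mult_scaleR v w k algebra_simps)
  finally show ?thesis using v(1)[of k] by (simp add: zero_le_mult_iff)
qed

text \<open>The comparison of positive eigenvectors in both directions supplies the uniqueness
  hidden in the definite description.\<close>

lemma pf_eigenvalue_eqI:
  fixes A :: "real^'n^'n"
  assumes "\<And>i j. A $ i $ j \<ge> 0" "\<And>i. v $ i > 0" "A *v v = l *\<^sub>R v"
  shows "pf_eigenvalue A = l"
  unfolding pf_eigenvalue_def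
proof (rule the_equality)
  show "\<exists>v. (\<forall>i. v $ i > 0) \<and> A *v v = l *\<^sub>R v" using assms by blast
  fix m assume "\<exists>v. (\<forall>i. v $ i > 0) \<and> A *v v = m *\<^sub>R v"
  then obtain w where "\<And>i. w $ i > 0" "A *v w = m *\<^sub>R w" by blast
  then show "m = l"
    using positive_eigenvalue_le[of A v l w m] positive_eigenvalue_le[of A w m v l] assms
    by (simp add: order_antisym)
qed

lemma subst_matrix_nonneg: "subst_matrix \<zeta> $ i $ j \<ge> 0"
  by (simp add: subst_matrix_def)

lemma mat_pow_nonneg:
  fixes A :: "real^'n^'n"
  assumes "\<And>i j. A $ i $ j \<ge> 0"
  shows "mat_pow A n $ i $ j \<ge> 0"
  by (induction n arbitrary: i j)
    (auto simp: mat_def matrix_matrix_mult_def intro!: sum_nonneg mult_nonneg_nonneg assms)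

lemma two_eigenvectors:
  fixes A :: "real^'n^'n"
  assumes card: "CARD('n) = 2"
    and "l1 \<noteq> l2" "v1 \<noteq> 0" "v2 \<noteq> 0" "A *v v1 = l1 *\<^sub>R v1" "A *v v2 = l2 *\<^sub>R v2"
  shows "v1 \<notin> span {v2}" and "\<exists>a b. p = a *\<^sub>R v1 + b *\<^sub>R v2"
proof -
  show *: "v1 \<notin> span {v2}"
  proof
    assume "v1 \<in> span {v2}"
    then obtain c where c: "v1 = c *\<^sub>R v2" by (auto simp: span_singleton)
    then have "l1 *\<^sub>R v1 = l2 *\<^sub>R v1"
      using assms by (metis matrix_vector_mult_scaleR scaleR_left_commute)
    with assms show False by simp
  qed
  then have "independent {v1, v2}" "v1 \<noteq> v2"
    using assms by (auto simp: independent_insert span_base)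
  then have "UNIV \<subseteq> span {v1, v2}"
    using card by (intro card_ge_dim_independent) (simp_all add: dim_UNIV)
  then have "p \<in> span {v1, v2}" by blast
  then obtain a where "p - a *\<^sub>R v1 \<in> span {v2}" using span_breakdown_eq[of p v1 "{v2}"] by blast
  then obtain b where "p - a *\<^sub>R v1 = b *\<^sub>R v2" by (auto simp: span_singleton)
  then have "p = a *\<^sub>R v1 + b *\<^sub>R v2" by (simp add: algebra_simps)
  then show "\<exists>a b. p = a *\<^sub>R v1 + b *\<^sub>R v2" by blast
qed

text \<open>If the two eigenvalues were opposite, the square of the matrix would be scalar,
  so no power of it could be strictly positive.\<close>

lemma primitive_abs_eigenvalues_neq:
  fixes \<zeta> :: "'a::finite \<Rightarrow> 'a list"
  assumes card: "CARD('a) = 2" and prim: "primitive \<zeta>"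
    and ne: "l1 \<noteq> l2" "v1 \<noteq> 0" "v2 \<noteq> 0"
    and v: "subst_matrix \<zeta> *v v1 = l1 *\<^sub>R v1" "subst_matrix \<zeta> *v v2 = l2 *\<^sub>R v2"
  shows "\<bar>l1\<bar> \<noteq> \<bar>l2\<bar>"
proof
  let ?S = "subst_matrix \<zeta>"
  assume "\<bar>l1\<bar> = \<bar>l2\<bar>"
  then have sq: "l1 ^ (2 * n) = l2 ^ (2 * n)" for n by (metis power_even_abs even_mult_iff even_numeral)
  obtain n where n: "\<And>i j. mat_pow ?S n $ i $ j > 0" using prim by (auto simp: primitive_def)
  have add: "mat_pow ?S (m + n) = mat_pow ?S m ** mat_pow ?S n" for m
    by (induction m) (simp_all add: matrix_mul_assoc)
  obtain i j :: 'a where ij: "i \<noteq> j"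
    using card by (metis card_2_iff)
  have "mat_pow ?S (2 * n) $ i $ j > 0"
    unfolding mult_2 add by (auto simp: matrix_matrix_mult_def intro!: sum_pos mult_pos_pos n)
  moreover have "mat_pow ?S (2 * n) *v p = l1 ^ (2 * n) *\<^sub>R p" for p
  proof -
    obtain a b where p: "p = a *\<^sub>R v1 + b *\<^sub>R v2"
      using two_eigenvectors(2)[OF card ne v, of p] by blast
    show ?thesis
      unfolding p matrix_vector_right_distrib matrix_vector_mult_scaleR
        mat_pow_mult_vec_eigen[OF v(1)] mat_pow_mult_vec_eigen[OF v(2)] sq[of n, symmetric]
      by (simp add: scaleR_add_right mult.commute)
  qed
  then have "(mat_pow ?S (2 * n) *v axis j 1) $ i = 0" using ij by (simp add: axis_def)
  then have "mat_pow ?S (2 * n) $ i $ j = 0" by (simp add: matrix_vector_mul_component inner_axis)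
  ultimately show False by simp
qed

text \<open>Power iteration: some basis vector lies off the line of \<open>v2\<close>, and its
  images, divided by powers of \<open>l1\<close>, converge to a multiple of \<open>v1\<close>.
  Limits of nonnegative vectors are nonnegative, and a strictly positive power of the matrix makes
  the limit strictly positive. Even exponents are used because the sign of \<open>l1\<close> is
  known only at the end.\<close>

lemma perron_vector_exists:
  fixes \<zeta> :: "'a::finite \<Rightarrow> 'a list"
  assumes card: "CARD('a) = 2" and prim: "primitive \<zeta>"
    and l: "\<bar>l2\<bar> < \<bar>l1\<bar>" and ne: "v1 \<noteq> 0" "v2 \<noteq> 0"
    and v: "subst_matrix \<zeta> *v v1 = l1 *\<^sub>R v1" "subst_matrix \<zeta> *v v2 = l2 *\<^sub>R v2"
  obtains u where "\<And>i. u $ i > 0" "subst_matrix \<zeta> *v u = l1 *\<^sub>R u" "l1 > 0"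
proof -
  let ?S = "subst_matrix \<zeta>"
  have neq: "l1 \<noteq> l2" using l by auto
  note ev = two_eigenvectors[OF card neq ne v]
  have "\<exists>k. axis k 1 \<notin> span {v2}"
  proof (rule ccontr)
    assume "\<nexists>k. axis k 1 \<notin> span {v2}"
    then have "(\<Sum>k\<in>UNIV. v1 $ k *\<^sub>R axis k 1) \<in> span {v2}"
      by (intro span_sum span_scale) auto
    moreover have "(\<Sum>k\<in>UNIV. v1 $ k *\<^sub>R axis k 1) = v1"
      using basis_expansion[of v1] by (simp add: scalar_mult_eq_scaleR)
    ultimately show False using ev(1) by simp
  qed
  then obtain k where k: "axis k 1 \<notin> span {v2}" by blast
  obtain a b where ab: "axis k 1 = a *\<^sub>R v1 + b *\<^sub>R v2" using ev(2) by blast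
  with k have a: "a \<noteq> 0" by (auto simp: span_singleton)
  define u where "u = a *\<^sub>R v1"
  have u: "?S *v u = l1 *\<^sub>R u" by (simp add: u_def matrix_vector_mult_scaleR v)
  have u0: "u \<noteq> 0" using a ne by (simp add: u_def)
  have nonneg: "u $ i \<ge> 0" for i
  proof (rule LIMSEQ_le_const)
    have "(\<lambda>n. (l2 / l1) ^ (2 * n)) \<longlonglongrightarrow> 0"
    proof -
      have "\<bar>l2 / l1\<bar> < 1" using l by (simp add: abs_divide field_simps)
      then have "(l2 / l1)\<^sup>2 < 1" by (simp add: abs_square_less_1)
      then show ?thesis by (simp add: power_mult LIMSEQ_realpow_zero)
    qed
    then have "(\<lambda>n. u $ i + b * (l2 / l1) ^ (2 * n) * v2 $ i) \<longlonglongrightarrow> u $ i + b * 0 * v2 $ i"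
      by (intro tendsto_intros)
    then show "(\<lambda>n. u $ i + b * (l2 / l1) ^ (2 * n) * v2 $ i) \<longlonglongrightarrow> u $ i" by simp
    have "0 \<le> u $ i + b * (l2 / l1) ^ (2 * n) * v2 $ i" for n
    proof -
      have "0 \<le> (mat_pow ?S (2 * n) *v axis k 1) $ i"
        using mat_pow_nonneg[OF subst_matrix_nonneg]
        by (simp add: matrix_vector_mul_component inner_axis)
      also have "\<dots> = l1 ^ (2 * n) * (a * v1 $ i) + l2 ^ (2 * n) * (b * v2 $ i)"
        unfolding ab matrix_vector_right_distrib matrix_vector_mult_scaleR
          mat_pow_mult_vec_eigen[OF v(1)] mat_pow_mult_vec_eigen[OF v(2)]
        by (simp add: algebra_simps)
      also have "\<dots> = l1 ^ (2 * n) * (u $ i + b * (l2 / l1) ^ (2 * n) * v2 $ i)"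
        using l by (simp add: u_def power_divide field_simps)
      finally have "0 \<le> l1 ^ (2 * n) * (u $ i + b * (l2 / l1) ^ (2 * n) * v2 $ i)" .
      moreover have "l1 ^ (2 * n) > 0"
      proof -
        have "l1 \<noteq> 0" using l by auto
        then show ?thesis by (simp add: power_mult)
      qed
      ultimately show ?thesis by (simp add: zero_le_mult_iff)
    qed
    then show "\<exists>N. \<forall>n\<ge>N. 0 \<le> u $ i + b * (l2 / l1) ^ (2 * n) * v2 $ i" by blast
  qed
  obtain n where n: "\<And>i j. mat_pow ?S n $ i $ j > 0" using prim by (auto simp: primitive_def)
  obtain m where m: "u $ m \<noteq> 0" using u0 by (auto simp: vec_eq_iff)
  have pos: "u $ i > 0" for i
  proof -
    have "0 < mat_pow ?S n $ i $ m * u $ m" using n m nonneg[of m] by (simp add: order.strict_iff_order)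
    also have "\<dots> \<le> (\<Sum>j\<in>UNIV. mat_pow ?S n $ i $ j * u $ j)"
      by (rule member_le_sum) (use n nonneg in \<open>auto intro: mult_nonneg_nonneg less_imp_le\<close>)
    also have "\<dots> = (mat_pow ?S n *v u) $ i" by (simp add: matrix_vector_mult_def)
    also have "\<dots> = l1 ^ n * u $ i" by (simp add: mat_pow_mult_vec_eigen[OF u])
    finally show ?thesis using nonneg[of i] by (cases "u $ i = 0") auto
  qed
  have "0 \<le> (?S *v u) $ m"
    unfolding matrix_vector_mult_def using nonneg by (auto intro!: sum_nonneg simp: subst_matrix_nonneg)
  then have "0 \<le> l1" using pos[of m] by (simp add: u zero_le_mult_iff)
  with l have "l1 > 0" by auto
  with pos u that show ?thesis by blast
qed

section \<open>Lengths of substituted words and growth of frequencies\<close>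

lemma length_subst_iter_pos:
  assumes "is_substitution \<zeta>"
  shows "length (subst_iter \<zeta> n a) > 0"
proof (induction n arbitrary: a)
  case (Suc n)
  have "\<zeta> a \<noteq> []" using assms by (simp add: is_substitution_def)
  then show ?case using Suc[of "hd (\<zeta> a)"] by (cases "\<zeta> a") (auto simp: subst_iter_Suc)
qed simp

text \<open>Paired with the Perron vector, the lengths at level \<open>n\<close> grow exactly by
  \<open>\<theta> ^ n\<close>, so some letter reaches that size. A strictly positive power of the
  matrix spreads this to all letters within \<open>N\<close> further levels.\<close>

lemma length_subst_iter_lower_bound:
  fixes \<zeta> :: "'a::finite \<Rightarrow> 'a list"
  assumes sub: "is_substitution \<zeta>" and prim: "primitive \<zeta>"
    and u: "\<And>i. u $ i > 0" "subst_matrix \<zeta> *v u = \<theta> *\<^sub>R u" and "\<theta> > 1"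
  obtains c where "c > 0" "\<And>n a. c * \<theta> ^ n \<le> real (length (subst_iter \<zeta> n a))"
proof -
  let ?S = "subst_matrix \<zeta>"
  let ?len = "\<lambda>n a. real (length (subst_iter \<zeta> n a))"
  have len: "?len n a = (torus_endo \<zeta> ^^ n) (\<chi> i. 1) $ a" for n a
    using funpow_torus_endo_diagonal[of n \<zeta> 1 a] by simp
  obtain N where N: "\<And>i j. mat_pow ?S N $ i $ j > 0" using prim by (auto simp: primitive_def)
  define m where "m = Min (range (\<lambda>(i, j). mat_pow ?S N $ i $ j))"
  have m: "m \<le> mat_pow ?S N $ i $ j" for i j
    unfolding m_def by (rule Min_le) (auto intro: image_eqI[of _ _ "(i, j)"])
  have "m \<in> range (\<lambda>(i, j). mat_pow ?S N $ i $ j)" unfolding m_def by (rule Min_in) auto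
  then have m0: "m > 0" using N by auto
  have big: "\<exists>b. \<theta> ^ n \<le> ?len n b" for n
  proof (rule ccontr)
    assume "\<nexists>b. \<theta> ^ n \<le> ?len n b"
    then have "(\<Sum>b\<in>UNIV. u $ b * ?len n b) < (\<Sum>b\<in>UNIV. u $ b * \<theta> ^ n)"
      using u(1) by (intro sum_strict_mono) (auto simp: not_le)
    moreover have "(\<Sum>b\<in>UNIV. u $ b * ?len n b) = u \<bullet> (torus_endo \<zeta> ^^ n) (\<chi> i. 1)"
      by (simp add: inner_vec_def len)
    moreover have "\<dots> = (\<Sum>b\<in>UNIV. u $ b * \<theta> ^ n)"
      unfolding inner_funpow_torus_endo mat_pow_mult_vec_eigen[OF u(2)]
      by (simp add: inner_vec_def mult.commute)
    ultimately show False by simp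
  qed
  \<comment> \<open>\<open>m\<close> serves the levels from \<open>N\<close> on; below
    \<open>N\<close> the trivial bound by one letter suffices after division by
    \<open>\<theta> ^ N\<close>.\<close>
  define c where "c = min m 1 / \<theta> ^ N"
  have c0: "c > 0" using m0 \<open>\<theta> > 1\<close> by (simp add: c_def)
  have "c * \<theta> ^ n \<le> ?len n a" for n a
  proof (cases "N \<le> n")
    case True
    then obtain k where k: "n = N + k" using le_Suc_ex by blast
    obtain b where b: "\<theta> ^ k \<le> ?len k b" using big by blast
    have "c * \<theta> ^ n = min m 1 * \<theta> ^ k" using \<open>\<theta> > 1\<close> by (simp add: c_def k power_add)
    also have "\<dots> \<le> m * ?len k b"
      using b m0 \<open>\<theta> > 1\<close> by (intro mult_mono) auto
    also have "\<dots> \<le> mat_pow ?S N $ b $ a * ?len k b"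
      using m by (intro mult_right_mono) auto
    also have "\<dots> \<le> (\<Sum>b\<in>UNIV. mat_pow ?S N $ b $ a * ?len k b)"
      by (rule member_le_sum) (auto intro!: mult_nonneg_nonneg mat_pow_nonneg subst_matrix_nonneg)
    also have "\<dots> = (mat_pow ?S N *v axis a 1) \<bullet> (torus_endo \<zeta> ^^ k) (\<chi> i. 1)"
      unfolding inner_vec_def len
      by (intro sum.cong refl) (simp add: matrix_vector_mul_component inner_axis)
    also have "\<dots> = axis a 1 \<bullet> (torus_endo \<zeta> ^^ n) (\<chi> i. 1)"
      by (simp add: k funpow_add inner_funpow_torus_endo)
    also have "\<dots> = ?len n a" by (simp add: len inner_axis')
    finally show ?thesis .
  next
    case False
    have "c * \<theta> ^ n \<le> 1 / \<theta> ^ N * \<theta> ^ N"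
      unfolding c_def using False \<open>\<theta> > 1\<close> m0
      by (intro mult_mono divide_right_mono power_increasing) auto
    also have "\<dots> \<le> ?len n a"
      using length_subst_iter_pos[OF sub, of n a] \<open>\<theta> > 1\<close> by (simp add: Suc_le_eq)
    finally show ?thesis .
  qed
  with c0 that show ?thesis by blast
qed

text \<open>The dominant term gains \<open>|A| (|x| - 1) |x|^j\<close> in one step while the other
  can take away at most \<open>|B| (|y| + 1) |y|^j\<close>. Without a dominant term the sequence is
  geometric with ratio of modulus \<open>|y| > 1\<close>.\<close>

lemma exponential_sum_eventually_increasing:
  fixes x y A B :: real
  assumes "1 < \<bar>y\<bar>" "\<bar>y\<bar> < \<bar>x\<bar>" "A \<noteq> 0 \<or> B \<noteq> 0"
  obtains j0 where "\<And>j. j0 \<le> j \<Longrightarrow> \<bar>A * x ^ j + B * y ^ j\<bar> < \<bar>A * x ^ Suc j + B * y ^ Suc j\<bar>"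
proof (cases "A = 0")
  case True
  have "\<bar>A * x ^ j + B * y ^ j\<bar> < \<bar>A * x ^ Suc j + B * y ^ Suc j\<bar>" for j
  proof -
    have "1 * \<bar>y\<bar> ^ j < \<bar>y\<bar> * \<bar>y\<bar> ^ j"
      using assms by (intro mult_strict_right_mono) auto
    with True assms show ?thesis by (simp add: abs_mult power_abs)
  qed
  with that show ?thesis by blast
next
  case False
  have "(\<lambda>j. \<bar>B\<bar> * (\<bar>y\<bar> + 1) * (\<bar>y\<bar> / \<bar>x\<bar>) ^ j) \<longlonglongrightarrow> \<bar>B\<bar> * (\<bar>y\<bar> + 1) * 0"
    using assms by (intro tendsto_intros LIMSEQ_realpow_zero) auto
  moreover have "0 < \<bar>A\<bar> * (\<bar>x\<bar> - 1)" using False assms by simp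
  ultimately have "\<forall>\<^sub>F j in sequentially. \<bar>B\<bar> * (\<bar>y\<bar> + 1) * (\<bar>y\<bar> / \<bar>x\<bar>) ^ j < \<bar>A\<bar> * (\<bar>x\<bar> - 1)"
    by (simp add: order_tendstoD(2))
  then obtain j0 where j0: "\<And>j. j0 \<le> j \<Longrightarrow> \<bar>B\<bar> * (\<bar>y\<bar> + 1) * (\<bar>y\<bar> / \<bar>x\<bar>) ^ j < \<bar>A\<bar> * (\<bar>x\<bar> - 1)"
    by (auto simp: eventually_sequentially)
  have "\<bar>A * x ^ j + B * y ^ j\<bar> < \<bar>A * x ^ Suc j + B * y ^ Suc j\<bar>" if "j0 \<le> j" for j
  proof -
    have "\<bar>x\<bar> ^ j > 0" using assms by auto
    with j0[OF that] have "\<bar>B\<bar> * (\<bar>y\<bar> + 1) * \<bar>y\<bar> ^ j < \<bar>A\<bar> * (\<bar>x\<bar> - 1) * \<bar>x\<bar> ^ j"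
      by (simp add: power_divide field_simps)
    then have "\<bar>A * x ^ j\<bar> + \<bar>B * y ^ j\<bar> < \<bar>A * x ^ Suc j\<bar> - \<bar>B * y ^ Suc j\<bar>"
      by (simp add: abs_mult power_abs algebra_simps)
    then show ?thesis by linarith
  qed
  with that show ?thesis by blast
qed

text \<open>Orthogonality to the vector of ones passes to its image under the transposed matrix, the
  vector of lengths. In dimension two the orthogonal complement of \<open>v\<close> is a line, so
  the lengths would be proportional to the ones.\<close>

lemma non_constant_length_inner_neq_0:
  fixes \<zeta> :: "'a::finite \<Rightarrow> 'a list"
  assumes card: "CARD('a) = 2" and ncl: "\<not> constant_length \<zeta>"
    and v: "v \<noteq> 0" "subst_matrix \<zeta> *v v = l *\<^sub>R v"
  shows "v \<bullet> (\<chi> i. 1) \<noteq> 0"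
proof
  assume 0: "v \<bullet> (\<chi> i. 1) = 0"
  obtain a b :: 'a where ab: "UNIV = {a, b}" "a \<noteq> b" using card by (metis card_2_iff)
  have U: "x = a \<or> x = b" for x using ab(1) by blast
  have "v \<bullet> torus_endo \<zeta> (\<chi> i. 1) = 0" by (simp add: inner_torus_endo v 0)
  moreover have "torus_endo \<zeta> (\<chi> i. 1) $ c = real (length (\<zeta> c))" for c
    using funpow_torus_endo_diagonal[of 1 \<zeta> 1 c] by (simp add: subst_iter_1)
  ultimately have "v $ a * real (length (\<zeta> a)) + v $ b * real (length (\<zeta> b)) = 0"
    using ab(2) by (simp add: inner_vec_def ab(1))
  moreover have vb: "v $ b = - v $ a" using 0 ab(2) by (simp add: inner_vec_def ab(1))
  ultimately have "v $ a * (real (length (\<zeta> a)) - real (length (\<zeta> b))) = 0"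
    by (simp add: algebra_simps)
  moreover have "v $ a \<noteq> 0"
  proof
    assume "v $ a = 0"
    with vb have "v $ x = 0" for x using U[of x] by auto
    with v(1) show False by (simp add: vec_eq_iff)
  qed
  ultimately have "length (\<zeta> a) = length (\<zeta> b)" by simp
  then have "length (\<zeta> x) = length (\<zeta> y)" for x y using U[of x] U[of y] by auto
  with ncl show False by (simp add: constant_length_def)
qed

text \<open>Both eigencomponents of an integer vector contribute here: an eigenvector orthogonal to
  \<open>(1, \<dots>, 1)\<close> would force constant length.\<close>

lemma frequencies_eventually_increasing:
  fixes \<zeta> :: "'a::finite \<Rightarrow> 'a list" and p :: "real^'a"
  assumes card: "CARD('a) = 2" and ncl: "\<not> constant_length \<zeta>"
    and l: "1 < \<bar>l2\<bar>" "\<bar>l2\<bar> < \<bar>l1\<bar>" and ne: "v1 \<noteq> 0" "v2 \<noteq> 0"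
    and v: "subst_matrix \<zeta> *v v1 = l1 *\<^sub>R v1" "subst_matrix \<zeta> *v v2 = l2 *\<^sub>R v2"
    and K: "K > 0" and p: "p \<noteq> 0"
  obtains j0 where "\<And>j. j0 \<le> j \<Longrightarrow> \<bar>p \<bullet> (torus_endo \<zeta> ^^ (j * K)) (\<chi> i. 1)\<bar> <
    \<bar>p \<bullet> (torus_endo \<zeta> ^^ (Suc j * K)) (\<chi> i. 1)\<bar>"
proof -
  have neq: "l1 \<noteq> l2" using l by auto
  obtain a b where ab: "p = a *\<^sub>R v1 + b *\<^sub>R v2"
    using two_eigenvectors(2)[OF card neq ne v, of p] by blast
  define A where "A = a * (v1 \<bullet> (\<chi> i. 1))"
  define B where "B = b * (v2 \<bullet> (\<chi> i. 1))"
  have AB: "A \<noteq> 0 \<or> B \<noteq> 0"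
    using p non_constant_length_inner_neq_0[OF card ncl ne(1) v(1)]
      non_constant_length_inner_neq_0[OF card ncl ne(2) v(2)] by (auto simp: A_def B_def ab)
  have eq: "p \<bullet> (torus_endo \<zeta> ^^ (j * K)) (\<chi> i. 1) = A * (l1 ^ K) ^ j + B * (l2 ^ K) ^ j" for j
  proof -
    have "mat_pow (subst_matrix \<zeta>) (j * K) *v p = (a * l1 ^ (j * K)) *\<^sub>R v1 + (b * l2 ^ (j * K)) *\<^sub>R v2"
      unfolding ab matrix_vector_right_distrib matrix_vector_mult_scaleR
        mat_pow_mult_vec_eigen[OF v(1)] mat_pow_mult_vec_eigen[OF v(2)] by simp
    then show ?thesis
      by (simp add: inner_funpow_torus_endo inner_add_left A_def B_def power_mult[symmetric] mult.commute mult.left_commute)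
  qed
  have "1 < \<bar>l2 ^ K\<bar>" "\<bar>l2 ^ K\<bar> < \<bar>l1 ^ K\<bar>"
    using l K by (auto simp: power_abs intro!: one_less_power power_strict_mono)
  then obtain j0 where "\<And>j. j0 \<le> j \<Longrightarrow> \<bar>A * (l1 ^ K) ^ j + B * (l2 ^ K) ^ j\<bar>
      < \<bar>A * (l1 ^ K) ^ Suc j + B * (l2 ^ K) ^ Suc j\<bar>"
    using exponential_sum_eventually_increasing[OF _ _ AB] by blast
  then show ?thesis using that unfolding eq by blast
qed

section \<open>Trigonometric polynomials\<close>

abbreviation unit_measure :: "real measure" where
  "unit_measure \<equiv> restrict_space lborel {0..1}"

text \<open>Haar measure of the torus on a fundamental cube; the doubled boundary is a null
  set.\<close>

abbreviation box_measure :: "(real^'n) measure" where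
  "box_measure \<equiv> restrict_space lborel (cbox 0 (\<chi> i. 1))"

lemma prob_space_unit_measure: "prob_space unit_measure"
  by (rule prob_spaceI) (simp add: emeasure_restrict_space space_restrict_space)

lemma prob_space_box_measure: "prob_space (box_measure :: (real^'n) measure)"
proof (rule prob_spaceI)
  have "(\<Prod>b\<in>Basis. ((\<chi> i. 1) - 0 :: real^'n) \<bullet> b) = 1"
    by (rule prod.neutral) (auto simp: Basis_vec_def inner_axis)
  moreover have "\<forall>b\<in>Basis. (0 :: real^'n) \<bullet> b \<le> (\<chi> i. 1) \<bullet> b"
    by (auto simp: Basis_vec_def inner_axis)
  ultimately have "emeasure lborel (cbox 0 (\<chi> i. 1) :: (real^'n) set) = 1"
    by (simp add: emeasure_lborel_cbox_eq)
  then show "emeasure box_measure (space (box_measure :: (real^'n) measure)) = 1"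
    by (simp add: emeasure_restrict_space space_restrict_space)
qed

lemma unit_measurable: "f \<in> borel_measurable borel \<Longrightarrow> f \<in> borel_measurable unit_measure"
  by (simp add: measurable_restrict_space1)

lemma box_measurable: "f \<in> borel_measurable borel \<Longrightarrow> f \<in> borel_measurable box_measure"
  by (simp add: measurable_restrict_space1)

lemma continuous_imp_integrable_unit:
  fixes f :: "real \<Rightarrow> 'b::{banach, second_countable_topology}"
  assumes "continuous_on UNIV f" "\<And>x. norm (f x) \<le> B"
  shows "integrable unit_measure f"
proof -
  interpret prob_space unit_measure by (rule prob_space_unit_measure)
  have "f \<in> borel_measurable borel" using assms(1) by (rule borel_measurable_continuous_onI)
  then show ?thesis using assms(2) by (intro integrable_const_bound[where B = B] AE_I2 unit_measurable)
qed

lemma continuous_imp_integrable_box: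
  fixes f :: "real^'n \<Rightarrow> 'b::{banach, second_countable_topology}"
  assumes "continuous_on UNIV f" "\<And>x. norm (f x) \<le> B"
  shows "integrable box_measure f"
proof -
  interpret prob_space "box_measure :: (real^'n) measure" by (rule prob_space_box_measure)
  have "f \<in> borel_measurable borel" using assms(1) by (rule borel_measurable_continuous_onI)
  then show ?thesis using assms(2) by (intro integrable_const_bound[where B = B] AE_I2 box_measurable)
qed

lemma continuous_on_twist [continuous_intros]:
  "continuous_on S f \<Longrightarrow> continuous_on S (\<lambda>x. twist (f x))"
  unfolding twist_def by (intro continuous_intros)

lemma integral_unit_twist:
  assumes "a \<in> \<int>"
  shows "(\<integral>t. twist (a * t) \<partial>unit_measure) = (if a = 0 then 1 else 0)"
proof (cases "a = 0")
  case True
  interpret prob_space unit_measure by (rule prob_space_unit_measure)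
  show ?thesis using True by (simp add: measure_restrict_space)
next
  case False
  define c where "c = - 2 * pi * \<i> * of_real a"
  have c: "c \<noteq> 0" using False by (simp add: c_def)
  have tw: "twist (a * t) = exp (c * of_real t)" for t by (simp add: twist_def c_def mult.assoc)
  have "has_bochner_integral lborel (\<lambda>x. indicator {0..1} x *\<^sub>R exp (c * of_real x))
      (exp (c * of_real 1) / c - exp (c * of_real 0) / c)"
  proof (rule has_bochner_integral_FTC_Icc)
    fix x :: real
    show "((\<lambda>x. exp (c * of_real x) / c) has_vector_derivative exp (c * of_real x)) (at x within {0..1})"
    proof -
      have "((\<lambda>z. exp (c * z) / c) has_field_derivative exp (c * of_real x)) (at (of_real x))"
        using c by (auto intro!: derivative_eq_intros)
      then show ?thesis
        by (rule has_vector_derivative_real_field)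
    qed
  qed (auto intro!: continuous_intros)
  moreover have "exp (c * of_real 1) = 1"
    using twist_eq_1_iff[of a] assms tw[of 1] by simp
  ultimately show ?thesis
    using False by (simp add: integral_restrict_space tw has_bochner_integral_integral_eq)
qed

text \<open>The character and the cube both factor over the coordinates, so the integral is a
  product of circle integrals. A coordinate with \<open>p $ i \<noteq> 0\<close> contributes the
  factor 0.\<close>

lemma integral_box_twist:
  fixes p :: "real^'n"
  assumes p: "\<And>i. p $ i \<in> \<int>" "p \<noteq> 0"
  shows "(\<integral>\<xi>. twist (p \<bullet> \<xi>) \<partial>box_measure) = 0"
proof -
  interpret product_sigma_finite "\<lambda>_::real^'n. lborel :: real measure" by standard
  let ?g = "\<lambda>(b::real^'n) t. indicator {0..1} t *\<^sub>R twist ((p \<bullet> b) * t)"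
  let ?f = "\<lambda>x. \<Sum>b\<in>Basis. x b *\<^sub>R b :: real^'n"
  have meas: "(\<lambda>\<xi>. indicator (cbox 0 (\<chi> i. 1)) \<xi> *\<^sub>R twist (p \<bullet> \<xi>)) \<in> borel_measurable (borel :: (real^'n) measure)"
    by (intro borel_measurable_scaleR borel_measurable_indicator borel_measurable_continuous_onI continuous_intros) auto
  have f_meas: "?f \<in> (\<Pi>\<^sub>M b\<in>(Basis :: (real^'n) set). lborel) \<rightarrow>\<^sub>M borel"
  proof (rule borel_measurable_sum)
    fix b :: "real^'n" assume "b \<in> Basis"
    then have "(\<lambda>x. x b) \<in> (\<Pi>\<^sub>M b\<in>(Basis :: (real^'n) set). lborel) \<rightarrow>\<^sub>M (lborel :: real measure)"
      by (rule measurable_component_singleton)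
    then have "(\<lambda>x. x b) \<in> (\<Pi>\<^sub>M b\<in>(Basis :: (real^'n) set). lborel) \<rightarrow>\<^sub>M (borel :: real measure)"
      by (simp only: measurable_lborel1)
    then show "(\<lambda>x. x b *\<^sub>R b) \<in> (\<Pi>\<^sub>M b\<in>(Basis :: (real^'n) set). lborel) \<rightarrow>\<^sub>M borel"
      by (rule borel_measurable_scaleR[OF _ borel_measurable_const])
  qed
  have eq: "indicator (cbox 0 (\<chi> i. 1)) (?f x) *\<^sub>R twist (p \<bullet> ?f x) = (\<Prod>b\<in>Basis. ?g b (x b))" for x
  proof -
    have comp: "?f x \<bullet> b = x b" if "b \<in> Basis" for b
      using that by simp
    have one: "(\<chi> i. 1) \<bullet> b = 1" if "b \<in> Basis" for b :: "real^'n"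
      using that by (auto simp: Basis_vec_def inner_axis)
    have "indicator (cbox 0 (\<chi> i. 1)) (?f x) = (\<Prod>b\<in>(Basis :: (real^'n) set). indicator {0..1} (x b) :: real)"
    proof (cases "?f x \<in> cbox 0 (\<chi> i. 1)")
      case True
      then have "x b \<in> {0..1}" if "b \<in> Basis" for b
        using that by (auto simp: mem_box comp one)
      with True show ?thesis by simp
    next
      case False
      then obtain b :: "real^'n" where "b \<in> Basis" "x b \<notin> {0..1}"
        by (auto simp: mem_box comp one)
      then have "(\<Prod>b\<in>(Basis :: (real^'n) set). indicator {0..1} (x b) :: real) = 0"
        by (intro prod_zero) (auto intro!: bexI[of _ b])
      with False show ?thesis by simp
    qed
    moreover have "twist (p \<bullet> ?f x) = (\<Prod>b\<in>Basis. twist ((p \<bullet> b) * x b))"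
    proof -
      have "p \<bullet> ?f x = (\<Sum>b\<in>Basis. (p \<bullet> b) * x b)"
        by (simp add: inner_sum_right mult.commute)
      moreover have "twist (\<Sum>b\<in>A. h b) = (\<Prod>b\<in>A. twist (h b))" for A and h :: "real^'n \<Rightarrow> real"
        by (induction A rule: infinite_finite_induct) (auto simp: twist_add)
      ultimately show ?thesis by simp
    qed
    ultimately show ?thesis by (simp add: scaleR_conv_of_real prod.distrib)
  qed
  have "(\<integral>\<xi>. twist (p \<bullet> \<xi>) \<partial>box_measure) =
      (\<integral>\<xi>. indicator (cbox 0 (\<chi> i. 1)) \<xi> *\<^sub>R twist (p \<bullet> \<xi>) \<partial>lborel)"
    by (rule integral_restrict_space) simp
  also have "\<dots> = (\<integral>x. indicator (cbox 0 (\<chi> i. 1)) (?f x) *\<^sub>R twist (p \<bullet> ?f x)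
      \<partial>(\<Pi>\<^sub>M b\<in>(Basis :: (real^'n) set). lborel))"
    by (subst lborel_eq) (rule integral_distr[OF f_meas meas])
  also have "\<dots> = (\<Prod>b\<in>Basis. \<integral>t. ?g b t \<partial>lborel)"
    unfolding eq
  proof (rule product_integral_prod)
    fix b :: "real^'n"
    have "integrable unit_measure (\<lambda>t. twist ((p \<bullet> b) * t))"
      by (rule continuous_imp_integrable_unit[where B = 1]) (auto intro!: continuous_intros)
    then show "integrable lborel (?g b)" by (simp add: integrable_restrict_space)
  qed simp
  also have "\<dots> = 0"
  proof -
    obtain i where i: "p $ i \<noteq> 0" using p(2) by (auto simp: vec_eq_iff)
    have "(\<integral>t. ?g (axis i 1) t \<partial>lborel) = (\<integral>t. twist ((p $ i) * t) \<partial>unit_measure)"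
      by (simp add: integral_restrict_space inner_axis)
    also have "\<dots> = 0" using integral_unit_twist[OF p(1)[of i]] i by simp
    finally show ?thesis
      by (intro prod_zero) (auto simp: Basis_vec_def intro!: bexI[of _ "axis i 1"])
  qed
  finally show ?thesis .
qed

text \<open>Closure rules instead of explicit finite sums: convergence of orbit averages is then
  shown for characters and passed on by rule induction.\<close>

inductive trig_poly :: "(real^'n \<Rightarrow> complex) \<Rightarrow> bool" where
  trig_poly_char: "(\<And>i. p $ i \<in> \<int>) \<Longrightarrow> trig_poly (\<lambda>\<xi>. twist (p \<bullet> \<xi>))"
| trig_poly_add: "trig_poly f \<Longrightarrow> trig_poly g \<Longrightarrow> trig_poly (\<lambda>\<xi>. f \<xi> + g \<xi>)"
| trig_poly_scale: "trig_poly f \<Longrightarrow> trig_poly (\<lambda>\<xi>. c * f \<xi>)"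

lemma trig_poly_const: "trig_poly (\<lambda>\<xi>. c)"
  using trig_poly_scale[OF trig_poly_char[of 0], of c] by simp

lemma trig_poly_sum: "(\<And>i. i \<in> I \<Longrightarrow> trig_poly (f i)) \<Longrightarrow> trig_poly (\<lambda>\<xi>. \<Sum>i\<in>I. f i \<xi>)"
  by (induction I rule: infinite_finite_induct) (auto intro: trig_poly_const trig_poly_add)

lemma trig_poly_mult:
  assumes "trig_poly f" "trig_poly g"
  shows "trig_poly (\<lambda>\<xi>. f \<xi> * g \<xi>)"
  using assms(1)
proof induction
  case (trig_poly_char p)
  show ?case
    using assms(2)
  proof induction
    case (trig_poly_char q)
    have "trig_poly (\<lambda>\<xi>. twist ((p + q) \<bullet> \<xi>))"
      by (rule trig_poly.trig_poly_char) (simp add: trig_poly_char \<open>\<And>i. p $ i \<in> \<int>\<close>)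
    then show ?case by (simp add: inner_add_left twist_add)
  next
    case (trig_poly_add f g)
    then show ?case unfolding distrib_left by (intro trig_poly.trig_poly_add)
  next
    case (trig_poly_scale f c)
    then show ?case unfolding mult.left_commute[of _ c] by (intro trig_poly.trig_poly_scale)
  qed
next
  case (trig_poly_add f g)
  then show ?case unfolding distrib_right by (intro trig_poly.trig_poly_add)
next
  case (trig_poly_scale f c)
  then show ?case unfolding mult.assoc by (intro trig_poly.trig_poly_scale)
qed

lemma trig_poly_continuous: "trig_poly f \<Longrightarrow> continuous_on S f"
  by (induction rule: trig_poly.induct) (auto intro!: continuous_intros)

lemma trig_poly_bounded: "trig_poly f \<Longrightarrow> \<exists>B. \<forall>\<xi>. cmod (f \<xi>) \<le> B"
proof (induction rule: trig_poly.induct)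
  case (trig_poly_add f g)
  then obtain B C where "\<And>\<xi>. cmod (f \<xi>) \<le> B" "\<And>\<xi>. cmod (g \<xi>) \<le> C" by blast
  then show ?case by (intro exI[of _ "B + C"]) (auto intro: norm_triangle_mono)
next
  case (trig_poly_scale f c)
  then obtain B where "\<And>\<xi>. cmod (f \<xi>) \<le> B" by blast
  then show ?case by (intro exI[of _ "cmod c * B"]) (auto simp: norm_mult intro: mult_left_mono)
qed (auto intro: exI[of _ 1])

lemma trig_poly_coordinates:
  "trig_poly (\<lambda>\<xi>. complex_of_real (Re (twist (\<xi> $ i))))"
  "trig_poly (\<lambda>\<xi>. complex_of_real (Im (twist (\<xi> $ i))))"
proof -
  have 1: "trig_poly (\<lambda>\<xi>. twist (\<xi> $ i))"
  proof -
    have "\<And>j. axis i (1::real) $ j \<in> \<int>" by (simp add: axis_def)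
    from trig_poly_char[OF this] show ?thesis by (simp add: inner_axis')
  qed
  have 2: "trig_poly (\<lambda>\<xi>. cnj (twist (\<xi> $ i)))"
  proof -
    have "\<And>j. axis i (- 1::real) $ j \<in> \<int>" by (simp add: axis_def)
    from trig_poly_char[OF this] show ?thesis by (simp add: inner_axis' twist_minus)
  qed
  have "complex_of_real (Re z) = (1/2) * z + (1/2) * cnj z"
    and "complex_of_real (Im z) = (- \<i>/2) * z + (\<i>/2) * cnj z" for z
    by (simp_all add: complex_eq_iff)
  moreover have "trig_poly (\<lambda>\<xi>. c * twist (\<xi> $ i) + d * cnj (twist (\<xi> $ i)))" for c d
    by (rule trig_poly_add[OF trig_poly_scale[OF 1] trig_poly_scale[OF 2]])
  ultimately show "trig_poly (\<lambda>\<xi>. complex_of_real (Re (twist (\<xi> $ i))))"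
    "trig_poly (\<lambda>\<xi>. complex_of_real (Im (twist (\<xi> $ i))))"
    by presburger+
qed

text \<open>Polynomials supplied by Stone-Weierstrass on the torus in complex space become
  trigonometric polynomials once the coordinates \<open>twist (\<xi> $ i)\<close> are
  inserted.\<close>

lemma trig_poly_real_polynomial:
  fixes r :: "complex^'n \<Rightarrow> real"
  assumes "real_polynomial_function r"
  shows "trig_poly (\<lambda>\<xi>. complex_of_real (r (\<chi> i. twist (\<xi> $ i))))"
  using assms
proof induction
  case (linear h)
  interpret bounded_linear h by fact
  \<comment> \<open>\<open>h\<close> is only real-linear, so each complex coordinate needs the two
    basis vectors \<open>axis i 1\<close> and \<open>axis i \<i>\<close>.\<close>
  have h: "h z = (\<Sum>i\<in>UNIV. Re (z $ i) * h (axis i 1) + Im (z $ i) * h (axis i \<i>))" for z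
  proof -
    have "z = (\<Sum>i\<in>UNIV. Re (z $ i) *\<^sub>R axis i 1 + Im (z $ i) *\<^sub>R axis i \<i>)"
      by (simp add: vec_eq_iff axis_def sum.delta complex_eq_iff if_distrib cong: if_cong)
    then have "h z = h (\<Sum>i\<in>UNIV. Re (z $ i) *\<^sub>R axis i 1 + Im (z $ i) *\<^sub>R axis i \<i>)" by simp
    also have "\<dots> = (\<Sum>i\<in>UNIV. Re (z $ i) * h (axis i 1) + Im (z $ i) * h (axis i \<i>))"
      by (simp add: sum add scaleR)
    finally show ?thesis .
  qed
  have "(\<lambda>\<xi>. complex_of_real (h (\<chi> i. twist (\<xi> $ i)))) =
     (\<lambda>\<xi>. \<Sum>i\<in>UNIV. of_real (h (axis i 1)) * complex_of_real (Re (twist (\<xi> $ i)))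
        + of_real (h (axis i \<i>)) * complex_of_real (Im (twist (\<xi> $ i))))"
  proof (rule ext)
    fix \<xi> :: "real^'n"
    show "complex_of_real (h (\<chi> i. twist (\<xi> $ i))) = (\<Sum>i\<in>UNIV. of_real (h (axis i 1)) * complex_of_real (Re (twist (\<xi> $ i)))
        + of_real (h (axis i \<i>)) * complex_of_real (Im (twist (\<xi> $ i))))"
      using h[of "\<chi> i. twist (\<xi> $ i)"] by (simp add: mult.commute)
  qed
  moreover have "trig_poly \<dots>"
    by (intro trig_poly_sum trig_poly_add[OF trig_poly_scale trig_poly_scale] trig_poly_coordinates)
  ultimately show ?case by simp
next
  case (const c)
  then show ?case by (rule trig_poly_const)
next
  case (add f g)
  then show ?case unfolding of_real_add by (intro trig_poly_add)
next
  case (mult f g)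
  then show ?case unfolding of_real_mult by (intro trig_poly_mult)
qed

text \<open>A periodic function factors through the torus in complex space; the factor is continuous
  because the torus is the image of a compact cube, and Stone-Weierstrass applies there.\<close>

lemma trig_poly_dense:
  fixes F :: "real^'n \<Rightarrow> real"
  assumes cont: "continuous_on UNIV F" and per: "int_periodic F" and "\<epsilon> > 0"
  obtains P where "trig_poly P" "\<And>\<xi>. cmod (of_real (F \<xi>) - P \<xi>) < \<epsilon>"
proof -
  define E :: "real^'n \<Rightarrow> complex^'n" where "E = (\<lambda>\<xi>. \<chi> i. twist (\<xi> $ i))"
  let ?Q = "cbox 0 (\<chi> i. 1) :: (real^'n) set"
  have E_cont: "continuous_on S E" for S unfolding E_def by (intro continuous_intros)
  have frac: "\<exists>\<xi>'\<in>?Q. E \<xi>' = E \<xi> \<and> F \<xi>' = F \<xi>" for \<xi>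
  proof (intro bexI conjI)
    let ?\<xi>' = "\<chi> i. frac (\<xi> $ i)"
    have int: "?\<xi>' $ i - \<xi> $ i \<in> \<int>" for i by (simp add: frac_def)
    show "E ?\<xi>' = E \<xi>" using int by (auto simp: E_def vec_eq_iff intro: twist_cong)
    show "F ?\<xi>' = F \<xi>" using per int by (auto simp: int_periodic_def)
    show "?\<xi>' \<in> ?Q" by (auto simp: mem_box_cart frac_lt_1 less_imp_le)
  qed
  have F_cong: "F \<xi> = F \<xi>'" if "E \<xi> = E \<xi>'" for \<xi> \<xi>'
  proof -
    have "\<xi> $ i - \<xi>' $ i \<in> \<int>" for i
    proof -
      have eq: "twist (\<xi> $ i) = twist (\<xi>' $ i)" using that by (simp add: E_def vec_eq_iff)
      have "twist (\<xi> $ i - \<xi>' $ i) * twist (\<xi>' $ i) = twist (\<xi> $ i)" by (simp flip: twist_add)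
      moreover have "twist (\<xi>' $ i) \<noteq> 0" by (simp add: twist_def)
      ultimately have "twist (\<xi> $ i - \<xi>' $ i) = 1" using eq by simp
      then show ?thesis by (simp add: twist_eq_1_iff)
    qed
    then show ?thesis using per by (auto simp: int_periodic_def)
  qed
  \<comment> \<open>\<open>inv_into\<close> picks an arbitrary preimage; by \<open>F_cong\<close>
    the value does not depend on it.\<close>
  define F' where "F' = F \<circ> inv_into UNIV E"
  have F': "F' (E \<xi>) = F \<xi>" for \<xi>
    unfolding F'_def o_def by (rule F_cong) (simp add: f_inv_into_f)
  have compact: "compact (E ` ?Q)" by (intro compact_continuous_image E_cont compact_cbox)
  have "continuous_on (E ` ?Q) F'"
    unfolding continuous_on_closed_vimage[OF compact_imp_closed[OF compact]]
  proof (intro allI impI)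
    fix C :: "real set" assume C: "closed C"
    have "F' -` C \<inter> E ` ?Q = E ` (?Q \<inter> F -` C)" by (auto simp: F')
    moreover have "closed (F -` C)"
      using C cont by (simp add: continuous_on_closed_vimage)
    then have "compact (E ` (?Q \<inter> F -` C))"
      by (intro compact_continuous_image E_cont compact_Int_closed compact_cbox)
    ultimately show "closed (F' -` C \<inter> E ` ?Q)" by (simp add: compact_imp_closed)
  qed
  then obtain r where r: "real_polynomial_function r" "\<And>z. z \<in> E ` ?Q \<Longrightarrow> \<bar>F' z - r z\<bar> < \<epsilon>"
    using Stone_Weierstrass_real_polynomial_function[OF compact _ \<open>\<epsilon> > 0\<close>] by blast
  show ?thesis
  proof
    show "trig_poly (\<lambda>\<xi>. complex_of_real (r (E \<xi>)))"
      unfolding E_def by (rule trig_poly_real_polynomial) (rule r)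
    fix \<xi>
    have "E \<xi> \<in> E ` ?Q" using frac[of \<xi>] by (metis image_eqI)
    then have "\<bar>F \<xi> - r (E \<xi>)\<bar> < \<epsilon>" using r(2)[of "E \<xi>"] by (simp add: F')
    then show "cmod (of_real (F \<xi>) - complex_of_real (r (E \<xi>))) < \<epsilon>"
      by (metis norm_of_real of_real_diff)
  qed
qed

section \<open>Equidistribution along the diagonal\<close>

text \<open>Orthogonality of characters in quadratic form. It is used both for orbit averages, where
  frequencies may coincide, and for Birkhoff sums, where they are distinct.\<close>

lemma integral_double_twist:
  assumes "\<And>k. k \<in> I \<Longrightarrow> n k \<in> \<int>"
  shows "(\<integral>t. (\<Sum>k\<in>I. \<Sum>l\<in>I. c k l * twist ((n k - n l) * t)) \<partial>unit_measure) =
    (\<Sum>k\<in>I. \<Sum>l\<in>I. if n k = n l then c k l else 0)"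
proof -
  have int: "integrable unit_measure (\<lambda>t. c k l * twist ((n k - n l) * t))" for k l
    by (rule continuous_imp_integrable_unit[where B = "cmod (c k l)"])
      (auto intro!: continuous_intros simp: norm_mult)
  have "(\<integral>t. (\<Sum>k\<in>I. \<Sum>l\<in>I. c k l * twist ((n k - n l) * t)) \<partial>unit_measure) =
      (\<Sum>k\<in>I. \<Sum>l\<in>I. \<integral>t. c k l * twist ((n k - n l) * t) \<partial>unit_measure)"
    by (subst Bochner_Integration.integral_sum, intro Bochner_Integration.integrable_sum int)
      (intro sum.cong refl Bochner_Integration.integral_sum int)
  also have "\<dots> = (\<Sum>k\<in>I. \<Sum>l\<in>I. if n k = n l then c k l else 0)"
  proof (intro sum.cong refl)
    fix k l assume kl: "k \<in> I" "l \<in> I"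
    have "n k - n l \<in> \<int>" using assms kl by simp
    then show "(\<integral>t. c k l * twist ((n k - n l) * t) \<partial>unit_measure) = (if n k = n l then c k l else 0)"
      using integral_unit_twist[of "n k - n l"] by simp
  qed
  finally show ?thesis .
qed

lemma cmod_sum_mult_twist_sq:
  "complex_of_real ((cmod (\<Sum>k\<in>I. a k * twist (n k * t)))\<^sup>2) =
    (\<Sum>k\<in>I. \<Sum>l\<in>I. (a k * cnj (a l)) * twist ((n k - n l) * t))"
proof -
  have "twist ((n k - n l) * t) = twist (n k * t) * cnj (twist (n l * t))" for k l
    by (simp add: left_diff_distrib flip: twist_minus twist_add)
  then show ?thesis
    unfolding complex_norm_square cnj_sum sum_product by (simp add: mult_ac)
qed

lemma abs_increasing_less:
  fixes n :: "nat \<Rightarrow> real"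
  assumes "\<And>j. j0 \<le> j \<Longrightarrow> \<bar>n j\<bar> < \<bar>n (Suc j)\<bar>" "j0 \<le> i" "i < j"
  shows "\<bar>n i\<bar> < \<bar>n j\<bar>"
  using assms(3)
proof (induction j)
  case (Suc j)
  show ?case
  proof (cases "i = j")
    case False
    then have "\<bar>n i\<bar> < \<bar>n j\<bar>" using Suc by simp
    also have "\<dots> < \<bar>n (Suc j)\<bar>" using assms(1)[of j] assms(2) Suc.prems by simp
    finally show ?thesis .
  qed (use assms in auto)
qed simp

text \<open>Expanding the square leaves the number of pairs with \<open>n k = n l\<close>. For fixed
  \<open>k\<close> there are at most \<open>j0\<close> early indices \<open>l\<close> and at most
  one later one.\<close>

lemma integral_average_twist_le:
  fixes n :: "nat \<Rightarrow> real"
  assumes int: "\<And>j. n j \<in> \<int>" and inc: "\<And>j. j0 \<le> j \<Longrightarrow> \<bar>n j\<bar> < \<bar>n (Suc j)\<bar>"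
  shows "(\<integral>t. (cmod ((\<Sum>j<J. twist (n j * t)) / of_nat J))\<^sup>2 \<partial>unit_measure) \<le> (real j0 + 1) / real J"
proof (cases "J = 0")
  case False
  let ?I = "\<integral>t. (cmod (\<Sum>j<J. twist (n j * t)))\<^sup>2 \<partial>unit_measure"
  have "complex_of_real ?I = (\<integral>t. complex_of_real ((cmod (\<Sum>j<J. 1 * twist (n j * t)))\<^sup>2) \<partial>unit_measure)"
    unfolding mult_1_left by (rule integral_complex_of_real[symmetric])
  also have "\<dots> = (\<Sum>k<J. \<Sum>l<J. if n k = n l then 1 else 0)"
    unfolding cmod_sum_mult_twist_sq integral_double_twist[OF int]
    by (simp cong: if_cong)
  also have "\<dots> = complex_of_real (\<Sum>k<J. \<Sum>l<J. if n k = n l then 1 else 0)"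
    by (simp add: if_distrib cong: if_cong)
  finally have "?I = (\<Sum>k<J. \<Sum>l<J. if n k = n l then 1 else 0)"
    using of_real_eq_iff by blast
  also have "\<dots> \<le> (\<Sum>k<J. real j0 + 1)"
  proof (rule sum_mono)
    fix k assume "k \<in> {..<J}"
    let ?S = "{l. j0 \<le> l \<and> n k = n l}"
    have uniq: "l = l'" if "l \<in> ?S" "l' \<in> ?S" for l l'
      using abs_increasing_less[of j0 n l l', OF inc] abs_increasing_less[of j0 n l' l, OF inc] that
      by (cases l l' rule: linorder_cases) auto
    then have S: "finite ?S \<and> card ?S \<le> 1"
    proof (cases "?S = {}")
      case False
      then obtain l where "l \<in> ?S" by blast
      with uniq have "?S = {l}" by blast
      then show ?thesis by simp
    qed (simp only:, simp)
    have "(\<Sum>l<J. if n k = n l then 1 else 0) = real (card {l\<in>{..<J}. n k = n l})"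
      by (simp flip: sum.inter_filter)
    also have "card {l\<in>{..<J}. n k = n l} \<le> card ({..<j0} \<union> ?S)"
      by (rule card_mono) (use S in auto)
    also have "\<dots> \<le> j0 + 1" using card_Un_le[of "{..<j0}" ?S] S by simp
    finally show "(\<Sum>l<J. if n k = n l then 1 else 0) \<le> real j0 + 1" by simp
  qed
  finally have "?I \<le> real J * (real j0 + 1)" by simp
  then have "?I / (real J)\<^sup>2 \<le> real J * (real j0 + 1) / (real J)\<^sup>2" by (intro divide_right_mono) auto
  also have "\<dots> = (real j0 + 1) / real J" using False by (simp add: power2_eq_square)
  finally show ?thesis by (simp add: norm_divide power_divide)
qed simp

text \<open>By linearity only characters matter. The constant one is averaged exactly; every other
  one has mean 0 on the torus, and its values along the orbit have eventually distinct integer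
  frequencies, hence are almost orthogonal on the diagonal.\<close>

lemma trig_poly_orbit_average_tendsto:
  fixes \<zeta> :: "'a::finite \<Rightarrow> 'a list"
  assumes freq: "\<And>p::real^'a. p \<noteq> 0 \<Longrightarrow> \<exists>j0. \<forall>j\<ge>j0. \<bar>p \<bullet> (torus_endo \<zeta> ^^ (j * K)) (\<chi> i. 1)\<bar> <
      \<bar>p \<bullet> (torus_endo \<zeta> ^^ (Suc j * K)) (\<chi> i. 1)\<bar>"
    and P: "trig_poly P"
  shows "(\<lambda>J. \<integral>\<omega>. (cmod ((\<Sum>j<J. P ((torus_endo \<zeta> ^^ (j * K)) (\<chi> i. \<omega>))) / of_nat J -
      (\<integral>\<xi>. P \<xi> \<partial>box_measure)))\<^sup>2 \<partial>unit_measure) \<longlonglongrightarrow> 0"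
  using P
proof induction
  case (trig_poly_char p)
  define n where "n = (\<lambda>j. p \<bullet> (torus_endo \<zeta> ^^ (j * K)) (\<chi> i. 1))"
  have n: "p \<bullet> (torus_endo \<zeta> ^^ (j * K)) (\<chi> i. \<omega>) = n j * \<omega>" for j \<omega>
    unfolding n_def by (simp add: inner_vec_def funpow_torus_endo_diagonal sum_distrib_left mult_ac)
  have int: "n j \<in> \<int>" for j
    using trig_poly_char by (auto simp: n_def inner_vec_def funpow_torus_endo_diagonal intro!: Ints_sum Ints_mult)
  show ?case
  proof (cases "p = 0")
    case True
    interpret prob_space "box_measure :: (real^'a) measure" by (rule prob_space_box_measure)
    have "(\<integral>\<xi>. twist (p \<bullet> \<xi>) \<partial>box_measure) = 1"
      using True prob_space by simp
    \<comment> \<open>The start at 1 matters: for \<open>J = 0\<close> the average is 0 by the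
      convention on division and misses the integral 1.\<close>
    then have "\<forall>\<^sub>F J in sequentially. (\<integral>\<omega>. (cmod ((\<Sum>j<J. twist (p \<bullet> (torus_endo \<zeta> ^^ (j * K)) (\<chi> i. \<omega>))) / of_nat J -
      (\<integral>\<xi>. twist (p \<bullet> \<xi>) \<partial>box_measure)))\<^sup>2 \<partial>unit_measure) = 0"
      using True by (intro eventually_sequentiallyI[of 1]) simp
    then show ?thesis by (rule tendsto_eventually)
  next
    case False
    then obtain j0 where j0: "\<And>j. j0 \<le> j \<Longrightarrow> \<bar>n j\<bar> < \<bar>n (Suc j)\<bar>" using freq unfolding n_def by blast
    have 0: "(\<integral>\<xi>. twist (p \<bullet> \<xi>) \<partial>box_measure) = 0"
      using integral_box_twist[of p] trig_poly_char False by blast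
    have "(\<lambda>J. \<integral>t. (cmod ((\<Sum>j<J. twist (n j * t)) / of_nat J))\<^sup>2 \<partial>unit_measure) \<longlonglongrightarrow> 0"
    proof (rule tendsto_sandwich[OF _ _ tendsto_const])
      show "(\<lambda>J. (real j0 + 1) / real J) \<longlonglongrightarrow> 0" by (rule lim_const_over_n)
      show "\<forall>\<^sub>F J in sequentially. (\<integral>t. (cmod ((\<Sum>j<J. twist (n j * t)) / of_nat J))\<^sup>2 \<partial>unit_measure) \<le> (real j0 + 1) / real J"
        by (intro always_eventually allI integral_average_twist_le int j0)
    qed (auto intro!: always_eventually)
    then show ?thesis by (simp add: n 0)
  qed
next
  case (trig_poly_add f g)
  let ?A = "\<lambda>h J \<omega>. (\<Sum>j<J. h ((torus_endo \<zeta> ^^ (j * K)) (\<chi> i. \<omega>))) / of_nat J - (\<integral>\<xi>. h \<xi> \<partial>box_measure)"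
  have int_box: "integrable box_measure h" if h: "trig_poly h" for h :: "real^'a \<Rightarrow> complex"
  proof -
    obtain B where "\<And>\<xi>. cmod (h \<xi>) \<le> B" using trig_poly_bounded[OF h] by blast
    then show ?thesis by (rule continuous_imp_integrable_box[OF trig_poly_continuous[OF h]])
  qed
  have A_cont: "continuous_on UNIV (?A h J)" if h: "trig_poly h" for h J
  proof -
    have "continuous_on UNIV (\<lambda>\<omega>. h ((torus_endo \<zeta> ^^ (j * K)) (\<chi> i. \<omega>)))" for j
      by (rule continuous_on_compose2[OF trig_poly_continuous[OF h, of UNIV]]) (auto intro!: continuous_intros)
    then show ?thesis unfolding divide_inverse by (intro continuous_intros)
  qed
  have A_int: "integrable unit_measure (\<lambda>\<omega>. (cmod (?A h J \<omega>))\<^sup>2)" if h: "trig_poly h" for h J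
  proof -
    obtain B where B: "\<And>\<xi>. cmod (h \<xi>) \<le> B" using trig_poly_bounded[OF h] by blast
    have B0: "0 \<le> B" using B norm_ge_zero order_trans by blast
    have "cmod (?A h J \<omega>) \<le> B + cmod (\<integral>\<xi>. h \<xi> \<partial>box_measure)" for \<omega>
    proof -
      have "cmod (\<Sum>j<J. h ((torus_endo \<zeta> ^^ (j * K)) (\<chi> i. \<omega>))) \<le> real J * B"
        using sum_norm_le[of "{..<J}" "\<lambda>j. h ((torus_endo \<zeta> ^^ (j * K)) (\<chi> i. \<omega>))" "\<lambda>_. B"] B by simp
      then have "cmod ((\<Sum>j<J. h ((torus_endo \<zeta> ^^ (j * K)) (\<chi> i. \<omega>))) / of_nat J) \<le> B"
        using B0 by (cases "J = 0") (simp_all add: norm_divide divide_le_eq mult.commute)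
      then show ?thesis using norm_triangle_ineq4 order_trans add_right_mono by meson
    qed
    then have "norm ((cmod (?A h J \<omega>))\<^sup>2) \<le> (B + cmod (\<integral>\<xi>. h \<xi> \<partial>box_measure))\<^sup>2" for \<omega>
      by (simp add: power_mono)
    then show ?thesis
      by (intro continuous_imp_integrable_unit continuous_intros A_cont h)
  qed
  have fg: "?A (\<lambda>\<xi>. f \<xi> + g \<xi>) J \<omega> = ?A f J \<omega> + ?A g J \<omega>" for J \<omega>
    using int_box[OF trig_poly_add.hyps(1)] int_box[OF trig_poly_add.hyps(2)]
    by (simp add: sum.distrib add_divide_distrib)
  show ?case
  proof (rule tendsto_sandwich[OF _ _ tendsto_const])
    let ?u = "\<lambda>h J. \<integral>\<omega>. (cmod (?A h J \<omega>))\<^sup>2 \<partial>unit_measure"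
    show "(\<lambda>J. 2 * ?u f J + 2 * ?u g J) \<longlonglongrightarrow> 0"
      using tendsto_add[OF tendsto_mult_left[OF trig_poly_add.IH(1), of 2] tendsto_mult_left[OF trig_poly_add.IH(2), of 2]]
      by simp
    have "?u (\<lambda>\<xi>. f \<xi> + g \<xi>) J \<le> 2 * ?u f J + 2 * ?u g J" for J
    proof -
      have "?u (\<lambda>\<xi>. f \<xi> + g \<xi>) J \<le> (\<integral>\<omega>. 2 * (cmod (?A f J \<omega>))\<^sup>2 + 2 * (cmod (?A g J \<omega>))\<^sup>2 \<partial>unit_measure)"
      proof (rule integral_mono)
        show "integrable unit_measure (\<lambda>\<omega>. (cmod (?A (\<lambda>\<xi>. f \<xi> + g \<xi>) J \<omega>))\<^sup>2)"
          by (intro A_int trig_poly.trig_poly_add trig_poly_add)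
        show "integrable unit_measure (\<lambda>\<omega>. 2 * (cmod (?A f J \<omega>))\<^sup>2 + 2 * (cmod (?A g J \<omega>))\<^sup>2)"
          by (intro Bochner_Integration.integrable_add integrable_mult_right A_int trig_poly_add)
      qed (unfold fg, rule cmod_add_sq_le)
      also have "\<dots> = 2 * ?u f J + 2 * ?u g J"
        by (subst Bochner_Integration.integral_add)
          (auto intro!: integrable_mult_right A_int trig_poly_add)
      finally show ?thesis .
    qed
    then show "\<forall>\<^sub>F J in sequentially. ?u (\<lambda>\<xi>. f \<xi> + g \<xi>) J \<le> 2 * ?u f J + 2 * ?u g J"
      by (rule always_eventually[OF allI])
  qed (auto intro!: always_eventually)
next
  case (trig_poly_scale f c)
  have eq: "(\<Sum>j<J. c * f ((torus_endo \<zeta> ^^ (j * K)) (\<chi> i. \<omega>))) / of_nat J - (\<integral>\<xi>. c * f \<xi> \<partial>box_measure)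
     = c * ((\<Sum>j<J. f ((torus_endo \<zeta> ^^ (j * K)) (\<chi> i. \<omega>))) / of_nat J - (\<integral>\<xi>. f \<xi> \<partial>box_measure))" for J \<omega>
    by (simp add: sum_distrib_left[symmetric] right_diff_distrib)
  show ?case
    unfolding eq norm_mult power_mult_distrib
    using tendsto_mult_left[OF trig_poly_scale.IH, of "(cmod c)\<^sup>2"] by simp
qed

lemma orbit_average_in_measure:
  fixes \<zeta> :: "'a::finite \<Rightarrow> 'a list" and F :: "real^'a \<Rightarrow> real"
  assumes freq: "\<And>p::real^'a. p \<noteq> 0 \<Longrightarrow> \<exists>j0. \<forall>j\<ge>j0. \<bar>p \<bullet> (torus_endo \<zeta> ^^ (j * K)) (\<chi> i. 1)\<bar> <
      \<bar>p \<bullet> (torus_endo \<zeta> ^^ (Suc j * K)) (\<chi> i. 1)\<bar>"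
    and F: "continuous_on UNIV F" "int_periodic F" "\<And>\<xi>. \<bar>F \<xi>\<bar> \<le> B"
    and \<gamma>: "(\<integral>\<xi>. F \<xi> \<partial>box_measure) < \<gamma>"
  shows "(\<lambda>J. measure lborel {\<omega>\<in>{0..1}. real J * \<gamma> < (\<Sum>j<J. F ((torus_endo \<zeta> ^^ (j * K)) (\<chi> i. \<omega>)))})
    \<longlonglongrightarrow> 0"
proof -
  \<comment> \<open>A quarter of the gap: one part pays for replacing \<open>F\<close> by
    \<open>P\<close> along the orbit, one for the same under the integral, and what remains for
    \<open>A\<close> still exceeds \<open>\<delta>\<close>.\<close>
  define \<delta> where "\<delta> = (\<gamma> - (\<integral>\<xi>. F \<xi> \<partial>box_measure)) / 4"
  have \<delta>: "\<delta> > 0" using \<gamma> by (simp add: \<delta>_def)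
  obtain P where P: "trig_poly P" "\<And>\<xi>. cmod (of_real (F \<xi>) - P \<xi>) < \<delta>"
    using trig_poly_dense[OF F(1,2) \<delta>] by blast
  let ?X = "\<lambda>j \<omega>. (torus_endo \<zeta> ^^ (j * K)) (\<chi> i. \<omega>)"
  define A where "A = (\<lambda>J \<omega>. (\<Sum>j<J. P (?X j \<omega>)) / of_nat J - (\<integral>\<xi>. P \<xi> \<partial>box_measure))"
  have lim: "(\<lambda>J. \<integral>\<omega>. (cmod (A J \<omega>))\<^sup>2 \<partial>unit_measure) \<longlonglongrightarrow> 0"
    unfolding A_def by (rule trig_poly_orbit_average_tendsto[OF freq P(1)])
  interpret box: prob_space "box_measure :: (real^'a) measure" by (rule prob_space_box_measure)
  interpret U: prob_space unit_measure by (rule prob_space_unit_measure)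
  obtain B' where B': "\<And>\<xi>. cmod (P \<xi>) \<le> B'" using trig_poly_bounded[OF P(1)] by blast
  have P_int: "integrable box_measure P"
    by (rule continuous_imp_integrable_box[OF trig_poly_continuous[OF P(1)] B'])
  have F_int: "integrable box_measure F"
    by (rule continuous_imp_integrable_box[OF F(1), of B]) (simp add: F)
  have IP: "Re (\<integral>\<xi>. P \<xi> \<partial>box_measure) \<le> (\<integral>\<xi>. F \<xi> \<partial>box_measure) + \<delta>"
  proof -
    have "Re (\<integral>\<xi>. P \<xi> \<partial>box_measure) = (\<integral>\<xi>. Re (P \<xi>) \<partial>box_measure)" using P_int by simp
    also have "\<dots> \<le> (\<integral>\<xi>. F \<xi> + \<delta> \<partial>box_measure)"
    proof (rule integral_mono)
      fix \<xi> show "Re (P \<xi>) \<le> F \<xi> + \<delta>"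
        using abs_Re_le_cmod[of "of_real (F \<xi>) - P \<xi>"] P(2)[of \<xi>] by simp
    qed (use P_int F_int in auto)
    also have "\<dots> = (\<integral>\<xi>. F \<xi> \<partial>box_measure) + \<delta>" using F_int box.prob_space by simp
    finally show ?thesis .
  qed
  have A_int: "integrable unit_measure (\<lambda>\<omega>. (cmod (A J \<omega>))\<^sup>2)" for J
  proof -
    have c: "continuous_on UNIV (\<lambda>\<omega>. P (?X j \<omega>))" for j
      by (rule continuous_on_compose2[OF trig_poly_continuous[OF P(1), of UNIV]]) (auto intro!: continuous_intros)
    have "continuous_on UNIV (A J)"
      unfolding A_def divide_inverse by (intro continuous_intros c)
    then have 1: "(\<lambda>\<omega>. (cmod (A J \<omega>))\<^sup>2) \<in> borel_measurable unit_measure"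
      by (intro unit_measurable borel_measurable_continuous_onI continuous_intros)
    have "continuous_on {0..1} (A J)" using \<open>continuous_on UNIV (A J)\<close> by (rule continuous_on_subset) simp
    then have "bounded (A J ` {0..1})"
      by (intro compact_imp_bounded compact_continuous_image) auto
    then obtain D where D: "\<forall>\<omega>\<in>{0..1}. cmod (A J \<omega>) \<le> D" by (auto simp: bounded_iff)
    show ?thesis
    proof (rule U.integrable_const_bound[OF AE_I2 1])
      fix \<omega> assume "\<omega> \<in> space unit_measure"
      then show "norm ((cmod (A J \<omega>))\<^sup>2) \<le> D\<^sup>2" using D by (simp add: space_restrict_space power_mono)
    qed
  qed
  have bound: "measure lborel {\<omega>\<in>{0..1}. real J * \<gamma> < (\<Sum>j<J. F (?X j \<omega>))} \<le>
      (\<integral>\<omega>. (cmod (A J \<omega>))\<^sup>2 \<partial>unit_measure) / \<delta>\<^sup>2" for J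
  proof -
    let ?S = "{\<omega>\<in>{0..1}. real J * \<gamma> < (\<Sum>j<J. F (?X j \<omega>))}"
    have sub: "?S \<subseteq> {\<omega> \<in> space unit_measure. \<delta>\<^sup>2 \<le> (cmod (A J \<omega>))\<^sup>2}"
    proof
      fix \<omega> assume \<omega>: "\<omega> \<in> ?S"
      then have J: "J > 0" by (cases J) auto
      have "(\<Sum>j<J. F (?X j \<omega>)) \<le> (\<Sum>j<J. Re (P (?X j \<omega>)) + \<delta>)"
      proof (rule sum_mono)
        fix j
        show "F (?X j \<omega>) \<le> Re (P (?X j \<omega>)) + \<delta>"
          using abs_Re_le_cmod[of "of_real (F (?X j \<omega>)) - P (?X j \<omega>)"] P(2)[of "?X j \<omega>"] by simp
      qed
      also have "\<dots> = Re (\<Sum>j<J. P (?X j \<omega>)) + real J * \<delta>" by (simp add: sum.distrib)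
      also have "(\<Sum>j<J. P (?X j \<omega>)) = of_nat J * (A J \<omega> + (\<integral>\<xi>. P \<xi> \<partial>box_measure))"
        using J by (simp add: A_def)
      also have "Re \<dots> + real J * \<delta> = real J * (Re (A J \<omega>) + Re (\<integral>\<xi>. P \<xi> \<partial>box_measure) + \<delta>)"
        by (simp add: algebra_simps del: integral_Re)
      finally have "real J * \<gamma> < real J * (Re (A J \<omega>) + Re (\<integral>\<xi>. P \<xi> \<partial>box_measure) + \<delta>)"
        using \<omega> by auto
      then have "\<gamma> < Re (A J \<omega>) + Re (\<integral>\<xi>. P \<xi> \<partial>box_measure) + \<delta>"
        using J by (simp del: integral_Re)
      then have "\<delta> \<le> cmod (A J \<omega>)"
        using IP \<delta> complex_Re_le_cmod[of "A J \<omega>"] unfolding \<delta>_def by argo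
      then show "\<omega> \<in> {\<omega> \<in> space unit_measure. \<delta>\<^sup>2 \<le> (cmod (A J \<omega>))\<^sup>2}"
        using \<omega> \<delta> by (simp add: space_restrict_space power_mono)
    qed
    have meas: "{\<omega> \<in> space unit_measure. \<delta>\<^sup>2 \<le> (cmod (A J \<omega>))\<^sup>2} \<in> sets unit_measure"
      using A_int[of J, THEN borel_measurable_integrable] by measurable
    have "measure lborel ?S = measure unit_measure ?S"
      by (subst measure_restrict_space) auto
    also have "\<dots> \<le> measure unit_measure {\<omega> \<in> space unit_measure. \<delta>\<^sup>2 \<le> (cmod (A J \<omega>))\<^sup>2}"
      by (rule U.finite_measure_mono[OF sub meas])
    also have "\<dots> \<le> (\<integral>\<omega>. (cmod (A J \<omega>))\<^sup>2 \<partial>unit_measure) / \<delta>\<^sup>2"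
      by (rule integral_Markov_inequality_measure[OF A_int sets.empty_sets]) (use \<delta> in auto)
    finally show ?thesis .
  qed
  show ?thesis
  proof (rule tendsto_sandwich[OF _ _ tendsto_const])
    show "(\<lambda>J. (\<integral>\<omega>. (cmod (A J \<omega>))\<^sup>2 \<partial>unit_measure) / \<delta>\<^sup>2) \<longlonglongrightarrow> 0"
      using tendsto_divide[OF lim tendsto_const[of "\<delta>\<^sup>2"]] \<delta> by simp
    show "\<forall>\<^sub>F J in sequentially. measure lborel {\<omega>\<in>{0..1}. real J * \<gamma> < (\<Sum>j<J. F (?X j \<omega>))} \<le>
      (\<integral>\<omega>. (cmod (A J \<omega>))\<^sup>2 \<partial>unit_measure) / \<delta>\<^sup>2"
      by (intro always_eventually allI bound)
  qed (auto intro!: always_eventually)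
qed

text \<open>Since the target is nonnegative, the cocycle may be clipped at 1. This gives the domination
  from below, and it absorbs the junk value \<open>ln 0 = 0\<close>.\<close>

lemma exists_block_length:
  fixes \<zeta> :: "'a::finite \<Rightarrow> 'a list"
  assumes lyap: "is_lyapunov_exponent \<zeta> \<chi>'" and "max \<chi>' 0 < c"
  obtains K where "K > 0"
    "(\<integral>\<xi>. ln (max 1 (norm (fourier_cocycle \<zeta> \<xi> K))) / real K \<partial>box_measure) < c"
proof -
  let ?f = "\<lambda>n \<xi>. ln (max 1 (norm (fourier_cocycle \<zeta> \<xi> n))) / real n"
  interpret prob_space "box_measure :: (real^'a) measure" by (rule prob_space_box_measure)
  obtain C where C: "C \<ge> 1" "\<And>\<xi>. norm (fourier_matrix \<zeta> \<xi>) \<le> C" using fourier_matrix_bounded by blast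
  define D where "D = norm (mat 1 :: complex^'a^'a)"
  have f_eq: "?f n \<xi> = max 0 (ln (norm (fourier_cocycle \<zeta> \<xi> n)) / real n)" for n \<xi>
  proof (cases "norm (fourier_cocycle \<zeta> \<xi> n) \<ge> 1")
    case True then show ?thesis by simp
  next
    case False
    then have "ln (norm (fourier_cocycle \<zeta> \<xi> n)) \<le> 0"
      by (cases "fourier_cocycle \<zeta> \<xi> n = 0") auto
    then have "ln (norm (fourier_cocycle \<zeta> \<xi> n)) / real n \<le> 0" by (simp add: divide_nonpos_nonneg)
    moreover have "max 1 (norm (fourier_cocycle \<zeta> \<xi> n)) = 1" using False by simp
    ultimately show ?thesis by (simp add: max_absorb1)
  qed
  have meas: "?f n \<in> borel_measurable box_measure" for n
    by (intro box_measurable borel_measurable_divide borel_measurable_const borel_measurable_ln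
      borel_measurable_max borel_measurable_continuous_onI continuous_intros)
  have "(\<lambda>n. \<integral>\<xi>. ?f n \<xi> \<partial>box_measure) \<longlonglongrightarrow> (\<integral>\<xi>. max 0 \<chi>' \<partial>(box_measure :: (real^'a) measure))"
  \<comment> \<open>From the bound \<open>C ^ n * D\<close>: for positive \<open>n\<close>, the
    logarithm divided by \<open>n\<close> is at most \<open>ln C\<close> plus the positive part of
    \<open>ln D\<close>.\<close>
  proof (rule integral_dominated_convergence[where w = "\<lambda>_. ln C + max 0 (ln D)"])
    have "AE \<xi> in lborel. (\<lambda>n. ln (norm (fourier_cocycle \<zeta> \<xi> n)) / real n) \<longlonglongrightarrow> \<chi>'"
      using lyap by (simp add: is_lyapunov_exponent_def)
    then have "AE \<xi> in lborel. (\<lambda>n. ?f n \<xi>) \<longlonglongrightarrow> max 0 \<chi>'"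
      unfolding f_eq by eventually_elim (intro tendsto_intros)
    then show "AE \<xi> in box_measure. (\<lambda>n. ?f n \<xi>) \<longlonglongrightarrow> max 0 \<chi>'"
      by (subst AE_restrict_space_iff) auto
    show "AE \<xi> in box_measure. norm (?f n \<xi>) \<le> ln C + max 0 (ln D)" for n
    proof (rule AE_I2)
      fix \<xi> :: "real^'a"
      show "norm (?f n \<xi>) \<le> ln C + max 0 (ln D)"
      proof (cases "n = 0")
        case True
        then show ?thesis using C(1) by simp
      next
        case False
        let ?x = "norm (fourier_cocycle \<zeta> \<xi> n)"
        have "?x \<le> C ^ n * D" unfolding D_def by (rule norm_fourier_cocycle_le[OF C(2)])
        also have "\<dots> \<le> C ^ n * max 1 D" using C(1) by (intro mult_left_mono) auto
        finally have "max 1 ?x \<le> C ^ n * max 1 D"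
          using mult_mono[of 1 "C ^ n" 1 "max 1 D"] C(1) by (simp add: one_le_power)
        then have "ln (max 1 ?x) \<le> ln (C ^ n * max 1 D)" by simp
        also have "\<dots> = real n * ln C + ln (max 1 D)"
          using C(1) by (simp add: ln_mult ln_realpow)
        also have "ln (max 1 D) \<le> real n * ln (max 1 D)"
          using False mult_right_mono[of 1 "real n" "ln (max 1 D)"] by simp
        finally have "ln (max 1 ?x) \<le> (ln C + ln (max 1 D)) * real n" by (simp add: algebra_simps)
        then have "?f n \<xi> \<le> ln C + ln (max 1 D)" using False by (simp add: divide_le_eq)
        also have "ln (max 1 D) \<le> max 0 (ln D)" by (auto simp: max_def)
        finally show ?thesis by simp
      qed
    qed
  qed (use meas in simp_all)
  then have "(\<lambda>n. \<integral>\<xi>. ?f n \<xi> \<partial>box_measure) \<longlonglongrightarrow> max 0 \<chi>'" using prob_space by simp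
  then have "\<forall>\<^sub>F n in sequentially. (\<integral>\<xi>. ?f n \<xi> \<partial>box_measure) < c"
    using assms(2) by (intro order_tendstoD) (auto simp: max.commute)
  then have "\<forall>\<^sub>F n in sequentially. (\<integral>\<xi>. ?f n \<xi> \<partial>box_measure) < c \<and> n > 0"
    using eventually_gt_at_top[of 0] by eventually_elim simp
  then show ?thesis using that by (auto simp: eventually_sequentially)
qed

section \<open>Approximation by functions of finitely many coordinates\<close>

definition depends_on_window :: "nat \<Rightarrow> ((int \<Rightarrow> 'a) \<Rightarrow> 'b) \<Rightarrow> bool" where
  "depends_on_window m g \<longleftrightarrow> (\<forall>x y. (\<forall>i. \<bar>i\<bar> \<le> int m \<longrightarrow> x i = y i) \<longrightarrow> g x = g y)"

lemma depends_on_window_mono: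
  "depends_on_window m g \<Longrightarrow> m \<le> n \<Longrightarrow> depends_on_window n g"
  unfolding depends_on_window_def by (meson of_nat_mono order_trans)

lemma sets_full_shift_space:
  "sets (full_shift_space :: (int \<Rightarrow> 'a) measure) = sigma_sets UNIV {{x. x i \<in> A} | i A. True}"
  unfolding full_shift_space_def by (simp add: sets_PiM_single)

lemma space_full_shift_space [simp]: "space full_shift_space = UNIV"
  unfolding full_shift_space_def by (simp add: space_PiM)

text \<open>Membership in the closure of the algebra of finite-window sets under the pseudometric
  given by the measure of the symmetric difference.\<close>

definition window_approx_set :: "(int \<Rightarrow> 'a) measure \<Rightarrow> (int \<Rightarrow> 'a) set \<Rightarrow> bool" where
  "window_approx_set \<mu> A \<longleftrightarrow> (\<forall>\<epsilon>>0. \<exists>m C. C \<in> sets \<mu> \<and> depends_on_window m (\<lambda>x. x \<in> C) \<and>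
    measure \<mu> ((A - C) \<union> (C - A)) < \<epsilon>)"

text \<open>Half of \<open>\<epsilon>\<close> goes into cutting the union down to finitely many
  sets, by continuity from below; the other half is shared by their approximations. Finitely many
  windows fit into a common one, which is why the cut comes first.\<close>

lemma window_approx_set_UN:
  assumes "prob_space \<mu>" and A: "\<And>n::nat. A n \<in> sets \<mu>" "\<And>n. window_approx_set \<mu> (A n)"
  shows "window_approx_set \<mu> (\<Union>n. A n)"
  unfolding window_approx_set_def
proof (intro allI impI)
  fix \<epsilon> :: real assume "\<epsilon> > 0"
  interpret prob_space \<mu> by fact
  have "(\<lambda>N. measure \<mu> (\<Union>n<N. A n)) \<longlonglongrightarrow> measure \<mu> (\<Union>N. \<Union>n<N. A n)"
    using A by (intro finite_Lim_measure_incseq incseq_SucI) (auto simp: less_Suc_eq)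
  moreover have "(\<Union>N. \<Union>n<N. A n) = (\<Union>n. A n)" by auto
  ultimately have "\<forall>\<^sub>F N in sequentially. measure \<mu> (\<Union>n. A n) - \<epsilon> / 2 < measure \<mu> (\<Union>n<N. A n)"
    using \<open>\<epsilon> > 0\<close> by (intro order_tendstoD(1)) auto
  then obtain N where N: "measure \<mu> (\<Union>n. A n) - \<epsilon> / 2 < measure \<mu> (\<Union>n<N. A n)"
    by (auto simp: eventually_sequentially)
  \<comment> \<open>\<open>real N + 1\<close> instead of \<open>real N\<close> keeps the denominator
    positive for \<open>N = 0\<close>.\<close>
  define \<eta> where "\<eta> = \<epsilon> / (2 * (real N + 1))"
  have \<eta>: "\<eta> > 0" using \<open>\<epsilon> > 0\<close> by (simp add: \<eta>_def)
  have "\<forall>n. \<exists>m C. C \<in> sets \<mu> \<and> depends_on_window m (\<lambda>x. x \<in> C) \<and> measure \<mu> ((A n - C) \<union> (C - A n)) < \<eta>"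
    using A(2) \<eta> by (auto simp: window_approx_set_def)
  then obtain m C where C: "\<And>n. C n \<in> sets \<mu>" "\<And>n. depends_on_window (m n) (\<lambda>x. x \<in> C n)"
    "\<And>n. measure \<mu> ((A n - C n) \<union> (C n - A n)) < \<eta>" by metis
  let ?C = "\<Union>n<N. C n"
  have "depends_on_window (Max (m ` {..<N})) (\<lambda>x. x \<in> C n)" if "n < N" for n
    by (rule depends_on_window_mono[OF C(2)]) (use that in auto)
  then have "depends_on_window (Max (m ` {..<N})) (\<lambda>x. x \<in> ?C)"
    unfolding depends_on_window_def by (simp add: Bex_def) blast
  moreover have "?C \<in> sets \<mu>" using C(1) by auto
  moreover have "measure \<mu> (((\<Union>n. A n) - ?C) \<union> (?C - (\<Union>n. A n))) < \<epsilon>"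
  proof -
    let ?D = "\<lambda>n. (A n - C n) \<union> (C n - A n)"
    let ?R = "(\<Union>n. A n) - (\<Union>n<N. A n)"
    have "measure \<mu> (((\<Union>n. A n) - ?C) \<union> (?C - (\<Union>n. A n))) \<le> measure \<mu> (?R \<union> (\<Union>n<N. ?D n))"
      by (rule finite_measure_mono) (use A C in auto)
    also have "\<dots> \<le> measure \<mu> ?R + measure \<mu> (\<Union>n<N. ?D n)"
      by (rule measure_Un_le) (use A C in auto)
    also have "measure \<mu> ?R = measure \<mu> (\<Union>n. A n) - measure \<mu> (\<Union>n<N. A n)"
      by (rule finite_measure_Diff) (use A in auto)
    also have "measure \<mu> (\<Union>n<N. ?D n) \<le> (\<Sum>n<N. measure \<mu> (?D n))"
      by (rule measure_UNION_le) (use A C in auto)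
    also have "\<dots> \<le> (\<Sum>n<N. \<eta>)" by (intro sum_mono less_imp_le C(3))
    also have "\<dots> \<le> \<epsilon> / 2"
      using \<open>\<epsilon> > 0\<close> by (simp add: \<eta>_def field_simps)
    finally show ?thesis using N by linarith
  qed
  ultimately show "\<exists>m C. C \<in> sets \<mu> \<and> depends_on_window m (\<lambda>x. x \<in> C) \<and>
      measure \<mu> (((\<Union>n. A n) - C) \<union> (C - (\<Union>n. A n))) < \<epsilon>" by blast
qed

text \<open>The approximable sets are closed under complements and countable unions and contain the
  conditions on a single coordinate, which generate the sigma-algebra.\<close>

lemma window_approx_setI:
  fixes \<mu> :: "(int \<Rightarrow> 'a) measure"
  assumes sets: "sets \<mu> = sets full_shift_space" and prob: "prob_space \<mu>" and "A \<in> sets \<mu>"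
  shows "window_approx_set \<mu> A"
proof -
  let ?G = "{{x. x i \<in> A} | i A. True} :: (int \<Rightarrow> 'a) set set"
  have \<mu>: "sets \<mu> = sigma_sets UNIV ?G" by (simp add: sets sets_full_shift_space)
  have "A \<in> sigma_sets UNIV ?G" using assms(3) \<mu> by simp
  then show ?thesis
  proof induction
    case (Basic a)
    then obtain i B where a: "a = {x. x i \<in> B}" by blast
    have "a \<in> sets \<mu>" unfolding \<mu> using Basic by (rule sigma_sets.Basic)
    moreover have "depends_on_window (nat \<bar>i\<bar>) (\<lambda>x. x \<in> a)"
      by (auto simp: a depends_on_window_def)
    ultimately show ?case unfolding window_approx_set_def by (metis Diff_cancel Un_absorb measure_empty)
  next
    case Empty
    have "depends_on_window 0 (\<lambda>x. x \<in> ({} :: (int \<Rightarrow> 'a) set))" by (simp add: depends_on_window_def)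
    then show ?case
      unfolding window_approx_set_def by (metis Diff_cancel Un_absorb measure_empty sets.empty_sets)
  next
    case (Compl a)
    have sp: "space \<mu> = UNIV" using sets_eq_imp_space_eq[OF sets] by simp
    show ?case
      unfolding window_approx_set_def
    proof (intro allI impI)
      fix \<epsilon> :: real assume "\<epsilon> > 0"
      then obtain m C where C: "C \<in> sets \<mu>" "depends_on_window m (\<lambda>x. x \<in> C)"
          "measure \<mu> ((a - C) \<union> (C - a)) < \<epsilon>"
        using Compl.IH by (auto simp: window_approx_set_def)
      have "UNIV - C \<in> sets \<mu>" using C(1) sp sets.compl_sets by metis
      moreover have "depends_on_window m (\<lambda>x. x \<in> UNIV - C)" using C(2) by (auto simp: depends_on_window_def)
      moreover have "(UNIV - a - (UNIV - C)) \<union> (UNIV - C - (UNIV - a)) = (a - C) \<union> (C - a)" by auto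
      ultimately show "\<exists>m C. C \<in> sets \<mu> \<and> depends_on_window m (\<lambda>x. x \<in> C) \<and>
          measure \<mu> ((UNIV - a - C) \<union> (C - (UNIV - a))) < \<epsilon>"
        using C(3) by metis
    qed
  next
    case (Union a)
    then show ?case using \<mu> by (intro window_approx_set_UN prob) auto
  qed
qed

text \<open>Membership in the L^2 closure of the bounded finite-window functions. Boundedness is
  required because the sup norm enters the boundary errors of twisted sums.\<close>

definition window_approx :: "(int \<Rightarrow> 'a) measure \<Rightarrow> ((int \<Rightarrow> 'a) \<Rightarrow> complex) \<Rightarrow> bool" where
  "window_approx \<mu> f \<longleftrightarrow> (\<forall>\<epsilon>>0. \<exists>m g B. g \<in> borel_measurable \<mu> \<and> depends_on_window m g \<and> (\<forall>x. cmod (g x) \<le> B) \<and>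
    integrable \<mu> (\<lambda>x. (cmod (f x - g x))\<^sup>2) \<and> (\<integral>x. (cmod (f x - g x))\<^sup>2 \<partial>\<mu>) < \<epsilon>)"

lemma square_integrable_add:
  fixes f g :: "'x \<Rightarrow> complex"
  assumes [measurable]: "f \<in> borel_measurable M" "g \<in> borel_measurable M"
    and int: "integrable M (\<lambda>x. (cmod (f x))\<^sup>2)" "integrable M (\<lambda>x. (cmod (g x))\<^sup>2)"
  shows "integrable M (\<lambda>x. (cmod (f x + g x))\<^sup>2)"
    and "(\<integral>x. (cmod (f x + g x))\<^sup>2 \<partial>M) \<le> 2 * (\<integral>x. (cmod (f x))\<^sup>2 \<partial>M) + 2 * (\<integral>x. (cmod (g x))\<^sup>2 \<partial>M)"
proof -
  have bd: "integrable M (\<lambda>x. 2 * (cmod (f x))\<^sup>2 + 2 * (cmod (g x))\<^sup>2)" using int by simp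
  show *: "integrable M (\<lambda>x. (cmod (f x + g x))\<^sup>2)"
    by (rule Bochner_Integration.integrable_bound[OF bd]) (auto simp: cmod_add_sq_le)
  have "(\<integral>x. (cmod (f x + g x))\<^sup>2 \<partial>M) \<le> (\<integral>x. 2 * (cmod (f x))\<^sup>2 + 2 * (cmod (g x))\<^sup>2 \<partial>M)"
    by (rule integral_mono[OF * bd]) (rule cmod_add_sq_le)
  then show "(\<integral>x. (cmod (f x + g x))\<^sup>2 \<partial>M) \<le> 2 * (\<integral>x. (cmod (f x))\<^sup>2 \<partial>M) + 2 * (\<integral>x. (cmod (g x))\<^sup>2 \<partial>M)"
    using int by simp
qed

lemma window_approx_indicator:
  assumes prob: "prob_space \<mu>" and A: "A \<in> sets \<mu>" "window_approx_set \<mu> A"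
  shows "window_approx \<mu> (\<lambda>x. c * indicator A x)"
  unfolding window_approx_def
proof (intro allI impI)
  fix \<epsilon> :: real assume "\<epsilon> > 0"
  interpret prob_space \<mu> by fact
  \<comment> \<open>The summand 1 covers \<open>c = 0\<close>.\<close>
  let ?\<eta> = "\<epsilon> / ((cmod c)\<^sup>2 + 1)"
  have pos: "(cmod c)\<^sup>2 + 1 > 0" by (simp add: add_nonneg_pos)
  then have "?\<eta> > 0" using \<open>\<epsilon> > 0\<close> by simp
  then obtain m C where C: "C \<in> sets \<mu>" "depends_on_window m (\<lambda>x. x \<in> C)"
      "measure \<mu> ((A - C) \<union> (C - A)) < ?\<eta>"
    using A(2) unfolding window_approx_set_def by blast
  let ?D = "(A - C) \<union> (C - A)"
  have eq: "(cmod (c * indicator A x - c * indicator C x))\<^sup>2 = (cmod c)\<^sup>2 * indicator ?D x" for x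
    by (auto simp: indicator_def norm_mult)
  have "(cmod c)\<^sup>2 * measure \<mu> ?D < \<epsilon>"
  proof -
    have "(cmod c)\<^sup>2 * measure \<mu> ?D \<le> ((cmod c)\<^sup>2 + 1) * measure \<mu> ?D"
      by (intro mult_right_mono) auto
    also have "\<dots> < \<epsilon>" using C(3) pos by (simp add: field_simps)
    finally show ?thesis .
  qed
  moreover have D: "?D \<in> sets \<mu>" using A C by auto
  moreover have "integrable \<mu> (indicat_real ?D)"
    by (rule integrable_const_bound[where B = 1]) (use D in \<open>auto simp: indicator_def\<close>)
  moreover have "(\<lambda>x. c * indicator C x) \<in> borel_measurable \<mu>" using C(1) by simp
  moreover have "depends_on_window m (\<lambda>x. c * indicator C x)"
    using C(2) by (auto simp: depends_on_window_def indicator_def)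
  moreover have "cmod (c * indicator C x) \<le> cmod c" for x by (simp add: indicator_def)
  ultimately show "\<exists>m g B. g \<in> borel_measurable \<mu> \<and> depends_on_window m g \<and> (\<forall>x. cmod (g x) \<le> B) \<and>
      integrable \<mu> (\<lambda>x. (cmod (c * indicator A x - g x))\<^sup>2) \<and>
      (\<integral>x. (cmod (c * indicator A x - g x))\<^sup>2 \<partial>\<mu>) < \<epsilon>"
    by (intro exI[of _ m] exI[of _ "\<lambda>x. c * indicator C x"] exI[of _ "cmod c"]) (auto simp: eq)
qed

lemma window_approx_limit:
  assumes f: "f \<in> borel_measurable \<mu>"
    and approx: "\<And>\<epsilon>. \<epsilon> > 0 \<Longrightarrow> \<exists>s. s \<in> borel_measurable \<mu> \<and> window_approx \<mu> s \<and>
      integrable \<mu> (\<lambda>x. (cmod (f x - s x))\<^sup>2) \<and> (\<integral>x. (cmod (f x - s x))\<^sup>2 \<partial>\<mu>) < \<epsilon>"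
  shows "window_approx \<mu> f"
  unfolding window_approx_def
proof (intro allI impI)
  fix \<epsilon> :: real assume "\<epsilon> > 0"
  \<comment> \<open>Quarters, because \<open>square_integrable_add\<close> doubles both squared
    distances.\<close>
  then have "\<epsilon> / 4 > 0" by simp
  then obtain s where s: "s \<in> borel_measurable \<mu>" "window_approx \<mu> s"
      "integrable \<mu> (\<lambda>x. (cmod (f x - s x))\<^sup>2)" "(\<integral>x. (cmod (f x - s x))\<^sup>2 \<partial>\<mu>) < \<epsilon> / 4"
    using approx by blast
  obtain m g B where g: "g \<in> borel_measurable \<mu>" "depends_on_window m g" "\<forall>x. cmod (g x) \<le> B"
      "integrable \<mu> (\<lambda>x. (cmod (s x - g x))\<^sup>2)" "(\<integral>x. (cmod (s x - g x))\<^sup>2 \<partial>\<mu>) < \<epsilon> / 4"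
    using s(2) \<open>\<epsilon> / 4 > 0\<close> unfolding window_approx_def by blast
  have "integrable \<mu> (\<lambda>x. (cmod (f x - g x))\<^sup>2)" "(\<integral>x. (cmod (f x - g x))\<^sup>2 \<partial>\<mu>) < \<epsilon>"
    using square_integrable_add[of "\<lambda>x. f x - s x" \<mu> "\<lambda>x. s x - g x"] f s g by auto
  with g show "\<exists>m g B. g \<in> borel_measurable \<mu> \<and> depends_on_window m g \<and> (\<forall>x. cmod (g x) \<le> B) \<and>
      integrable \<mu> (\<lambda>x. (cmod (f x - g x))\<^sup>2) \<and> (\<integral>x. (cmod (f x - g x))\<^sup>2 \<partial>\<mu>) < \<epsilon>" by blast
qed

lemma window_approx_add:
  assumes f: "f1 \<in> borel_measurable \<mu>" "f2 \<in> borel_measurable \<mu>"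
    and "window_approx \<mu> f1" "window_approx \<mu> f2"
  shows "window_approx \<mu> (\<lambda>x. f1 x + f2 x)"
  unfolding window_approx_def
proof (intro allI impI)
  fix \<epsilon> :: real assume "\<epsilon> > 0"
  then have \<epsilon>: "\<epsilon> / 4 > 0" by simp
  obtain m1 g1 B1 where g1: "g1 \<in> borel_measurable \<mu>" "depends_on_window m1 g1" "\<forall>x. cmod (g1 x) \<le> B1"
      "integrable \<mu> (\<lambda>x. (cmod (f1 x - g1 x))\<^sup>2)" "(\<integral>x. (cmod (f1 x - g1 x))\<^sup>2 \<partial>\<mu>) < \<epsilon> / 4"
    using assms(3) \<epsilon> unfolding window_approx_def by blast
  obtain m2 g2 B2 where g2: "g2 \<in> borel_measurable \<mu>" "depends_on_window m2 g2" "\<forall>x. cmod (g2 x) \<le> B2"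
      "integrable \<mu> (\<lambda>x. (cmod (f2 x - g2 x))\<^sup>2)" "(\<integral>x. (cmod (f2 x - g2 x))\<^sup>2 \<partial>\<mu>) < \<epsilon> / 4"
    using assms(4) \<epsilon> unfolding window_approx_def by blast
  have eq: "f1 x - g1 x + (f2 x - g2 x) = f1 x + f2 x - (g1 x + g2 x)" for x by simp
  have "integrable \<mu> (\<lambda>x. (cmod (f1 x + f2 x - (g1 x + g2 x)))\<^sup>2)"
    "(\<integral>x. (cmod (f1 x + f2 x - (g1 x + g2 x)))\<^sup>2 \<partial>\<mu>) < \<epsilon>"
    using square_integrable_add[of "\<lambda>x. f1 x - g1 x" \<mu> "\<lambda>x. f2 x - g2 x"] f g1 g2
    unfolding eq by auto
  moreover have "(\<lambda>x. g1 x + g2 x) \<in> borel_measurable \<mu>" using g1 g2 by simp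
  moreover have "depends_on_window (max m1 m2) (\<lambda>x. g1 x + g2 x)"
    using depends_on_window_mono[OF g1(2), of "max m1 m2"] depends_on_window_mono[OF g2(2), of "max m1 m2"]
    unfolding depends_on_window_def by (metis max.cobounded1 max.cobounded2)
  moreover have "\<forall>x. cmod (g1 x + g2 x) \<le> B1 + B2" using g1(3) g2(3) by (auto intro: norm_triangle_mono)
  ultimately show "\<exists>m g B. g \<in> borel_measurable \<mu> \<and> depends_on_window m g \<and> (\<forall>x. cmod (g x) \<le> B) \<and>
      integrable \<mu> (\<lambda>x. (cmod (f1 x + f2 x - g x))\<^sup>2) \<and> (\<integral>x. (cmod (f1 x + f2 x - g x))\<^sup>2 \<partial>\<mu>) < \<epsilon>"
    by blast
qed

lemma window_approx_square_integrable:
  fixes f :: "(int \<Rightarrow> 'a) \<Rightarrow> complex"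
  assumes sets: "sets \<mu> = sets full_shift_space" and prob: "prob_space \<mu>"
    and f: "f \<in> borel_measurable \<mu>" "integrable \<mu> (\<lambda>x. (cmod (f x))\<^sup>2)"
  shows "window_approx \<mu> f"
proof -
  interpret prob_space \<mu> by fact
  have ind: "window_approx \<mu> (\<lambda>x. c * indicator A x)" if "A \<in> sets \<mu>" for c A
    by (rule window_approx_indicator[OF prob that window_approx_setI[OF sets prob that]])
  have fin: "window_approx \<mu> (\<lambda>x. \<Sum>y\<in>Y. y * indicator (A y) x)"
    if "finite Y" "\<And>y. A y \<in> sets \<mu>" for Y :: "complex set" and A
    using that(1)
  proof (induction Y)
    case empty
    then show ?case using ind[of "{}" 0] by simp
  next
    case (insert y Y)
    have [measurable]: "A y \<in> sets \<mu>" for y by (rule that)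
    show ?case
      unfolding sum.insert[OF insert.hyps(1,2)]
      by (rule window_approx_add[OF _ _ ind[OF that(2)] insert.IH]) measurable
  qed
  have simple: "window_approx \<mu> s" if s: "simple_function \<mu> s" for s :: "(int \<Rightarrow> 'a) \<Rightarrow> complex"
  proof -
    have sp: "space \<mu> = UNIV" using sets_eq_imp_space_eq[OF sets] by simp
    have "finite (range s)" using s sp by (simp add: simple_function_def)
    moreover have "s -` {y} \<in> sets \<mu>" for y
      using simple_functionD(2)[OF s, of "{y}"] sp by simp
    ultimately have "window_approx \<mu> (\<lambda>x. \<Sum>y\<in>range s. y * indicator (s -` {y}) x)" by (rule fin)
    moreover have "(\<Sum>y\<in>range s. y * indicator (s -` {y}) x) = s x" for x
    proof -
      have "(\<Sum>y\<in>range s. y * indicator (s -` {y}) x) = (\<Sum>y\<in>range s. if y = s x then y else 0)"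
        by (rule sum.cong) (auto simp: indicator_def)
      then show ?thesis using \<open>finite (range s)\<close> by simp
    qed
    ultimately show ?thesis by simp
  qed
  obtain F where F: "\<And>i. simple_function \<mu> (F i)" "\<And>x. x \<in> space \<mu> \<Longrightarrow> (\<lambda>i. F i x) \<longlonglongrightarrow> f x"
      "\<And>i x. x \<in> space \<mu> \<Longrightarrow> dist (F i x) 0 \<le> 2 * dist (f x) 0"
    using borel_measurable_implies_sequence_metric[OF f(1), of 0] by blast
  have F_meas [measurable]: "F i \<in> borel_measurable \<mu>" for i by (rule borel_measurable_simple_function[OF F(1)])
  note f(1)[measurable]
  \<comment> \<open>\<open>|F i x| \<le> 2 |f x|\<close> gives the factor
    \<open>(1 + 2)^2 = 9\<close>, hence an integrable majorant uniform in \<open>i\<close>.\<close>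
  have bound: "(cmod (f x - F i x))\<^sup>2 \<le> 9 * (cmod (f x))\<^sup>2" if "x \<in> space \<mu>" for i x
  proof -
    have "cmod (f x - F i x) \<le> 3 * cmod (f x)"
      using F(3)[OF that, of i] norm_triangle_ineq4[of "f x" "F i x"] by simp
    then have "(cmod (f x - F i x))\<^sup>2 \<le> (3 * cmod (f x))\<^sup>2" by (intro power_mono) auto
    then show ?thesis by (simp add: power_mult_distrib)
  qed
  have int9: "integrable \<mu> (\<lambda>x. 9 * (cmod (f x))\<^sup>2)" using f(2) by simp
  have int: "integrable \<mu> (\<lambda>x. (cmod (f x - F i x))\<^sup>2)" for i
    by (rule Bochner_Integration.integrable_bound[OF int9]) (auto simp: bound)
  have "(\<lambda>i. \<integral>x. (cmod (f x - F i x))\<^sup>2 \<partial>\<mu>) \<longlonglongrightarrow> (\<integral>x. 0 \<partial>\<mu>)"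
  proof (rule integral_dominated_convergence[OF _ _ int9])
    show "AE x in \<mu>. (\<lambda>i. (cmod (f x - F i x))\<^sup>2) \<longlonglongrightarrow> 0"
    proof (rule AE_I2)
      fix x assume "x \<in> space \<mu>"
      then have "(\<lambda>i. (cmod (f x - F i x))\<^sup>2) \<longlonglongrightarrow> (cmod (f x - f x))\<^sup>2"
        by (intro tendsto_intros F(2))
      then show "(\<lambda>i. (cmod (f x - F i x))\<^sup>2) \<longlonglongrightarrow> 0" by simp
    qed
  qed (auto simp: bound)
  then have lim: "(\<lambda>i. \<integral>x. (cmod (f x - F i x))\<^sup>2 \<partial>\<mu>) \<longlonglongrightarrow> 0" by simp
  show ?thesis
  proof (rule window_approx_limit[OF f(1)])
    fix \<epsilon> :: real assume "\<epsilon> > 0"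
    then have "\<forall>\<^sub>F i in sequentially. (\<integral>x. (cmod (f x - F i x))\<^sup>2 \<partial>\<mu>) < \<epsilon>"
      using lim by (rule order_tendstoD(2)[rotated])
    then obtain i where "(\<integral>x. (cmod (f x - F i x))\<^sup>2 \<partial>\<mu>) < \<epsilon>" by (auto simp: eventually_sequentially)
    then show "\<exists>s. s \<in> borel_measurable \<mu> \<and> window_approx \<mu> s \<and>
      integrable \<mu> (\<lambda>x. (cmod (f x - s x))\<^sup>2) \<and> (\<integral>x. (cmod (f x - s x))\<^sup>2 \<partial>\<mu>) < \<epsilon>"
      using F_meas simple[OF F(1)] int by blast
  qed
qed

text \<open>Turns a finite-window function into a function of blocks of length
  \<open>2 * m + 1\<close>, as needed for \<open>twisted_sum\<close>. Coordinates outside the window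
  are read from irrelevant list positions, which \<open>g\<close> ignores.\<close>

lemma depends_on_window_block:
  assumes "depends_on_window m g"
  shows "g x = g (\<lambda>i. block x (- int m) (2 * m + 1) ! nat (i + int m))"
proof -
  have *: "x i = block x (- int m) (2 * m + 1) ! nat (i + int m)" if "\<bar>i\<bar> \<le> int m" for i
  proof -
    have "nat (i + int m) < 2 * m + 1" "0 \<le> i + int m" using that by linarith+
    then show ?thesis by (simp add: block_def del: upt_Suc)
  qed
  show ?thesis by (rule assms[unfolded depends_on_window_def, rule_format]) (rule *)
qed

section \<open>Spectral measures and twisted Birkhoff sums\<close>

lemma measurable_shift_pow:
  assumes "sets \<mu> = sets full_shift_space"
  shows "shift_pow n \<in> \<mu> \<rightarrow>\<^sub>M \<mu>"
proof -
  have "shift_pow n \<in> full_shift_space \<rightarrow>\<^sub>M full_shift_space"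
    unfolding shift_pow_def full_shift_space_def
    by (intro measurable_abs_UNIV measurable_component_singleton) auto
  then show ?thesis using measurable_cong_sets[OF assms assms] by blast
qed

lemma distr_shift_pow:
  assumes sets: "sets \<mu> = sets full_shift_space" and inv: "distr \<mu> \<mu> shift = \<mu>"
  shows "distr \<mu> \<mu> (shift_pow (int n)) = \<mu>"
proof (induction n)
  case 0
  have "shift_pow (int 0) = (\<lambda>x. x :: int \<Rightarrow> 'a)" by (simp add: shift_pow_def fun_eq_iff)
  then show ?case by (simp add: distr_id2)
next
  case (Suc n)
  have sh: "shift = (shift_pow 1 :: (int \<Rightarrow> 'a) \<Rightarrow> _)" by (simp add: shift_def shift_pow_def fun_eq_iff)
  have "shift_pow (int (Suc n)) = shift_pow (int n) \<circ> (shift :: (int \<Rightarrow> 'a) \<Rightarrow> _)"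
    by (simp add: shift_def shift_pow_def fun_eq_iff algebra_simps)
  then have "distr \<mu> \<mu> (shift_pow (int (Suc n))) = distr (distr \<mu> \<mu> shift) \<mu> (shift_pow (int n))"
    using measurable_shift_pow[OF sets] by (subst distr_distr) (simp_all add: sh)
  then show ?case by (simp add: inv Suc)
qed

lemma shift_invariant_integral:
  fixes \<Phi> :: "(int \<Rightarrow> 'a) \<Rightarrow> 'b::{banach, second_countable_topology}"
  assumes sets: "sets \<mu> = sets full_shift_space" and inv: "distr \<mu> \<mu> shift = \<mu>"
    and \<Phi>: "\<Phi> \<in> borel_measurable \<mu>"
  shows "(\<integral>x. \<Phi> (shift_pow (int n) x) \<partial>\<mu>) = (\<integral>x. \<Phi> x \<partial>\<mu>)"
    and "integrable \<mu> \<Phi> \<Longrightarrow> integrable \<mu> (\<lambda>x. \<Phi> (shift_pow (int n) x))"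
  using integral_distr[OF measurable_shift_pow[OF sets] \<Phi>, of "int n"]
    integrable_distr_eq[OF measurable_shift_pow[OF sets] \<Phi>, of "int n"]
  by (simp_all add: distr_shift_pow[OF sets inv])

text \<open>The negative sign of the frequency centres the Dirichlet kernel of
  \<open>birkhoff_energy_spectral\<close> at \<open>\<omega>\<close> itself.\<close>

definition birkhoff_energy :: "(int \<Rightarrow> 'a) measure \<Rightarrow> ((int \<Rightarrow> 'a) \<Rightarrow> complex) \<Rightarrow> nat \<Rightarrow> real \<Rightarrow> real" where
  "birkhoff_energy \<mu> f N \<omega> =
    (\<integral>x. (cmod (\<Sum>k<N. f (shift_pow (int k) x) * twist (- real k * \<omega>)))\<^sup>2 \<partial>\<mu>)"

lemma measurable_cnj [measurable]: "cnj \<in> borel_measurable borel"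
  by (intro borel_measurable_continuous_onI continuous_intros)

locale square_integrable_on_shift =
  fixes \<mu> :: "(int \<Rightarrow> 'a) measure" and f :: "(int \<Rightarrow> 'a) \<Rightarrow> complex"
  assumes sets_\<mu>: "sets \<mu> = sets full_shift_space"
    and invariant: "distr \<mu> \<mu> shift = \<mu>"
    and measurable_f: "f \<in> borel_measurable \<mu>"
    and square_integrable: "integrable \<mu> (\<lambda>x. (cmod (f x))\<^sup>2)"
begin

lemma measurable_f_shift: "(\<lambda>x. f (shift_pow n x)) \<in> borel_measurable \<mu>"
  using measurable_compose[OF measurable_shift_pow[OF sets_\<mu>] measurable_f] .

lemma integrable_f_shift: "integrable \<mu> (\<lambda>x. (cmod (f (shift_pow (int k) x)))\<^sup>2)"
  by (rule shift_invariant_integral(2)[OF sets_\<mu> invariant _ square_integrable])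
    (use measurable_f in measurable)

definition correlation :: "nat \<Rightarrow> nat \<Rightarrow> complex" where
  "correlation k l = (\<integral>x. f (shift_pow (int k) x) * cnj (f (shift_pow (int l) x)) \<partial>\<mu>)"

lemma integrable_correlation:
  "integrable \<mu> (\<lambda>x. f (shift_pow (int k) x) * cnj (f (shift_pow (int l) x)))"
proof (rule Bochner_Integration.integrable_bound)
  show "integrable \<mu> (\<lambda>x. (cmod (f (shift_pow (int k) x)))\<^sup>2 + (cmod (f (shift_pow (int l) x)))\<^sup>2)"
    by (intro Bochner_Integration.integrable_add integrable_f_shift)
  show "(\<lambda>x. f (shift_pow (int k) x) * cnj (f (shift_pow (int l) x))) \<in> borel_measurable \<mu>"
    using measurable_f_shift[of "int k"] measurable_f_shift[of "int l"] by measurable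
  have "norm (a * cnj b) \<le> norm ((cmod a)\<^sup>2 + (cmod b)\<^sup>2)" for a b
  proof -
    have "0 \<le> cmod a * cmod b" by simp
    then have "cmod a * cmod b \<le> (cmod a)\<^sup>2 + (cmod b)\<^sup>2"
      using sum_squares_bound[of "cmod a" "cmod b"] by linarith
    then show ?thesis by (simp add: norm_mult)
  qed
  then show "AE x in \<mu>. norm (f (shift_pow (int k) x) * cnj (f (shift_pow (int l) x)))
      \<le> norm ((cmod (f (shift_pow (int k) x)))\<^sup>2 + (cmod (f (shift_pow (int l) x)))\<^sup>2)" by simp
qed

lemma correlation_self: "correlation k k = of_real (\<integral>x. (cmod (f x))\<^sup>2 \<partial>\<mu>)"
proof -
  have "correlation k k = (\<integral>x. of_real ((cmod (f (shift_pow (int k) x)))\<^sup>2) \<partial>\<mu>)"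
    unfolding correlation_def complex_norm_square ..
  also have "\<dots> = of_real (\<integral>x. (cmod (f (shift_pow (int k) x)))\<^sup>2 \<partial>\<mu>)"
    by (rule integral_complex_of_real)
  also have "(\<integral>x. (cmod (f (shift_pow (int k) x)))\<^sup>2 \<partial>\<mu>) = (\<integral>x. (cmod (f x))\<^sup>2 \<partial>\<mu>)"
    by (rule shift_invariant_integral(1)[OF sets_\<mu> invariant]) (use measurable_f in measurable)
  finally show ?thesis .
qed

lemma birkhoff_energy_eq_sum:
  "of_real (birkhoff_energy \<mu> f N \<omega>) =
    (\<Sum>k<N. \<Sum>l<N. correlation k l * twist ((- real k - - real l) * \<omega>))"
proof -
  have "of_real (birkhoff_energy \<mu> f N \<omega>) =
      (\<integral>x. complex_of_real ((cmod (\<Sum>k<N. f (shift_pow (int k) x) * twist (- real k * \<omega>)))\<^sup>2) \<partial>\<mu>)"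
    unfolding birkhoff_energy_def by (rule integral_complex_of_real[symmetric])
  also have "\<dots> = (\<integral>x. (\<Sum>k<N. \<Sum>l<N. f (shift_pow (int k) x) * cnj (f (shift_pow (int l) x)) *
      twist ((- real k - - real l) * \<omega>)) \<partial>\<mu>)"
    by (simp only: cmod_sum_mult_twist_sq)
  also have "\<dots> = (\<Sum>k<N. \<integral>x. (\<Sum>l<N. f (shift_pow (int k) x) * cnj (f (shift_pow (int l) x)) *
      twist ((- real k - - real l) * \<omega>)) \<partial>\<mu>)"
    by (intro Bochner_Integration.integral_sum Bochner_Integration.integrable_sum
        integrable_mult_left integrable_correlation)
  also have "\<dots> = (\<Sum>k<N. \<Sum>l<N. \<integral>x. f (shift_pow (int k) x) * cnj (f (shift_pow (int l) x)) *
      twist ((- real k - - real l) * \<omega>) \<partial>\<mu>)"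
    by (intro sum.cong refl Bochner_Integration.integral_sum integrable_mult_left integrable_correlation)
  also have "\<dots> = (\<Sum>k<N. \<Sum>l<N. correlation k l * twist ((- real k - - real l) * \<omega>))"
    by (intro sum.cong refl) (simp add: correlation_def)
  finally show ?thesis .
qed

lemma integrable_birkhoff_energy: "integrable unit_measure (birkhoff_energy \<mu> f N)"
proof (rule continuous_imp_integrable_unit)
  have eq: "birkhoff_energy \<mu> f N \<omega> = Re (\<Sum>k<N. \<Sum>l<N. correlation k l * twist ((- real k - - real l) * \<omega>))" for \<omega>
    using arg_cong[OF birkhoff_energy_eq_sum[of N \<omega>], of Re] by simp
  show "continuous_on UNIV (birkhoff_energy \<mu> f N)"
    unfolding eq[abs_def] by (intro continuous_intros)
  fix \<omega>
  have "norm (birkhoff_energy \<mu> f N \<omega>) \<le> cmod (\<Sum>k<N. \<Sum>l<N. correlation k l * twist ((- real k - - real l) * \<omega>))"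
    unfolding eq real_norm_def by (rule abs_Re_le_cmod)
  also have "\<dots> \<le> (\<Sum>k<N. \<Sum>l<N. cmod (correlation k l))"
    by (intro sum_norm_le) (simp add: norm_mult)
  finally show "norm (birkhoff_energy \<mu> f N \<omega>) \<le> (\<Sum>k<N. \<Sum>l<N. cmod (correlation k l))" .
qed

text \<open>Integration over \<open>\<omega>\<close> removes all correlations with different
  indices, and by invariance the remaining ones equal the squared norm. No regularity of
  \<open>f\<close> enters, so the identity can be applied to the error of an L^2
  approximation.\<close>

lemma integral_birkhoff_energy:
  "(\<integral>\<omega>. birkhoff_energy \<mu> f N \<omega> \<partial>unit_measure) = real N * (\<integral>x. (cmod (f x))\<^sup>2 \<partial>\<mu>)"
proof -
  have "complex_of_real (\<integral>\<omega>. birkhoff_energy \<mu> f N \<omega> \<partial>unit_measure) =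
      (\<integral>\<omega>. of_real (birkhoff_energy \<mu> f N \<omega>) \<partial>unit_measure)"
    by (rule integral_complex_of_real[symmetric])
  also have "\<dots> = (\<Sum>k<N. \<Sum>l<N. if - real k = - real l then correlation k l else 0)"
    unfolding birkhoff_energy_eq_sum by (rule integral_double_twist) simp
  also have "\<dots> = (\<Sum>k<N. correlation k k)"
    by (intro sum.cong refl) simp
  also have "\<dots> = of_real (real N * (\<integral>x. (cmod (f x))\<^sup>2 \<partial>\<mu>))"
    by (simp add: correlation_self)
  finally show ?thesis using of_real_eq_iff by blast
qed

text \<open>By invariance a correlation depends only on the difference of its indices and is a
  Fourier coefficient of \<open>\<sigma>\<close>; both sides are then the same double sum.\<close>

lemma birkhoff_energy_spectral:
  assumes "spectral_measure_of \<mu> f \<sigma>"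
  shows "birkhoff_energy \<mu> f N \<omega> = (\<integral>t. (cmod (\<Sum>k<N. twist (real k * (t - \<omega>))))\<^sup>2 \<partial>\<sigma>)"
proof -
  have \<sigma>: "sets \<sigma> = sets borel" "finite_measure \<sigma>"
    and spec: "(\<integral>t. twist (of_int n * t) \<partial>\<sigma>) = (\<integral>x. f (shift_pow n x) * cnj (f x) \<partial>\<mu>)" for n :: int
    using assms by (auto simp: spectral_measure_of_def twist_def mult.assoc)
  interpret finite_measure \<sigma> by fact
  have int: "integrable \<sigma> (\<lambda>t. c * twist (a * t))" for a c
  proof -
    have "(\<lambda>t. c * twist (a * t)) \<in> borel_measurable borel"
      by (intro borel_measurable_continuous_onI continuous_intros)
    then have "(\<lambda>t. c * twist (a * t)) \<in> borel_measurable \<sigma>"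
      using measurable_cong_sets[OF \<sigma>(1) refl] by blast
    then show ?thesis by (intro integrable_const_bound[where B = "cmod c"]) (auto simp: norm_mult)
  qed
  have corr: "correlation k l = (\<integral>t. twist ((real k - real l) * t) \<partial>\<sigma>)" for k l
  proof -
    have meas: "(\<lambda>x. f (shift_pow (int k - int l) x) * cnj (f x)) \<in> borel_measurable \<mu>"
      using measurable_f_shift[of "int k - int l"] measurable_f by measurable
    have "(\<integral>t. twist ((real k - real l) * t) \<partial>\<sigma>) = (\<integral>x. f (shift_pow (int k - int l) x) * cnj (f x) \<partial>\<mu>)"
      using spec[of "int k - int l"] by simp
    also have "\<dots> = (\<integral>x. f (shift_pow (int k - int l) (shift_pow (int l) x)) * cnj (f (shift_pow (int l) x)) \<partial>\<mu>)"
      by (rule shift_invariant_integral(1)[OF sets_\<mu> invariant meas, symmetric])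
    also have "\<dots> = correlation k l"
      by (simp add: correlation_def shift_pow_def algebra_simps)
    finally show ?thesis ..
  qed
  have "of_real (birkhoff_energy \<mu> f N \<omega>) =
      (\<Sum>k<N. \<Sum>l<N. \<integral>t. twist ((- real k - - real l) * \<omega>) * twist ((real k - real l) * t) \<partial>\<sigma>)"
    unfolding birkhoff_energy_eq_sum corr by (simp add: mult.commute)
  also have "\<dots> = (\<Sum>k<N. \<integral>t. (\<Sum>l<N. twist ((- real k - - real l) * \<omega>) * twist ((real k - real l) * t)) \<partial>\<sigma>)"
    by (intro sum.cong refl Bochner_Integration.integral_sum[symmetric] int)
  also have "\<dots> = (\<integral>t. (\<Sum>k<N. \<Sum>l<N. twist ((- real k - - real l) * \<omega>) * twist ((real k - real l) * t)) \<partial>\<sigma>)"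
    by (intro Bochner_Integration.integral_sum[symmetric] Bochner_Integration.integrable_sum int)
  also have "\<dots> = (\<integral>t. complex_of_real ((cmod (\<Sum>k<N. twist (real k * (t - \<omega>))))\<^sup>2) \<partial>\<sigma>)"
  proof (rule Bochner_Integration.integral_cong[OF refl])
    fix t
    have eq: "twist ((- real k - - real l) * \<omega>) * twist ((real k - real l) * t)
        = 1 * cnj 1 * twist ((real k - real l) * (t - \<omega>))" for k l
      by (simp add: algebra_simps flip: twist_add)
    show "(\<Sum>k<N. \<Sum>l<N. twist ((- real k - - real l) * \<omega>) * twist ((real k - real l) * t)) =
        complex_of_real ((cmod (\<Sum>k<N. twist (real k * (t - \<omega>))))\<^sup>2)"
      unfolding eq cmod_sum_mult_twist_sq[of "\<lambda>_. 1", symmetric] by simp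
  qed
  also have "\<dots> = of_real (\<integral>t. (cmod (\<Sum>k<N. twist (real k * (t - \<omega>))))\<^sup>2 \<partial>\<sigma>)"
    by (rule integral_complex_of_real)
  finally show ?thesis using of_real_eq_iff by blast
qed

end

lemma birkhoff_energy_add_le:
  assumes f: "square_integrable_on_shift \<mu> f" and g: "square_integrable_on_shift \<mu> g"
  shows "birkhoff_energy \<mu> (\<lambda>x. f x + g x) N \<omega> \<le> 2 * birkhoff_energy \<mu> f N \<omega> + 2 * birkhoff_energy \<mu> g N \<omega>"
proof -
  let ?S = "\<lambda>f x. \<Sum>k<N. f (shift_pow (int k) x) * twist (- real k * \<omega>)"
  have int: "?S h \<in> borel_measurable \<mu>" "integrable \<mu> (\<lambda>x. (cmod (?S h x))\<^sup>2)"
    if h: "square_integrable_on_shift \<mu> h" for h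
  proof -
    interpret square_integrable_on_shift \<mu> h by fact
    show "?S h \<in> borel_measurable \<mu>"
      by (intro borel_measurable_sum borel_measurable_times measurable_f_shift borel_measurable_const)
    have "integrable \<mu> (\<lambda>x. Re (complex_of_real ((cmod (?S h x))\<^sup>2)))"
      unfolding cmod_sum_mult_twist_sq
      by (intro integrable_Re Bochner_Integration.integrable_sum integrable_mult_left integrable_correlation)
    then show "integrable \<mu> (\<lambda>x. (cmod (?S h x))\<^sup>2)" by simp
  qed
  have "?S (\<lambda>x. f x + g x) x = ?S f x + ?S g x" for x
    by (simp add: distrib_right sum.distrib)
  then show ?thesis
    unfolding birkhoff_energy_def
    using square_integrable_add(2)[OF int(1)[OF f] int(1)[OF g] int(2)[OF f] int(2)[OF g]] by simp
qed

text \<open>The angles \<open>2 * pi * k * u\<close> stay within \<open>pi / 3\<close> of 0, so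
  every term has real part at least \<open>1 / 2\<close>; this is where the 6 comes from.\<close>

lemma norm_dirichlet_sum_ge:
  assumes "N > 0" "\<bar>u\<bar> \<le> 1 / (6 * real N)"
  shows "real N / 2 \<le> cmod (\<Sum>k<N. twist (real k * u))"
proof -
  have "1 / 2 \<le> Re (twist (real k * u))" if "k < N" for k
  proof -
    have "real k * \<bar>u\<bar> \<le> real N * (1 / (6 * real N))"
      using assms that by (intro mult_mono) auto
    then have "\<bar>real k * u\<bar> \<le> 1 / 6" using assms(1) by (simp add: abs_mult)
    then have "2 * pi * \<bar>real k * u\<bar> \<le> 2 * pi * (1 / 6)" by (intro mult_left_mono) auto
    then have "cos (pi / 3) \<le> cos \<bar>2 * pi * (real k * u)\<bar>"
      by (intro cos_monotone_0_pi_le) (auto simp: abs_mult)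
    then have "1 / 2 \<le> cos (2 * pi * (real k * u))" by (simp add: cos_60)
    moreover have "Re (twist (real k * u)) = cos (2 * pi * (real k * u))"
    proof -
      have "twist (real k * u) = cis (- (2 * pi * (real k * u)))"
        by (simp add: twist_def cis_conv_exp mult_ac)
      then show ?thesis by simp
    qed
    ultimately show ?thesis by simp
  qed
  then have "(\<Sum>k<N. 1 / 2) \<le> (\<Sum>k<N. Re (twist (real k * u)))" by (intro sum_mono) auto
  also have "\<dots> = Re (\<Sum>k<N. twist (real k * u))" by simp
  also have "\<dots> \<le> cmod (\<Sum>k<N. twist (real k * u))" by (rule complex_Re_le_cmod)
  finally show ?thesis by simp
qed

text \<open>Borel-Cantelli, applied to the sets \<open>U\<close> under \<open>\<sigma>\<close> and to their complements under Lebesgue measure.\<close>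

lemma singular_lebesgue_criterion:
  assumes \<sigma>: "sets \<sigma> = sets borel" "finite_measure \<sigma>" "emeasure \<sigma> (UNIV - {0..<1}) = 0"
    and small: "\<And>\<epsilon>. \<epsilon> > 0 \<Longrightarrow> \<exists>U\<in>sets borel. measure \<sigma> U \<le> \<epsilon> \<and> measure lborel ({0..<1} - U) \<le> \<epsilon>"
  shows "singular_lebesgue \<sigma>"
proof -
  interpret finite_measure \<sigma> by fact
  have "\<forall>n::nat. \<exists>U\<in>sets borel. measure \<sigma> U \<le> (1 / 2) ^ n \<and> measure lborel ({0..<1} - U) \<le> (1 / 2) ^ n"
    using small by simp
  then obtain U where U: "\<And>n::nat. U n \<in> sets borel" "\<And>n. measure \<sigma> (U n) \<le> (1 / 2) ^ n"
      "\<And>n. measure lborel ({0..<1} - U n) \<le> (1 / 2) ^ n" by metis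
  let ?A = "\<lambda>n. {0..<1} - U n :: real set"
  have sum: "summable (\<lambda>n. (1 / 2 :: real) ^ n)" by simp
  have "limsup ?A \<in> null_sets lborel"
  proof (rule borel_cantelli_limsup1)
    show "?A n \<in> sets lborel" for n using U(1) by auto
    show "emeasure lborel (?A n) < \<infinity>" for n
    proof -
      have "emeasure lborel (?A n) \<le> emeasure lborel {0..<1::real}" by (rule emeasure_mono) auto
      also have "\<dots> < \<infinity>" by simp
      finally show ?thesis .
    qed
    show "summable (\<lambda>n. measure lborel (?A n))"
      by (rule summable_comparison_test'[OF sum, of 0]) (use U(3) in auto)
  qed
  moreover have "limsup U \<in> null_sets \<sigma>"
  proof (rule borel_cantelli_limsup1)
    show "U n \<in> sets \<sigma>" for n using U(1) \<sigma>(1) by auto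
    show "emeasure \<sigma> (U n) < \<infinity>" for n by (simp add: emeasure_eq_measure)
    show "summable (\<lambda>n. measure \<sigma> (U n))"
      by (rule summable_comparison_test'[OF sum, of 0]) (use U(2) in auto)
  qed
  moreover have "UNIV - {0..<1} \<in> null_sets \<sigma>"
    using \<sigma> by (intro null_setsI) auto
  ultimately have null: "limsup ?A \<in> null_sets lborel" "limsup U \<union> (UNIV - {0..<1}) \<in> null_sets \<sigma>"
    by auto
  \<comment> \<open>A point of the unit interval outside the first limsup lies in all but finitely
    many \<open>U n\<close>, hence in the second.\<close>
  have sub: "UNIV - limsup ?A \<subseteq> limsup U \<union> (UNIV - {0..<1})"
    by (auto simp: limsup_INF_SUP) (metis atLeast_iff max.cobounded1 max.cobounded2)
  have "limsup ?A \<in> sets borel" using null(1) by auto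
  moreover have "emeasure lborel (limsup ?A) = 0" using null(1) by auto
  moreover have "emeasure \<sigma> (UNIV - limsup ?A) = 0"
  proof -
    have "emeasure \<sigma> (UNIV - limsup ?A) \<le> emeasure \<sigma> (limsup U \<union> (UNIV - {0..<1}))"
      by (rule emeasure_mono[OF sub]) (use null(2) in auto)
    then show ?thesis using null_setsD1[OF null(2)] by simp
  qed
  ultimately show ?thesis unfolding singular_lebesgue_def by blast
qed

text \<open>Cut the unit interval into \<open>6 N\<close> cells. The Dirichlet kernel centred at a good point of a cell is at
  least \<open>N / 2\<close> on the whole cell, so cells that contain a good point carry little spectral mass,
  and the other cells consist of bad points.\<close>

lemma singular_if_birkhoff_energy_small:
  assumes f: "square_integrable_on_shift \<mu> f" and spec: "spectral_measure_of \<mu> f \<sigma>"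
    and small: "\<And>\<delta>. \<delta> > 0 \<Longrightarrow> \<exists>N Bad. N > 0 \<and> Bad \<in> sets borel \<and> Bad \<subseteq> {0..1} \<and> measure lborel Bad \<le> \<delta> \<and>
      (\<forall>\<omega>\<in>{0..<1} - Bad. birkhoff_energy \<mu> f N \<omega> \<le> \<delta> * real N)"
  shows "singular_lebesgue \<sigma>"
proof (rule singular_lebesgue_criterion)
  interpret square_integrable_on_shift \<mu> f by fact
  show \<sigma>: "sets \<sigma> = sets borel" "finite_measure \<sigma>" "emeasure \<sigma> (UNIV - {0..<1}) = 0"
    using spec by (auto simp: spectral_measure_of_def)
  interpret finite_measure \<sigma> by fact
  fix \<epsilon> :: real assume "\<epsilon> > 0"
  \<comment> \<open>At most \<open>6 * N\<close> cells are collected in \<open>U\<close>, each of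
    mass at most \<open>4 * \<delta> / N\<close>, in all at most
    \<open>24 * \<delta>\<close>.\<close>
  define \<delta> where "\<delta> = \<epsilon> / 24"
  have \<delta>: "\<delta> > 0" using \<open>\<epsilon> > 0\<close> by (simp add: \<delta>_def)
  obtain N Bad where N: "N > 0" and Bad: "Bad \<in> sets borel" "Bad \<subseteq> {0..1}" "measure lborel Bad \<le> \<delta>"
      and good: "\<And>\<omega>. \<omega> \<in> {0..<1} - Bad \<Longrightarrow> birkhoff_energy \<mu> f N \<omega> \<le> \<delta> * real N"
    using small[OF \<delta>] by blast
  let ?M = "6 * N"
  let ?J = "\<lambda>i. {real i / real ?M..<(real i + 1) / real ?M}"
  define H where "H = {i. i < ?M \<and> ?J i \<inter> ({0..<1} - Bad) \<noteq> {}}"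
  define U where "U = (\<Union>i\<in>H. ?J i)"
  have finH: "finite H" unfolding H_def by simp
  have Ub: "U \<in> sets borel" unfolding U_def using finH by auto
  have cell: "measure \<sigma> (?J i) \<le> 4 * \<delta> / real N" if i: "i \<in> H" for i
  proof -
    have "?J i \<inter> ({0..<1} - Bad) \<noteq> {}" using i by (simp add: H_def)
    then obtain \<omega> where \<omega>: "\<omega> \<in> ?J i" "\<omega> \<in> {0..<1} - Bad" by blast
    let ?D = "\<lambda>t. (cmod (\<Sum>k<N. twist (real k * (t - \<omega>))))\<^sup>2"
    have "continuous_on UNIV ?D" by (intro continuous_intros)
    then have "?D \<in> borel_measurable borel" by (rule borel_measurable_continuous_onI)
    then have Dm: "?D \<in> borel_measurable \<sigma>" using measurable_cong_sets[OF \<sigma>(1) refl] by blast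
    have D_le: "?D t \<le> (real N)\<^sup>2" for t
      using sum_norm_le[of "{..<N}" "\<lambda>k. twist (real k * (t - \<omega>))" "\<lambda>_. 1"]
      by (intro power_mono) auto
    have Dint: "integrable \<sigma> ?D"
      by (rule integrable_const_bound[where B = "(real N)\<^sup>2", OF AE_I2 Dm]) (use D_le in simp)
    have sub: "?J i \<subseteq> {t \<in> space \<sigma>. (real N / 2)\<^sup>2 \<le> ?D t}"
    proof
      fix t assume t: "t \<in> ?J i"
      have "\<bar>t - \<omega>\<bar> \<le> (real i + 1) / real ?M - real i / real ?M" using t \<omega>(1) by auto
      also have "\<dots> = 1 / (6 * real N)" by (simp flip: diff_divide_distrib)
      finally have "real N / 2 \<le> cmod (\<Sum>k<N. twist (real k * (t - \<omega>)))"
        by (rule norm_dirichlet_sum_ge[OF N])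
      then have "(real N / 2)\<^sup>2 \<le> ?D t" by (intro power_mono) auto
      moreover have "t \<in> space \<sigma>" using sets_eq_imp_space_eq[OF \<sigma>(1)] by simp
      ultimately show "t \<in> {t \<in> space \<sigma>. (real N / 2)\<^sup>2 \<le> ?D t}" by blast
    qed
    have "measure \<sigma> (?J i) \<le> measure \<sigma> {t \<in> space \<sigma>. (real N / 2)\<^sup>2 \<le> ?D t}"
      by (rule finite_measure_mono[OF sub]) (use Dm in measurable)
    also have "\<dots> \<le> (\<integral>t. ?D t \<partial>\<sigma>) / (real N / 2)\<^sup>2"
      by (rule integral_Markov_inequality_measure[OF Dint sets.empty_sets]) (use N in auto)
    also have "(\<integral>t. ?D t \<partial>\<sigma>) = birkhoff_energy \<mu> f N \<omega>"
      by (rule birkhoff_energy_spectral[OF spec, symmetric])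
    also have "\<dots> / (real N / 2)\<^sup>2 \<le> \<delta> * real N / (real N / 2)\<^sup>2"
      by (intro divide_right_mono good \<omega>(2)) simp
    also have "\<dots> = 4 * \<delta> / real N" using N by (simp add: power2_eq_square field_simps)
    finally show ?thesis .
  qed
  have "measure \<sigma> U \<le> (\<Sum>i\<in>H. measure \<sigma> (?J i))"
    unfolding U_def by (rule measure_UNION_le) (use finH \<sigma>(1) in auto)
  also have "\<dots> \<le> (\<Sum>i\<in>H. 4 * \<delta> / real N)" by (intro sum_mono cell)
  also have "\<dots> = real (card H) * (4 * \<delta> / real N)" by simp
  also have "\<dots> \<le> real ?M * (4 * \<delta> / real N)"
  proof (rule mult_right_mono)
    have "card H \<le> card {..<?M}" by (rule card_mono) (auto simp: H_def)
    then show "real (card H) \<le> real ?M" by simp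
  qed (use \<delta> in simp)
  also have "\<dots> = \<epsilon>" using N by (simp add: \<delta>_def)
  finally have 1: "measure \<sigma> U \<le> \<epsilon>" .
  have "{0..<1} - U \<subseteq> Bad"
  proof
    fix t assume t: "t \<in> {0..<1} - U"
    define i where "i = nat \<lfloor>t * real ?M\<rfloor>"
    have i: "real i = of_int \<lfloor>t * real ?M\<rfloor>" using t by (simp add: i_def)
    have tJ: "t \<in> ?J i"
      using N i floor_correct[of "t * real ?M"] by (simp add: field_simps)
    have iM: "i < ?M"
    proof -
      have "t * real ?M < real ?M" using t N by simp
      then have "real i < real ?M" using i by linarith
      then show ?thesis by (simp only: of_nat_less_iff)
    qed
    show "t \<in> Bad"
    proof (rule ccontr)
      assume "t \<notin> Bad"
      with t have "t \<in> {0..<1} - Bad" by blast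
      with tJ have "?J i \<inter> ({0..<1} - Bad) \<noteq> {}" by blast
      with iM have "i \<in> H" unfolding H_def by blast
      with tJ have "t \<in> U" unfolding U_def by blast
      with t show False by blast
    qed
  qed
  then have "measure lborel ({0..<1} - U) \<le> measure lborel Bad"
  proof (rule measure_mono_fmeasurable)
    have "emeasure lborel Bad \<le> emeasure lborel {0..1::real}" using Bad(2) by (rule emeasure_mono) simp
    also have "\<dots> < \<infinity>" by simp
    finally have "emeasure lborel Bad < \<infinity>" .
    then show "Bad \<in> fmeasurable lborel" using Bad(1) by (simp add: fmeasurable_def)
  qed (use Ub in auto)
  then have 2: "measure lborel ({0..<1} - U) \<le> \<epsilon>" using Bad(3) \<open>\<epsilon> > 0\<close> by (simp add: \<delta>_def)
  show "\<exists>U\<in>sets borel. measure \<sigma> U \<le> \<epsilon> \<and> measure lborel ({0..<1} - U) \<le> \<epsilon>"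
    using Ub 1 2 by blast
qed

section \<open>Singularity of the spectrum\<close>

lemma AE_shift_space:
  assumes "invariant_prob_on \<zeta> \<mu>"
  shows "AE x in \<mu>. x \<in> subst_shift_space \<zeta>"
proof -
  interpret prob_space \<mu> using assms by (simp add: invariant_prob_on_def)
  have em: "emeasure \<mu> (subst_shift_space \<zeta>) = 1" using assms by (simp add: invariant_prob_on_def)
  \<comment> \<open>A set that is not measurable would have \<open>emeasure\<close> 0, so
    measurability of the shift space can be read off from its measure 1.\<close>
  then have "subst_shift_space \<zeta> \<in> sets \<mu>" using emeasure_notin_sets by fastforce
  moreover have "prob (subst_shift_space \<zeta>) = 1" using em by (simp add: measure_def)
  ultimately show ?thesis by (subst AE_in_set_eq_1) auto
qed

text \<open>The block bound is uniform over the shift space, which has full measure, so it survives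
  integration of the square.\<close>

lemma birkhoff_energy_window_le:
  fixes \<zeta> :: "'a::finite \<Rightarrow> 'a list"
  assumes prim: "primitive \<zeta>" and inv: "invariant_prob_on \<zeta> \<mu>"
    and g: "depends_on_window m g" "\<And>x. cmod (g x) \<le> B" "g \<in> borel_measurable \<mu>"
  obtains C where "C \<ge> 0" "\<And>\<omega> J N. (\<And>c. N \<le> length (subst_iter \<zeta> (J * K) c)) \<Longrightarrow>
    birkhoff_energy \<mu> g N \<omega> \<le> (C * (real J + 1)^2 * cocycle_growth \<zeta> K (\<chi> i. \<omega>) J)\<^sup>2"
proof -
  interpret prob_space \<mu> using inv by (simp add: invariant_prob_on_def)
  have sets: "sets \<mu> = sets full_shift_space" using inv by (simp add: invariant_prob_on_def)
  \<comment> \<open>Conjugation turns the phases \<open>twist (- real k * \<omega>)\<close> into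
    \<open>twist (\<omega> * real k)\<close>, the sign used in \<open>twisted_sum\<close>, without
    changing moduli.\<close>
  define \<phi> where "\<phi> = (\<lambda>w. cnj (g (\<lambda>i. w ! nat (i + int m))))"
  have \<phi>: "cmod (\<phi> w) \<le> B" for w using g(2) by (simp add: \<phi>_def)
  obtain C where C: "C \<ge> 0" "\<And>\<omega> J N x a. \<lbrakk>x \<in> subst_shift_space \<zeta>; \<And>c. N \<le> length (subst_iter \<zeta> (J * K) c)\<rbrakk> \<Longrightarrow>
    cmod (\<Sum>j<N. \<phi> (block x (a + int j) (2 * m + 1)) * twist (\<omega> * real j))
      \<le> C * (real J + 1)^2 * cocycle_growth \<zeta> K (\<chi> i. \<omega>) J"
    using norm_block_sum_le[OF prim, where \<phi> = \<phi> and B = B and q = "2 * m + 1" and K = K] \<phi> by blast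
  have "birkhoff_energy \<mu> g N \<omega> \<le> (C * (real J + 1)^2 * cocycle_growth \<zeta> K (\<chi> i. \<omega>) J)\<^sup>2"
    if N: "\<And>c. N \<le> length (subst_iter \<zeta> (J * K) c)" for \<omega> J N
  proof -
    let ?R = "C * (real J + 1)^2 * cocycle_growth \<zeta> K (\<chi> i. \<omega>) J"
    let ?S = "\<lambda>x. \<Sum>k<N. g (shift_pow (int k) x) * twist (- real k * \<omega>)"
    have S_eq: "cmod (?S x) = cmod (\<Sum>j<N. \<phi> (block x (- int m + int j) (2 * m + 1)) * twist (\<omega> * real j))" for x
    proof -
      have "g (shift_pow (int k) x) = cnj (\<phi> (block x (- int m + int k) (2 * m + 1)))" for k
      proof -
        have "block (shift_pow (int k) x) (- int m) (2 * m + 1) = block x (- int m + int k) (2 * m + 1)"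
          by (simp add: block_def shift_pow_def algebra_simps del: upt_Suc)
        then show ?thesis
          using depends_on_window_block[OF g(1), of "shift_pow (int k) x"] by (simp add: \<phi>_def)
      qed
      moreover have "twist (- real k * \<omega>) = cnj (twist (\<omega> * real k))" for k
        by (simp add: mult.commute flip: twist_minus)
      ultimately have "?S x = cnj (\<Sum>j<N. \<phi> (block x (- int m + int j) (2 * m + 1)) * twist (\<omega> * real j))"
        by simp
      then show ?thesis by (simp only: complex_mod_cnj)
    qed
    have bound: "AE x in \<mu>. (cmod (?S x))\<^sup>2 \<le> ?R\<^sup>2"
      using AE_shift_space[OF inv]
    proof eventually_elim
      case (elim x)
      show ?case unfolding S_eq by (intro power_mono C(2) elim N) auto
    qed
    have meas: "(\<lambda>x. (cmod (?S x))\<^sup>2) \<in> borel_measurable \<mu>"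
    proof -
      have [measurable]: "(\<lambda>x. g (shift_pow n x)) \<in> borel_measurable \<mu>" for n
        using measurable_compose[OF measurable_shift_pow[OF sets] g(3)] .
      show ?thesis by measurable
    qed
    have "integrable \<mu> (\<lambda>x. (cmod (?S x))\<^sup>2)"
      by (rule integrable_const_bound[where B = "?R\<^sup>2", OF _ meas]) (use bound in simp)
    then have "birkhoff_energy \<mu> g N \<omega> \<le> (\<integral>x. ?R\<^sup>2 \<partial>\<mu>)"
      unfolding birkhoff_energy_def by (rule integral_mono_AE) (use bound in auto)
    then show ?thesis by (simp add: prob_space)
  qed
  with C(1) that show ?thesis by blast
qed

text \<open>Rewrites the product as an exponential of the orbit sum to which
  \<open>orbit_average_in_measure\<close> applies.\<close>

lemma cocycle_growth_eq_exp:
  assumes "K > 0"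
  shows "cocycle_growth \<zeta> K \<xi> J = exp (real K *
    (\<Sum>j<J. ln (max 1 (norm (fourier_cocycle \<zeta> ((torus_endo \<zeta> ^^ (j * K)) \<xi>) K))) / real K))"
  using assms unfolding cocycle_growth_def
  by (simp add: exp_sum flip: sum_divide_distrib)

text \<open>The choices are made in the order \<open>K\<close> and \<open>\<gamma>\<close>, the
  approximation \<open>g\<close> and its constant \<open>C\<close>, then \<open>J\<close> and
  \<open>N\<close>. One bad set collects the frequencies with a large orbit average, the other those
  where the remainder \<open>f - g\<close> has large energy.\<close>

lemma birkhoff_energy_small:
  fixes \<zeta> :: "'a::finite \<Rightarrow> 'a list"
  assumes sub: "is_substitution \<zeta>" and prim: "primitive \<zeta>" and inv: "invariant_prob_on \<zeta> \<mu>"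
    and freq: "\<And>K p. K > 0 \<Longrightarrow> p \<noteq> (0::real^'a) \<Longrightarrow> \<exists>j0. \<forall>j\<ge>j0. \<bar>p \<bullet> (torus_endo \<zeta> ^^ (j * K)) (\<chi> i. 1)\<bar> <
      \<bar>p \<bullet> (torus_endo \<zeta> ^^ (Suc j * K)) (\<chi> i. 1)\<bar>"
    and u: "\<And>i. u $ i > 0" "subst_matrix \<zeta> *v u = \<theta> *\<^sub>R u" and \<theta>: "\<theta> > 1"
    and lyap: "is_lyapunov_exponent \<zeta> \<chi>'" "\<chi>' < ln \<theta> / 2"
    and f: "square_integrable_on_shift \<mu> f" and \<delta>: "\<delta> > 0"
  shows "\<exists>N Bad. N > 0 \<and> Bad \<in> sets borel \<and> Bad \<subseteq> {0..1} \<and> measure lborel Bad \<le> \<delta> \<and>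
      (\<forall>\<omega>\<in>{0..<1} - Bad. birkhoff_energy \<mu> f N \<omega> \<le> \<delta> * real N)"
proof -
  interpret f: square_integrable_on_shift \<mu> f by fact
  have prob: "prob_space \<mu>" using inv by (simp add: invariant_prob_on_def)
  interpret U: prob_space unit_measure by (rule prob_space_unit_measure)
  have "max \<chi>' 0 < ln \<theta> / 2" using lyap(2) ln_gt_zero[OF \<theta>] by (simp only: max_less_iff_conj) simp
  then obtain K where K: "K > 0"
      "(\<integral>\<xi>. ln (max 1 (norm (fourier_cocycle \<zeta> \<xi> K))) / real K \<partial>box_measure) < ln \<theta> / 2"
    using exists_block_length[OF lyap(1)] by blast
  define F where "F = (\<lambda>\<xi>. ln (max 1 (norm (fourier_cocycle \<zeta> \<xi> K))) / real K)"
  \<comment> \<open>The strict gap on the right beats the polynomial factor in \<open>J\<close>; the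
    one on the left makes the bad set small.\<close>
  obtain \<gamma> where \<gamma>: "(\<integral>\<xi>. F \<xi> \<partial>box_measure) < \<gamma>" "\<gamma> < ln \<theta> / 2"
    using K(2) dense unfolding F_def by blast
  have F_cont: "continuous_on UNIV F"
    unfolding F_def using K(1) by (intro continuous_intros continuous_on_max) auto
  have F_per: "int_periodic F"
    using int_periodic_fourier_cocycle[of \<zeta> K] unfolding F_def int_periodic_def by metis
  obtain C0 where C0: "C0 \<ge> 1" "\<And>\<xi>. norm (fourier_matrix \<zeta> \<xi>) \<le> C0" using fourier_matrix_bounded[of \<zeta>] by blast
  define D where "D = C0 ^ K * norm (mat 1 :: complex^'a^'a)"
  have F_bd: "\<bar>F \<xi>\<bar> \<le> ln (max 1 D) / real K" for \<xi>
  proof -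
    have "max 1 (norm (fourier_cocycle \<zeta> \<xi> K)) \<le> max 1 D"
      using norm_fourier_cocycle_le[of \<zeta> C0 \<xi> K, OF C0(2)] unfolding D_def by linarith
    then have "ln (max 1 (norm (fourier_cocycle \<zeta> \<xi> K))) \<le> ln (max 1 D)" by simp
    then show ?thesis unfolding F_def by (simp add: abs_of_nonneg divide_right_mono)
  qed
  let ?X = "\<lambda>j \<omega>. (torus_endo \<zeta> ^^ (j * K)) (\<chi> i. \<omega>)"
  define Bad1 where "Bad1 = (\<lambda>J. {\<omega>\<in>{0..1}. real J * \<gamma> < (\<Sum>j<J. F (?X j \<omega>))})"
  have "(\<lambda>J. measure lborel (Bad1 J)) \<longlonglongrightarrow> 0"
    unfolding Bad1_def by (rule orbit_average_in_measure[OF freq[OF K(1)] F_cont F_per F_bd \<gamma>(1)])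
  then have ev1: "\<forall>\<^sub>F J in sequentially. measure lborel (Bad1 J) < \<delta> / 2"
    using \<delta> by (intro order_tendstoD(2)) auto

  have "window_approx \<mu> f"
    by (rule window_approx_square_integrable[OF f.sets_\<mu> prob f.measurable_f f.square_integrable])
  \<comment> \<open>Markov's inequality at level \<open>\<delta> * N / 4\<close> turns this into
    \<open>4 / \<delta>\<close> times as much, which leaves \<open>\<delta> / 2\<close> for the
    second bad set.\<close>
  moreover have "\<delta>\<^sup>2 / 8 > 0" using \<delta> by simp
  ultimately obtain m g B where g: "g \<in> borel_measurable \<mu>" "depends_on_window m g" "\<forall>x. cmod (g x) \<le> B"
      "integrable \<mu> (\<lambda>x. (cmod (f x - g x))\<^sup>2)" "(\<integral>x. (cmod (f x - g x))\<^sup>2 \<partial>\<mu>) < \<delta>\<^sup>2 / 8"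
    unfolding window_approx_def by blast
  interpret mu: prob_space \<mu> by fact
  have sq_g: "square_integrable_on_shift \<mu> g"
  proof
    show "integrable \<mu> (\<lambda>x. (cmod (g x))\<^sup>2)"
    proof (rule mu.integrable_const_bound[where B = "B\<^sup>2"])
      have "(cmod (g x))\<^sup>2 \<le> B\<^sup>2" for x using g(3) by (intro power_mono) auto
      then show "AE x in \<mu>. norm ((cmod (g x))\<^sup>2) \<le> B\<^sup>2" by simp
    qed (use g(1) in measurable)
  qed (use g f.sets_\<mu> f.invariant in auto)
  have sq_d: "square_integrable_on_shift \<mu> (\<lambda>x. f x - g x)"
    by standard (use g f.sets_\<mu> f.invariant f.measurable_f in auto)
  interpret d: square_integrable_on_shift \<mu> "\<lambda>x. f x - g x" by fact
  obtain C where C: "C \<ge> 0" "\<And>\<omega> J N. (\<And>c. N \<le> length (subst_iter \<zeta> (J * K) c)) \<Longrightarrow>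
    birkhoff_energy \<mu> g N \<omega> \<le> (C * (real J + 1)^2 * cocycle_growth \<zeta> K (\<chi> i. \<omega>) J)\<^sup>2"
    using birkhoff_energy_window_le[OF prim inv g(2) _ g(1), of B K] g(3) by blast
  obtain c where c: "c > 0" "\<And>n a. c * \<theta> ^ n \<le> real (length (subst_iter \<zeta> n a))"
    using length_subst_iter_lower_bound[OF sub prim u \<theta>] by blast

  \<comment> \<open>\<open>\<kappa>\<close> is the exponential gap per block between
    \<open>\<theta> ^ K\<close> and the square of the cocycle bound.\<close>
  define \<kappa> where "\<kappa> = real K * (ln \<theta> - 2 * \<gamma>)"
  have \<kappa>: "\<kappa> > 0" using K(1) \<gamma>(2) by (simp add: \<kappa>_def)
  have "((\<lambda>J. C\<^sup>2 * (real J + 1) ^ 4 * exp (- \<kappa> * real J)) \<longlongrightarrow> 0) sequentially"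
    using \<kappa> by real_asymp
  moreover have "\<delta> / 4 * c > 0" using \<delta> c(1) by simp
  ultimately have "\<forall>\<^sub>F J in sequentially. C\<^sup>2 * (real J + 1) ^ 4 * exp (- \<kappa> * real J) < \<delta> / 4 * c"
    by (rule order_tendstoD(2))
  with ev1 have "\<forall>\<^sub>F J in sequentially. measure lborel (Bad1 J) < \<delta> / 2 \<and>
      C\<^sup>2 * (real J + 1) ^ 4 * exp (- \<kappa> * real J) < \<delta> / 4 * c" by eventually_elim simp
  then obtain J where J: "measure lborel (Bad1 J) < \<delta> / 2"
      "C\<^sup>2 * (real J + 1) ^ 4 * exp (- \<kappa> * real J) < \<delta> / 4 * c"
    by (auto simp: eventually_sequentially)
  \<comment> \<open>The largest length that the block bound admits for every letter; it is still at
    least \<open>c * \<theta> ^ (J * K)\<close>.\<close>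
  define N where "N = Min (range (\<lambda>a. length (subst_iter \<zeta> (J * K) a)))"
  have N_le: "N \<le> length (subst_iter \<zeta> (J * K) a)" for a unfolding N_def by (rule Min_le) auto
  have "N \<in> range (\<lambda>a. length (subst_iter \<zeta> (J * K) a))" unfolding N_def by (rule Min_in) auto
  then obtain a where a: "N = length (subst_iter \<zeta> (J * K) a)" by blast
  have N: "N > 0" using length_subst_iter_pos[OF sub] a by simp
  have N_ge: "c * \<theta> ^ (J * K) \<le> real N" using c(2) a by simp

  define Bad2 where "Bad2 = {\<omega> \<in> space unit_measure. \<delta> * real N / 4 \<le> birkhoff_energy \<mu> (\<lambda>x. f x - g x) N \<omega>}"
  have Bad2_sub: "Bad2 \<subseteq> {0..1}" by (auto simp: Bad2_def space_restrict_space)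
  have "Bad2 \<in> sets unit_measure"
    unfolding Bad2_def using borel_measurable_integrable[OF d.integrable_birkhoff_energy[of N]] by measurable
  then have Bad2_sets: "Bad2 \<in> sets borel" by (simp add: sets_restrict_space_iff)
  have "measure lborel Bad2 = measure unit_measure Bad2"
    by (subst measure_restrict_space) (use Bad2_sub in auto)
  also have "\<dots> \<le> (\<integral>\<omega>. birkhoff_energy \<mu> (\<lambda>x. f x - g x) N \<omega> \<partial>unit_measure) / (\<delta> * real N / 4)"
    unfolding Bad2_def
    by (rule integral_Markov_inequality_measure[OF d.integrable_birkhoff_energy sets.empty_sets])
      (use \<delta> N in \<open>auto simp: birkhoff_energy_def\<close>)
  also have "\<dots> = (\<integral>x. (cmod (f x - g x))\<^sup>2 \<partial>\<mu>) * (4 / \<delta>)"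
    unfolding d.integral_birkhoff_energy using N \<delta> by (simp add: field_simps)
  also have "\<dots> \<le> \<delta>\<^sup>2 / 8 * (4 / \<delta>)" using g(5) \<delta> by (intro mult_right_mono) auto
  also have "\<dots> = \<delta> / 2" using \<delta> by (simp add: power2_eq_square)
  finally have Bad2: "measure lborel Bad2 \<le> \<delta> / 2" .

  have Bad1_sets: "Bad1 J \<in> sets borel"
  proof -
    have "continuous_on UNIV (\<lambda>\<omega>. \<Sum>j<J. F (?X j \<omega>))"
      by (intro continuous_on_sum continuous_on_compose2[OF F_cont]) (auto intro!: continuous_intros)
    then have [measurable]: "(\<lambda>\<omega>. \<Sum>j<J. F (?X j \<omega>)) \<in> borel_measurable borel" by (rule borel_measurable_continuous_onI)
    have "Bad1 J = {0..1} \<inter> {\<omega> \<in> space borel. real J * \<gamma> < (\<Sum>j<J. F (?X j \<omega>))}" by (auto simp: Bad1_def)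
    also have "\<dots> \<in> sets borel" by (intro sets.Int) measurable
    finally show ?thesis .
  qed
  have "birkhoff_energy \<mu> f N \<omega> \<le> \<delta> * real N" if \<omega>: "\<omega> \<in> {0..<1} - (Bad1 J \<union> Bad2)" for \<omega>
  proof -
    have 1: "(\<Sum>j<J. F (?X j \<omega>)) \<le> real J * \<gamma>" using \<omega> by (auto simp: Bad1_def)
    have 2: "birkhoff_energy \<mu> (\<lambda>x. f x - g x) N \<omega> \<le> \<delta> * real N / 4"
      using \<omega> by (auto simp: Bad2_def space_restrict_space)
    have "cocycle_growth \<zeta> K (\<chi> i. \<omega>) J \<le> exp (real K * (real J * \<gamma>))"
      unfolding cocycle_growth_eq_exp[OF K(1)] using 1 K(1) by (simp add: F_def)
    then have "(C * (real J + 1)^2 * cocycle_growth \<zeta> K (\<chi> i. \<omega>) J)\<^sup>2 \<le>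
        (C * (real J + 1)^2 * exp (real K * (real J * \<gamma>)))\<^sup>2"
      using C(1) cocycle_growth_ge_1[of \<zeta> K "\<chi> i. \<omega>" J] by (intro power_mono mult_left_mono) auto
    also have "\<dots> = C\<^sup>2 * (real J + 1) ^ 4 * exp (- \<kappa> * real J) * \<theta> ^ (J * K)"
    proof -
      have "(exp (real K * (real J * \<gamma>)))\<^sup>2 = exp (- \<kappa> * real J) * exp (real (J * K) * ln \<theta>)"
        by (simp add: \<kappa>_def power2_eq_square algebra_simps flip: exp_add)
      also have "exp (real (J * K) * ln \<theta>) = \<theta> ^ (J * K)"
        using \<theta> by (subst exp_of_nat_mult) simp
      finally show ?thesis by (simp add: power_mult_distrib flip: power_mult)
    qed
    also have "\<dots> \<le> \<delta> / 4 * c * \<theta> ^ (J * K)"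
      using J(2) \<theta> by (intro mult_right_mono) auto
    also have "\<dots> = \<delta> / 4 * (c * \<theta> ^ (J * K))" by simp
    also have "\<dots> \<le> \<delta> / 4 * real N" using N_ge \<delta> by (intro mult_left_mono) auto
    finally have "birkhoff_energy \<mu> g N \<omega> \<le> \<delta> * real N / 4"
      using C(2)[of N J \<omega>, OF N_le] by simp
    \<comment> \<open>Both parts have energy at most \<open>\<delta> * N / 4\<close>, and the
      inequality for sums doubles each.\<close>
    then show ?thesis
      using birkhoff_energy_add_le[OF sq_d sq_g, of N \<omega>] 2 by simp
  qed
  moreover have "measure lborel (Bad1 J \<union> Bad2) \<le> \<delta>"
    using measure_Un_le[of "Bad1 J" lborel Bad2] Bad1_sets Bad2_sets J(1) Bad2 by simp
  moreover have "Bad1 J \<union> Bad2 \<subseteq> {0..1}" using Bad2_sub by (auto simp: Bad1_def)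
  ultimately show ?thesis using N Bad1_sets Bad2_sets
    by (intro exI[of _ N] exI[of _ "Bad1 J \<union> Bad2"]) auto
qed

theorem theorem2p5:
  fixes \<zeta> :: "'a::finite \<Rightarrow> 'a list" and \<mu> :: "(int \<Rightarrow> 'a) measure" and \<chi>' :: real
  assumes "CARD('a) = 2"
    and "is_substitution \<zeta>"
    and "primitive \<zeta>"
    and "aperiodic \<zeta>"
    and "\<not> constant_length \<zeta>"
    and "\<exists>l1 l2 :: int. l1 \<noteq> l2 \<and> is_eigenvalue (subst_matrix \<zeta>) (of_int l1) \<and>
           is_eigenvalue (subst_matrix \<zeta>) (of_int l2) \<and> \<bar>l1\<bar> > 1 \<and> \<bar>l2\<bar> > 1"
    and "is_lyapunov_exponent \<zeta> \<chi>'"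
    and "\<chi>' < ln (pf_eigenvalue (subst_matrix \<zeta>)) / 2"
    and "invariant_prob_on \<zeta> \<mu>"
  shows "pure_singular_spectrum \<mu>"
proof -
  let ?S = "subst_matrix \<zeta>"
  obtain l1 l2 :: real where l: "l1 \<noteq> l2" "is_eigenvalue ?S l1" "is_eigenvalue ?S l2" "\<bar>l1\<bar> > 1" "\<bar>l2\<bar> > 1"
  proof -
    from assms(6) obtain k1 k2 :: int where k: "k1 \<noteq> k2" "is_eigenvalue ?S (of_int k1)"
      "is_eigenvalue ?S (of_int k2)" "\<bar>k1\<bar> > 1" "\<bar>k2\<bar> > 1" by blast
    have "\<bar>real_of_int k\<bar> > 1" if "\<bar>k\<bar> > 1" for k using that by linarith
    with k that[of "of_int k1" "of_int k2"] show ?thesis by simp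
  qed
  \<comment> \<open>The moduli differ by primitivity, so the eigenvalues can be named by size; the
    larger one is then identified with the Perron-Frobenius eigenvalue.\<close>
  have "\<exists>l1 l2 v1 v2. 1 < \<bar>l2\<bar> \<and> \<bar>l2\<bar> < \<bar>l1\<bar> \<and> v1 \<noteq> 0 \<and> v2 \<noteq> 0 \<and> ?S *v v1 = l1 *\<^sub>R v1 \<and> ?S *v v2 = l2 *\<^sub>R v2"
  proof -
    obtain v1 v2 where v: "v1 \<noteq> 0" "v2 \<noteq> 0" "?S *v v1 = l1 *\<^sub>R v1" "?S *v v2 = l2 *\<^sub>R v2"
      using l(2,3) by (auto simp: is_eigenvalue_def)
    have "\<bar>l1\<bar> \<noteq> \<bar>l2\<bar>"
      by (rule primitive_abs_eigenvalues_neq[OF assms(1,3) l(1) v])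
    then have "\<bar>l2\<bar> < \<bar>l1\<bar> \<or> \<bar>l1\<bar> < \<bar>l2\<bar>" by linarith
    then show ?thesis using l(4,5) v by blast
  qed
  then obtain \<theta> l v1 v2 where ev: "1 < \<bar>l\<bar>" "\<bar>l\<bar> < \<bar>\<theta>\<bar>" "v1 \<noteq> 0" "v2 \<noteq> 0"
      "?S *v v1 = \<theta> *\<^sub>R v1" "?S *v v2 = l *\<^sub>R v2" by blast
  obtain u where u: "\<And>i. u $ i > 0" "?S *v u = \<theta> *\<^sub>R u" "\<theta> > 0"
    using perron_vector_exists[OF assms(1,3) ev(2-6)] by blast
  have \<theta>: "\<theta> > 1" using ev u(3) by simp
  have pf: "pf_eigenvalue ?S = \<theta>" by (rule pf_eigenvalue_eqI[OF subst_matrix_nonneg u(1,2)])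
  have freq: "\<exists>j0. \<forall>j\<ge>j0. \<bar>p \<bullet> (torus_endo \<zeta> ^^ (j * K)) (\<chi> i. 1)\<bar> <
      \<bar>p \<bullet> (torus_endo \<zeta> ^^ (Suc j * K)) (\<chi> i. 1)\<bar>" if "K > 0" "p \<noteq> (0::real^'a)" for K p
    using frequencies_eventually_increasing[OF assms(1,5) ev that] by blast
  show ?thesis
    unfolding pure_singular_spectrum_def
  proof (intro allI impI, elim conjE)
    fix f \<sigma>
    assume f: "f \<in> borel_measurable \<mu>" "integrable \<mu> (\<lambda>x. (cmod (f x))\<^sup>2)"
      and spec: "spectral_measure_of \<mu> f \<sigma>"
    have sq: "square_integrable_on_shift \<mu> f"
      by standard (use f assms(9) in \<open>auto simp: invariant_prob_on_def\<close>)
    show "singular_lebesgue \<sigma>"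
      by (rule singular_if_birkhoff_energy_small[OF sq spec])
        (rule birkhoff_energy_small[OF assms(2,3,9) freq u(1,2) \<theta> assms(7) assms(8)[unfolded pf] sq])
  qed
qed

end
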